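(* Let $n\geq1$. The ring $\Gamma[X_n]$ is a free $\Gamma[X_n]^{S_n}$-module with basis $\{\mathfrak{S}_\varpi(X)\}$ for $\varpi\in S_n$. The ring $\Gamma[X_n]^{S_n}$ is a free $\Gamma^{(n)}$-module with basis $\{\widetilde{Q}_\lambda(-X_n)\}$ for $\lambda\in\mathcal{P}_n$. The ring $\Gamma[X_n]$ is a free $\Gamma^{(n)}$-module on the basis $\{\mathfrak{C}_w(X_n)\}$ of single type C Schubert polynomials for $w\in W_n$, and is also free on the product basis $\{\widetilde{Q}_\lambda(-X_n)\,\mathfrak{S}_\varpi(X)\}$ for $\lambda\in\mathcal{P}_n$ and $\varpi\in S_n$.
   Context: $c_1,c_2,\ldots$ are commuting variables, $c_0:=1$, $c_p:=0$ for $p<0$; $\Gamma$ is the quotient of $\mathbb{Z}[c_1,c_2,\ldots]$ by the relations $c_p^2+2\sum_{i=1}^p(-1)^ic_{p+i}c_{p-i}=0$, $p\geq1$. $X=(x_1,x_2,\ldots)$, $Y=(y_1,y_2,\ldots)$ are independent variables, $X_n=(x_1,\ldots,x_n)$, $-X_n=(-x_1,\ldots,-x_n)$. $e_p(X_n)$ is the elementary symmetric polynomial ($0$ for $p<0$ or $p>n$), ${}^nc_p:=\sum_{j=0}^pc_{p-j}e_j(X_n)$, and $\Gamma^{(n)}:=\mathbb{Z}[{}^nc_1,{}^nc_2,\ldots]\subset\Gamma[X_n]$. $S_n$ acts on $\Gamma[X_n]$ by permuting $x_1,\ldots,x_n$ and fixing $\Gamma$. $\mathfrak{S}_\varpi(X)$,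 $\varpi\in S_n$, are the Lascoux–Schützenberger (type A) single Schubert polynomials. $\mathcal{P}_n$ is the set of strict partitions $\lambda$ with $\lambda_1\leq n$ (including the empty one). For a partition $\lambda$ of length $\ell$, $\widetilde{Q}_\lambda(X_n):=\prod_{1\leq i<j\leq\ell}\frac{1-R_{ij}}{1+R_{ij}}\,e_\lambda(X_n)$, where $e_\alpha:=\prod_ie_{\alpha_i}$, $R_{ij}\alpha=(\ldots,\alpha_i+1,\ldots,\alpha_j-1,\ldots)$, each monomial $R$ in the $R_{ij}$ acts by $R\,e_\alpha:=e_{R\alpha}$, and the operator is expanded as a power series in the $R_{ij}$. $W_k$ is the group of signed permutations of $\{1,\ldots,k\}$, $W_\infty=\bigcup_kW_k$, generated by $s_i=(i,i+1)$, $i\geq1$, and the sign change $s_0$ of $1$; $\ell$ is the length. $W_\infty$ acts on $\Gamma[X,Y]$ by ring automorphisms: $s_i$ ($i\geq1$) interchanges $x_i,x_{i+1}$ and fixes all other variables and all $c_p$; $s_0$ sends $x_1\mapsto-x_1$, fixes $x_j$ ($j\geq2$) and all $y_j$, and $s_0(c_p)=c_p+2\sum_{j=1}^px_1^jc_{p-j}$. $\partial_0^xf=\frac{f-s_0f}{-2x_1}$, $\partial_i^xf=\frac{f-s_if}{x_i-x_{i+1}}$ ($i\geq1$); $\omega$ is the ring involution with $\omega(x_j)=-y_j$, $\omega(y_j)=-x_j$, $\omega(c_p)=c_p$, and $\partial_i^y=\omega\partial_i^x\omega$. $\mathfrak{C}_w(X,Y)$, $w\in W_\infty$, is the unique family in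 $\Gamma[X,Y]$ such that for all $i\geq0$: $\partial_i^x\mathfrak{C}_w=\mathfrak{C}_{ws_i}$ if $\ell(ws_i)<\ell(w)$ and $0$ otherwise; $\partial_i^y\mathfrak{C}_w=\mathfrak{C}_{s_iw}$ if $\ell(s_iw)<\ell(w)$ and $0$ otherwise; and the constant term of $\mathfrak{C}_w$ is $\delta_{w,1}$. For $w\in W_n$, $\mathfrak{C}_w(X_n):=\mathfrak{C}_w(X,0)\in\Gamma[X_n]$. *)

theory Defs
  imports
    "HOL-Library.Poly_Mapping"
    "HOL-Library.Groups_Big_Fun"
    "HOL-Combinatorics.Permutations"
    "HOL-Computational_Algebra.Formal_Power_Series"
begin

section \<open>Polynomials in arbitrarily many variables\<close>

type_synonym ('v, 'a) mpol = "('v \<Rightarrow>\<^sub>0 nat) \<Rightarrow>\<^sub>0 'a"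

definition mvar :: "'v \<Rightarrow> ('v, 'a::zero_neq_one) mpol" where
  "mvar v = Poly_Mapping.single (Poly_Mapping.single v 1) 1"

definition mconst :: "'a::zero \<Rightarrow> ('v, 'a) mpol" where
  "mconst a = Poly_Mapping.single 0 a"

definition mono_eval :: "('v \<Rightarrow> 'b::comm_ring_1) \<Rightarrow> ('v \<Rightarrow>\<^sub>0 nat) \<Rightarrow> 'b" where
  "mono_eval \<sigma> m = (\<Prod>v\<in>Poly_Mapping.keys m. \<sigma> v ^ Poly_Mapping.lookup m v)"

text \<open>Substitution: apply \<open>\<phi>\<close> to the coefficients and replace each variable \<open>v\<close> by \<open>\<sigma> v\<close>.\<close>

definition peval :: "('a::zero \<Rightarrow> 'b::comm_ring_1) \<Rightarrow> ('v \<Rightarrow> 'b) \<Rightarrow> ('v, 'a) mpol \<Rightarrow> 'b" where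
  "peval \<phi> \<sigma> f =
     (\<Sum>m\<in>Poly_Mapping.keys f. \<phi> (Poly_Mapping.lookup f m) * mono_eval \<sigma> m)"

definition is_ring_hom :: "('a::comm_ring_1 \<Rightarrow> 'b::comm_ring_1) \<Rightarrow> bool" where
  "is_ring_hom h \<longleftrightarrow> h 1 = 1 \<and> (\<forall>a b. h (a + b) = h a + h b) \<and> (\<forall>a b. h (a * b) = h a * h b)"

lemma is_ring_hom_zero: "is_ring_hom h \<Longrightarrow> h 0 = 0"
  unfolding is_ring_hom_def by (metis add_cancel_right_right)

lemma is_ring_hom_of_int: "is_ring_hom of_int"
  by (simp add: is_ring_hom_def)

lemma mono_eval_superset:
  assumes "finite S" "Poly_Mapping.keys m \<subseteq> S"
  shows "mono_eval \<sigma> m = (\<Prod>v\<in>S. \<sigma> v ^ Poly_Mapping.lookup m v)"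
  unfolding mono_eval_def using assms
  by (intro prod.mono_neutral_left) (auto simp: in_keys_iff)

lemma mono_eval_add: "mono_eval \<sigma> (m + m') = mono_eval \<sigma> m * mono_eval \<sigma> m'"
proof -
  let ?S = "Poly_Mapping.keys m \<union> Poly_Mapping.keys m'"
  have "mono_eval \<sigma> (m + m') = (\<Prod>v\<in>?S. \<sigma> v ^ Poly_Mapping.lookup (m + m') v)"
    using Poly_Mapping.keys_add[of m m'] by (intro mono_eval_superset) auto
  also have "\<dots> = (\<Prod>v\<in>?S. \<sigma> v ^ Poly_Mapping.lookup m v)
                 * (\<Prod>v\<in>?S. \<sigma> v ^ Poly_Mapping.lookup m' v)"
    by (simp add: lookup_add power_add prod.distrib)
  also have "\<dots> = mono_eval \<sigma> m * mono_eval \<sigma> m'"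
    using mono_eval_superset[of ?S m \<sigma>] mono_eval_superset[of ?S m' \<sigma>] by simp
  finally show ?thesis .
qed

lemma peval_superset:
  assumes "finite S" "Poly_Mapping.keys f \<subseteq> S" "\<phi> 0 = 0"
  shows "peval \<phi> \<sigma> f = (\<Sum>m\<in>S. \<phi> (Poly_Mapping.lookup f m) * mono_eval \<sigma> m)"
  unfolding peval_def using assms
  by (intro sum.mono_neutral_left) (auto simp: in_keys_iff)

lemma peval_single: "\<phi> 0 = 0 \<Longrightarrow> peval \<phi> \<sigma> (Poly_Mapping.single m a) = \<phi> a * mono_eval \<sigma> m"
  by (subst peval_superset[of "{m}"]) auto

lemma peval_add:
  assumes "is_ring_hom \<phi>"
  shows "peval \<phi> \<sigma> (f + g) = peval \<phi> \<sigma> f + peval \<phi> \<sigma> g"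
proof -
  let ?S = "Poly_Mapping.keys f \<union> Poly_Mapping.keys g"
  have z: "\<phi> 0 = 0" and a: "\<And>a b. \<phi> (a + b) = \<phi> a + \<phi> b"
    using assms is_ring_hom_zero by (auto simp: is_ring_hom_def)
  have "peval \<phi> \<sigma> (f + g)
      = (\<Sum>m\<in>?S. \<phi> (Poly_Mapping.lookup (f + g) m) * mono_eval \<sigma> m)"
    using Poly_Mapping.keys_add[of f g] by (intro peval_superset) (auto simp: z)
  also have "\<dots> = (\<Sum>m\<in>?S. \<phi> (Poly_Mapping.lookup f m) * mono_eval \<sigma> m)
                + (\<Sum>m\<in>?S. \<phi> (Poly_Mapping.lookup g m) * mono_eval \<sigma> m)"
    by (simp add: lookup_add a distrib_right sum.distrib)
  also have "\<dots> = peval \<phi> \<sigma> f + peval \<phi> \<sigma> g"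
    using peval_superset[of ?S f \<phi> \<sigma>] peval_superset[of ?S g \<phi> \<sigma>] z by simp
  finally show ?thesis .
qed

lemma peval_sum:
  assumes "is_ring_hom \<phi>"
  shows "peval \<phi> \<sigma> (sum F A) = (\<Sum>i\<in>A. peval \<phi> \<sigma> (F i))"
proof -
  have "peval \<phi> \<sigma> 0 = 0" by (simp add: peval_def)
  then show ?thesis
    by (induction A rule: infinite_finite_induct) (simp_all add: peval_add[OF assms])
qed

lemma mpol_expand:
  "f = (\<Sum>m\<in>Poly_Mapping.keys f. Poly_Mapping.single m (Poly_Mapping.lookup f m))"
proof (rule poly_mapping_eqI)
  fix k
  show "Poly_Mapping.lookup f k =
    Poly_Mapping.lookup (\<Sum>m\<in>Poly_Mapping.keys f. Poly_Mapping.single m (Poly_Mapping.lookup f m)) k"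
    by (cases "k \<in> Poly_Mapping.keys f")
       (auto simp: lookup_sum lookup_single when_def in_keys_iff sum.delta')
qed

lemma peval_mult:
  assumes h: "is_ring_hom \<phi>"
  shows "peval \<phi> \<sigma> (f * g) = peval \<phi> \<sigma> f * peval \<phi> \<sigma> g"
proof -
  let ?K = Poly_Mapping.keys and ?L = Poly_Mapping.lookup
  have z: "\<phi> 0 = 0" and m: "\<And>a b. \<phi> (a * b) = \<phi> a * \<phi> b"
    using h is_ring_hom_zero by (auto simp: is_ring_hom_def)
  have "f * g = (\<Sum>k\<in>?K f. Poly_Mapping.single k (?L f k))
              * (\<Sum>l\<in>?K g. Poly_Mapping.single l (?L g l))"
    using mpol_expand[of f] mpol_expand[of g] by simp
  also have "\<dots> = (\<Sum>k\<in>?K f. \<Sum>l\<in>?K g. Poly_Mapping.single (k + l) (?L f k * ?L g l))"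
    by (simp add: sum_product mult_single)
  finally have "peval \<phi> \<sigma> (f * g)
      = (\<Sum>k\<in>?K f. \<Sum>l\<in>?K g. (\<phi> (?L f k) * mono_eval \<sigma> k) * (\<phi> (?L g l) * mono_eval \<sigma> l))"
    by (simp add: peval_sum[OF h] peval_single z m mono_eval_add algebra_simps)
  then show ?thesis
    by (simp add: peval_def sum_product)
qed

lemma peval_ring_hom:
  assumes "is_ring_hom \<phi>"
  shows "is_ring_hom (peval \<phi> \<sigma>)"
proof -
  have "peval \<phi> \<sigma> 1 = 1"
    using peval_single[of \<phi> \<sigma> 0 1] is_ring_hom_zero[OF assms] assms
    by (simp add: mono_eval_def is_ring_hom_def)
  then show ?thesis
    unfolding is_ring_hom_def using peval_add[OF assms] peval_mult[OF assms] by blast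
qed

lemma peval_mvar: "is_ring_hom \<phi> \<Longrightarrow> peval \<phi> \<sigma> (mvar v) = \<sigma> v"
  by (simp add: mvar_def peval_single is_ring_hom_zero)
     (simp add: is_ring_hom_def mono_eval_def)


section \<open>The ring \<open>\<Gamma>\<close>\<close>

text \<open>In \<open>\<int>[c\<^sub>1, c\<^sub>2, \<dots>]\<close> the variable with index \<open>k\<close> stands for \<open>c\<^bsub>k+1\<^esub>\<close>.\<close>

fun cpol :: "nat \<Rightarrow> (nat, int) mpol" where
  "cpol 0 = 1"
| "cpol (Suc k) = mvar k"

definition Grel :: "(nat \<Rightarrow> 'a::comm_ring_1) \<Rightarrow> nat \<Rightarrow> 'a" where
  "Grel a p = a p ^ 2 + 2 * (\<Sum>i=1..p. (-1) ^ i * a (p + i) * a (p - i))"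

definition Gideal :: "(nat, int) mpol set" where
  "Gideal = module.span (*) {Grel cpol p | p. p \<ge> 1}"

lemma module_times: "module ((*) :: 'a::comm_ring_1 \<Rightarrow> 'a \<Rightarrow> 'a)"
  by unfold_locales (simp_all add: algebra_simps)

lemmas Gideal_base = module.span_base[OF module_times,
        of _ "{Grel cpol p | p. p \<ge> 1}", folded Gideal_def]
  and Gideal_zero = module.span_zero[OF module_times,
        of "{Grel cpol p | p. p \<ge> 1}", folded Gideal_def]
  and Gideal_add = module.span_add[OF module_times,
        of _ "{Grel cpol p | p. p \<ge> 1}", folded Gideal_def]
  and Gideal_neg = module.span_neg[OF module_times,
        of _ "{Grel cpol p | p. p \<ge> 1}", folded Gideal_def]
  and Gideal_scale = module.span_scale[OF module_times,
        of _ "{Grel cpol p | p. p \<ge> 1}", folded Gideal_def]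

lemma peval_Gideal:
  fixes a :: "nat \<Rightarrow> 'a::comm_ring_1"
  assumes "a 0 = 1" "\<And>p. p \<ge> 1 \<Longrightarrow> Grel a p = 0" "f \<in> Gideal"
  shows "peval of_int (\<lambda>k. a (Suc k)) f = 0"
proof -
  let ?h = "peval of_int (\<lambda>k. a (Suc k)) :: (nat, int) mpol \<Rightarrow> 'a"
  have h: "is_ring_hom ?h" by (rule peval_ring_hom[OF is_ring_hom_of_int])
  have ad: "?h (x + y) = ?h x + ?h y" and mu: "?h (x * y) = ?h x * ?h y" and one: "?h 1 = 1"
    for x y using h by (auto simp: is_ring_hom_def)
  have z: "?h 0 = 0" using h by (rule is_ring_hom_zero)
  have neg: "?h (- x) = - ?h x" for x using ad[of x "- x"] z
    by (simp add: eq_neg_iff_add_eq_0 add.commute[of "?h x"])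
  have pw: "?h (x ^ k) = ?h x ^ k" for x k by (induction k) (simp_all add: one mu)
  have sm: "?h (sum F A) = (\<Sum>i\<in>A. ?h (F i))" for F and A :: "nat set"
    by (rule peval_sum[OF is_ring_hom_of_int])
  have two: "?h 2 = 2" using ad[of 1 1] one by simp
  have c: "?h (cpol p) = a p" for p
    by (cases p) (simp_all add: one assms(1) peval_mvar[OF is_ring_hom_of_int])
  have g: "?h (Grel cpol p) = Grel a p" for p
    by (simp add: Grel_def ad mu pw sm two neg one c)
  show ?thesis
    using assms(3) unfolding Gideal_def
  proof (induction rule: module.span_induct_alt[OF module_times, consumes 1])
    case 1 then show ?case by (rule z)
  next
    case (2 q x y)
    then show ?case using assms(2) by (auto simp: ad mu g)
  qed
qed

lemma one_notin_Gideal: "1 \<notin> Gideal"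
proof
  assume *: "1 \<in> Gideal"
  have "Grel (\<lambda>p. if p = 0 then 1 else 0 :: int) p = 0" if "p \<ge> 1" for p
    using that by (auto simp: Grel_def intro!: sum.neutral)
  then have "peval of_int (\<lambda>k. 0 :: int) (1 :: (nat, int) mpol) = 0"
    using peval_Gideal[of "\<lambda>p. if p = 0 then 1 else 0 :: int" 1] * by simp
  then show False
    using peval_ring_hom[OF is_ring_hom_of_int, of "\<lambda>k :: nat. 0 :: int"]
    unfolding is_ring_hom_def by (metis zero_neq_one)
qed

definition Geq :: "(nat, int) mpol \<Rightarrow> (nat, int) mpol \<Rightarrow> bool" where
  "Geq f g \<longleftrightarrow> f - g \<in> Gideal"

lemma Geq_equivp: "equivp Geq"
proof (rule equivpI)
  show "reflp Geq" by (simp add: reflp_def Geq_def Gideal_zero)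
  show "symp Geq"
  proof (rule sympI)
    fix f g :: "(nat, int) mpol"
    assume "Geq f g"
    then have "- (f - g) \<in> Gideal" unfolding Geq_def by (rule Gideal_neg)
    then show "Geq g f" by (simp add: Geq_def)
  qed
  show "transp Geq"
  proof (rule transpI)
    fix f g h :: "(nat, int) mpol"
    assume "Geq f g" "Geq g h"
    then have "(f - g) + (g - h) \<in> Gideal" unfolding Geq_def by (rule Gideal_add)
    then show "Geq f h" by (simp add: Geq_def)
  qed
qed

quotient_type gamma = "(nat, int) mpol" / Geq
  by (rule Geq_equivp)

instantiation gamma :: comm_ring_1
begin

lift_definition zero_gamma :: gamma is 0 .
lift_definition one_gamma :: gamma is 1 .
lift_definition plus_gamma :: "gamma \<Rightarrow> gamma \<Rightarrow> gamma" is "(+)"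
proof -
  fix f g f' g' :: "(nat, int) mpol"
  assume "Geq f g" "Geq f' g'"
  then have "(f - g) + (f' - g') \<in> Gideal" unfolding Geq_def by (rule Gideal_add)
  then show "Geq (f + f') (g + g')" by (simp add: Geq_def algebra_simps)
qed
lift_definition uminus_gamma :: "gamma \<Rightarrow> gamma" is "uminus"
proof -
  fix f g :: "(nat, int) mpol"
  assume "Geq f g"
  then have "- (f - g) \<in> Gideal" unfolding Geq_def by (rule Gideal_neg)
  then show "Geq (- f) (- g)" by (simp add: Geq_def)
qed
lift_definition minus_gamma :: "gamma \<Rightarrow> gamma \<Rightarrow> gamma" is "(-)"
proof -
  fix f g f' g' :: "(nat, int) mpol"
  assume "Geq f g" "Geq f' g'"
  then have "(f - g) + - (f' - g') \<in> Gideal"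
    unfolding Geq_def by (intro Gideal_add Gideal_neg)
  then show "Geq (f - f') (g - g')" by (simp add: Geq_def algebra_simps)
qed
lift_definition times_gamma :: "gamma \<Rightarrow> gamma \<Rightarrow> gamma" is "(*)"
proof -
  fix f g f' g' :: "(nat, int) mpol"
  assume "Geq f g" "Geq f' g'"
  then have "f' * (f - g) + g * (f' - g') \<in> Gideal"
    unfolding Geq_def by (intro Gideal_add Gideal_scale)
  then show "Geq (f * f') (g * g')" by (simp add: Geq_def algebra_simps)
qed

instance
proof
  have r: "Geq f g" if "f = g" for f g using that by (simp add: Geq_def Gideal_zero)
  fix a b c :: gamma
  show "a * b * c = a * (b * c)" by transfer (rule r, simp add: algebra_simps)
  show "a * b = b * a" by transfer (rule r, simp add: algebra_simps)
  show "1 * a = a" by transfer (rule r, simp add: algebra_simps)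
  show "a + b + c = a + (b + c)" by transfer (rule r, simp add: algebra_simps)
  show "a + b = b + a" by transfer (rule r, simp add: algebra_simps)
  show "0 + a = a" by transfer (rule r, simp add: algebra_simps)
  show "- a + a = 0" by transfer (rule r, simp add: algebra_simps)
  show "a - b = a + - b" by transfer (rule r, simp add: algebra_simps)
  show "(a + b) * c = a * c + b * c" by transfer (rule r, simp add: algebra_simps)
  show "(0::gamma) \<noteq> 1"
  proof transfer
    show "\<not> Geq 0 1"
      unfolding Geq_def using one_notin_Gideal Gideal_neg[of "- 1"] by auto
  qed
qed

end

lift_definition gc :: "nat \<Rightarrow> gamma" is cpol .

text \<open>The homomorphism out of \<open>\<Gamma>\<close> with \<open>c\<^sub>p \<mapsto> a p\<close> for \<open>p \<ge> 1\<close>. It does not depend on the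
  representative as soon as \<open>a\<close> satisfies the defining relations of \<open>\<Gamma>\<close>, see the two
  lemmas below.\<close>

definition gamma_eval :: "(nat \<Rightarrow> 'b::comm_ring_1) \<Rightarrow> gamma \<Rightarrow> 'b" where
  "gamma_eval a g = peval of_int (\<lambda>k. a (Suc k)) (rep_gamma g)"

lemma gamma_eval_abs:
  fixes a :: "nat \<Rightarrow> 'a::comm_ring_1"
  assumes "a 0 = 1" "\<And>p. p \<ge> 1 \<Longrightarrow> Grel a p = 0"
  shows "gamma_eval a (abs_gamma f) = peval of_int (\<lambda>k. a (Suc k)) f"
proof -
  let ?h = "peval of_int (\<lambda>k. a (Suc k)) :: (nat, int) mpol \<Rightarrow> 'a"
  have "Geq (rep_gamma (abs_gamma f)) f"
    by (rule Quotient3_rep_abs[OF Quotient3_gamma]) (simp add: Geq_def Gideal_zero)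
  then have "?h (rep_gamma (abs_gamma f) - f) = 0"
    using peval_Gideal[OF assms] by (simp add: Geq_def)
  moreover have "?h (rep_gamma (abs_gamma f))
      = ?h (rep_gamma (abs_gamma f) - f) + ?h f"
    using peval_add[OF is_ring_hom_of_int,
        of "\<lambda>k. a (Suc k)" "rep_gamma (abs_gamma f) - f" f] by simp
  ultimately show ?thesis by (simp add: gamma_eval_def)
qed

lemma gamma_eval_ring_hom:
  fixes a :: "nat \<Rightarrow> 'a::comm_ring_1"
  assumes "a 0 = 1" "\<And>p. p \<ge> 1 \<Longrightarrow> Grel a p = 0"
  shows "is_ring_hom (gamma_eval a)" and "gamma_eval a (gc p) = a p"
proof -
  let ?h = "peval of_int (\<lambda>k. a (Suc k)) :: (nat, int) mpol \<Rightarrow> 'a"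
  note abs = gamma_eval_abs[OF assms]
  have h: "is_ring_hom ?h" by (rule peval_ring_hom[OF is_ring_hom_of_int])
  have surj: "\<exists>f. x = abs_gamma f" for x
    by (metis Quotient3_abs_rep[OF Quotient3_gamma])
  have "gamma_eval a 1 = 1"
    using h by (simp add: one_gamma.abs_eq abs is_ring_hom_def)
  moreover have "gamma_eval a (x + y) = gamma_eval a x + gamma_eval a y" for x y
    using surj[of x] surj[of y] h by (auto simp: plus_gamma.abs_eq abs is_ring_hom_def)
  moreover have "gamma_eval a (x * y) = gamma_eval a x * gamma_eval a y" for x y
    using surj[of x] surj[of y] h by (auto simp: times_gamma.abs_eq abs is_ring_hom_def)
  ultimately show "is_ring_hom (gamma_eval a)" by (simp add: is_ring_hom_def)
  show "gamma_eval a (gc p) = a p"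
    using h by (cases p) (simp_all add: gc.abs_eq abs assms(1) peval_mvar[OF is_ring_hom_of_int] is_ring_hom_def)
qed


section \<open>The ring \<open>\<Gamma>[X, Y]\<close> and the action of the generators of \<open>W\<^sub>\<infinity>\<close>\<close>

text \<open>\<open>XV k\<close> and \<open>YV k\<close> are the variables \<open>x\<^bsub>k+1\<^esub>\<close> and \<open>y\<^bsub>k+1\<^esub>\<close>; the functions
  \<open>xv\<close> and \<open>yv\<close> below are meant for indices \<open>\<ge> 1\<close>.\<close>

datatype xyvar = XV nat | YV nat

type_synonym gxy = "(xyvar, gamma) mpol"

definition xv :: "nat \<Rightarrow> gxy" where "xv i = mvar (XV (i - 1))"
definition yv :: "nat \<Rightarrow> gxy" where "yv i = mvar (YV (i - 1))"
definition cc :: "nat \<Rightarrow> gxy" where "cc p = mconst (gc p)"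

definition perm_act :: "(nat \<Rightarrow> nat) \<Rightarrow> gxy \<Rightarrow> gxy" where
  "perm_act \<pi> = peval mconst (\<lambda>v. case v of XV k \<Rightarrow> xv (\<pi> (Suc k)) | YV k \<Rightarrow> yv (Suc k))"

definition s0c :: "nat \<Rightarrow> gxy" where
  "s0c p = cc p + 2 * (\<Sum>j=1..p. xv 1 ^ j * cc (p - j))"

definition s0_act :: "gxy \<Rightarrow> gxy" where
  "s0_act = peval (gamma_eval s0c)
     (\<lambda>v. case v of XV k \<Rightarrow> (if k = 0 then - xv 1 else xv (Suc k)) | YV k \<Rightarrow> yv (Suc k))"

text \<open>That \<open>s\<^sub>0\<close> is well defined: with \<open>c(t) = \<Sum> c\<^sub>p t\<^sup>p\<close>, the relations of \<open>\<Gamma>\<close> say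
  \<open>c(t) c(-t) = 1\<close>, and \<open>s\<^sub>0\<close> multiplies \<open>c(t)\<close> by \<open>(1 + x\<^sub>1 t)/(1 - x\<^sub>1 t)\<close>.\<close>

lemma Grel_even:
  fixes a :: "nat \<Rightarrow> 'a::comm_ring_1"
  shows "(\<Sum>i\<le>2*p. (-1) ^ i * a i * a (2 * p - i)) = (-1) ^ p * Grel a p"
proof -
  let ?f = "\<lambda>i. (-1) ^ i * a i * a (2 * p - i)"
  let ?g = "\<lambda>j. (-1) ^ p * ((-1) ^ j * a (p + j) * a (p - j))"
  have sgn: "(-1) ^ (p - j) = (-1 :: 'a) ^ p * (-1) ^ j" if "j \<le> p" for j
  proof -
    define q where "q = p - j"
    have p: "p = q + j" using that by (simp add: q_def)
    show ?thesis unfolding p by (simp add: power_add mult.assoc)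
  qed
  have low: "?f (p - j) = ?g j" if "j \<in> {1..p}" for j
  proof -
    have "2 * p - (p - j) = p + j" "j \<le> p" using that by auto
    then show ?thesis by (simp add: sgn mult.assoc mult.commute mult.left_commute)
  qed
  have high: "?f (p + j) = ?g j" if "j \<in> {1..p}" for j
  proof -
    have "2 * p - (p + j) = p - j" using that by auto
    then show ?thesis by (simp add: power_add mult.assoc)
  qed
  have "sum ?f {..2*p} = sum ?f {..<p} + (?f p + sum ?f {p<..2*p})"
  proof -
    have "{..2*p} = {..<p} \<union> insert p {p<..2*p}" by auto
    moreover have "sum ?f ({..<p} \<union> insert p {p<..2*p}) = sum ?f {..<p} + sum ?f (insert p {p<..2*p})"
      by (rule sum.union_disjoint) auto
    moreover have "sum ?f (insert p {p<..2*p}) = ?f p + sum ?f {p<..2*p}"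
      by (rule sum.insert) auto
    ultimately show ?thesis by (simp only:)
  qed
  also have "sum ?f {..<p} = sum ?g {1..p}"
  proof (rule sum.reindex_bij_witness[of _ "\<lambda>j. p - j" "\<lambda>i. p - i"])
    fix i assume "i \<in> {..<p}"
    then have "p - i \<in> {1..p}" "p - (p - i) = i" by auto
    then show "?g (p - i) = ?f i" using low[of "p - i"] by simp
  qed auto
  also have "sum ?f {p<..2*p} = sum ?g {1..p}"
  proof (rule sum.reindex_bij_witness[of _ "\<lambda>j. p + j" "\<lambda>i. i - p"])
    fix i assume "i \<in> {p<..2*p}"
    then have "i - p \<in> {1..p}" "p + (i - p) = i" by auto
    then show "?g (i - p) = ?f i" using high[of "i - p"] by simp
  qed auto
  also have "sum ?g {1..p} = (-1) ^ p * (\<Sum>j=1..p. (-1) ^ j * a (p + j) * a (p - j))"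
    by (simp only: sum_distrib_left)
  also have "?f p = (-1) ^ p * a p ^ 2"
    by (simp add: power2_eq_square mult.assoc)
  finally show ?thesis
    by (simp only: Grel_def mult_2 distrib_left add_ac)
qed

lemma Grel_odd:
  fixes a :: "nat \<Rightarrow> 'a::comm_ring_1"
  shows "(\<Sum>i\<le>2*p+1. (-1) ^ i * a i * a (2 * p + 1 - i)) = 0"
proof -
  let ?N = "2 * p + 1"
  let ?f = "\<lambda>i. (-1) ^ i * a i * a (?N - i)"
  have sym: "- ?f (?N - i) = ?f i" if "i \<le> ?N" for i
  proof -
    define q where "q = ?N - i"
    have q: "?N = q + i" using that by (simp add: q_def)
    have "(-1 :: 'a) ^ ?N = -1" by simp
    then have "(-1 :: 'a) ^ q * (-1) ^ i = -1" unfolding q power_add .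
    then have "(-1 :: 'a) ^ q * (-1) ^ i * (-1) ^ i = - ((-1) ^ i)" by simp
    then have "(-1 :: 'a) ^ q = - ((-1) ^ i)" by (simp only: mult.assoc minus_one_mult_self mult_1_right)
    moreover have "?N - i = q" "?N - (?N - i) = i" using q by auto
    ultimately have "- ?f (?N - i) = - (- ((-1) ^ i) * a q * a i)" by (simp only:)
    also have "\<dots> = (-1) ^ i * a i * a q" by (simp only: mult_minus_left mult_minus_right minus_minus mult_ac)
    finally show ?thesis using \<open>?N - i = q\<close> by (simp only:)
  qed
  have "sum ?f {..?N} = sum ?f {..p} + sum ?f {p<..?N}"
  proof -
    have "{..?N} = {..p} \<union> {p<..?N}" by auto
    moreover have "sum ?f ({..p} \<union> {p<..?N}) = sum ?f {..p} + sum ?f {p<..?N}"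
      by (rule sum.union_disjoint) auto
    ultimately show ?thesis by (simp only:)
  qed
  also have "sum ?f {p<..?N} = (\<Sum>i\<le>p. - ?f i)"
  proof (rule sum.reindex_bij_witness[of _ "\<lambda>j. ?N - j" "\<lambda>i. ?N - i"])
    fix i assume "i \<in> {p<..?N}"
    then show "- ?f (?N - i) = ?f i" using sym[of i] by auto
  qed auto
  finally show ?thesis by (simp only: sum_negf add.right_inverse)
qed

lemma Grel_iff_fps:
  fixes a :: "nat \<Rightarrow> 'a::comm_ring_1"
  assumes "a 0 = 1"
  shows "(\<forall>p\<ge>1. Grel a p = 0) \<longleftrightarrow> Abs_fps (\<lambda>p. (-1) ^ p * a p) * Abs_fps a = 1"
proof -
  define c where "c n = (\<Sum>i\<le>n. (-1) ^ i * a i * a (n - i))" for n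
  have ev: "c (2 * p) = (-1) ^ p * Grel a p" for p
    unfolding c_def by (rule Grel_even)
  have od: "c (2 * p + 1) = 0" for p
    unfolding c_def by (rule Grel_odd)
  have c0: "c 0 = 1" using assms by (simp add: c_def)
  have "Abs_fps (\<lambda>p. (-1) ^ p * a p) * Abs_fps a = Abs_fps c"
    by (rule fps_ext) (simp add: fps_mult_nth atLeast0AtMost c_def)
  then have "Abs_fps (\<lambda>p. (-1) ^ p * a p) * Abs_fps a = 1 \<longleftrightarrow> (\<forall>n. c n = (if n = 0 then 1 else 0))"
    by (simp add: fps_eq_iff)
  also have "\<dots> \<longleftrightarrow> (\<forall>p\<ge>1. Grel a p = 0)"
  proof
    assume *: "\<forall>n. c n = (if n = 0 then 1 else 0)"
    show "\<forall>p\<ge>1. Grel a p = 0"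
    proof (intro allI impI)
      fix p :: nat assume "p \<ge> 1"
      then have "(-1) ^ p * Grel a p = 0" using *[rule_format, of "2 * p"] ev[of p] by simp
      then have "(-1) ^ p * ((-1) ^ p * Grel a p) = 0" by (simp only: mult_zero_right)
      then show "Grel a p = 0" by (simp only: left_minus_one_mult_self)
    qed
  next
    assume *: "\<forall>p\<ge>1. Grel a p = 0"
    show "\<forall>n. c n = (if n = 0 then 1 else 0)"
    proof
      fix n
      show "c n = (if n = 0 then 1 else 0)"
      proof (cases "even n")
        case True
        then obtain p where p: "n = 2 * p" by (elim evenE)
        show ?thesis
        proof (cases "p = 0")
          case False
          then have "Grel a p = 0" using * by simp
          then show ?thesis using False by (simp add: p ev)
        qed (simp add: p c0)
      next
        case False
        then obtain p where "n = 2 * p + 1" by (elim oddE)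
        then show ?thesis using od[of p] by simp
      qed
    qed
  qed
  finally show ?thesis by (rule sym)
qed

lemma Grel_gc: "p \<ge> 1 \<Longrightarrow> Grel gc p = 0"
proof -
  assume "p \<ge> 1"
  have ad: "abs_gamma f + abs_gamma g = abs_gamma (f + g)"
   and mu: "abs_gamma f * abs_gamma g = abs_gamma (f * g)" for f g
    by (simp_all add: plus_gamma.abs_eq times_gamma.abs_eq)
  have hom: "is_ring_hom abs_gamma"
    by (simp add: is_ring_hom_def ad mu one_gamma.abs_eq)
  have neg: "abs_gamma (- f) = - abs_gamma f" for f by (simp add: uminus_gamma.abs_eq)
  have pw: "abs_gamma (f ^ k) = abs_gamma f ^ k" for f k
    by (induction k) (simp_all add: mu[symmetric] one_gamma.abs_eq)
  have sm: "abs_gamma (sum F A) = (\<Sum>i\<in>A. abs_gamma (F i))" for F and A :: "nat set"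
    by (induction A rule: infinite_finite_induct) (simp_all add: ad[symmetric] zero_gamma.abs_eq)
  have one: "abs_gamma 1 = 1" by (simp add: one_gamma.abs_eq)
  have two: "abs_gamma 2 = 2" using ad[of 1 1] one by simp
  have "Grel gc p = abs_gamma (Grel cpol p)"
    by (simp add: Grel_def gc.abs_eq ad[symmetric] mu[symmetric] pw sm one two neg)
  also have "Grel cpol p \<in> Gideal" using \<open>p \<ge> 1\<close> by (intro Gideal_base) blast
  then have "Geq (Grel cpol p) 0" by (simp add: Geq_def)
  then have "abs_gamma (Grel cpol p) = 0"
    using Quotient3_rel_abs[OF Quotient3_gamma] by (simp add: zero_gamma_def)
  finally show ?thesis .
qed

lemma is_ring_hom_mconst: "is_ring_hom (mconst :: 'a::comm_ring_1 \<Rightarrow> ('v, 'a) mpol)"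
  by (simp add: is_ring_hom_def mconst_def single_add mult_single)

lemma Grel_hom:
  assumes "is_ring_hom h"
  shows "Grel (\<lambda>p. h (a p)) p = h (Grel a p)"
proof -
  have ad: "h (f + g) = h f + h g" and mu: "h (f * g) = h f * h g" and one: "h 1 = 1" for f g
    using assms by (auto simp: is_ring_hom_def)
  have z: "h 0 = 0" using assms by (rule is_ring_hom_zero)
  have neg: "h (- f) = - h f" for f
    using ad[of f "- f"] z by (simp add: eq_neg_iff_add_eq_0 add.commute[of "h f"])
  have pw: "h (f ^ k) = h f ^ k" for f k by (induction k) (simp_all add: mu one)
  have sm: "h (sum F A) = (\<Sum>i\<in>A. h (F i))" for F and A :: "nat set"
    by (induction A rule: infinite_finite_induct) (simp_all add: ad z)
  have two: "h 2 = 2" using ad[of 1 1] one by simp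
  show ?thesis by (simp add: Grel_def ad mu pw sm one two neg)
qed

lemma gc_0: "gc 0 = 1"
  by (simp add: gc.abs_eq one_gamma.abs_eq)

lemma cc_0: "cc 0 = 1"
  by (simp add: cc_def gc_0 mconst_def)

lemma Grel_cc: "p \<ge> 1 \<Longrightarrow> Grel cc p = 0"
  using Grel_hom[OF is_ring_hom_mconst, of gc p] Grel_gc[of p]
  unfolding cc_def[abs_def] by (simp add: mconst_def)

lemma s0c_0: "s0c 0 = 1"
  by (simp add: s0c_def cc_0)

lemma s0c_Suc: "s0c (Suc p) - xv 1 * s0c p = cc (Suc p) + xv 1 * cc p"
proof -
  have "(\<Sum>j=1..Suc p. xv 1 ^ j * cc (Suc p - j))
      = xv 1 * cc p + (\<Sum>j=1..p. xv 1 ^ Suc j * cc (p - j))"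
    by (simp add: sum.atLeast_Suc_atMost sum.shift_bounds_cl_Suc_ivl del: sum.cl_ivl_Suc)
  then show ?thesis
    by (simp add: s0c_def algebra_simps sum_distrib_left del: sum.cl_ivl_Suc)
qed

lemma Grel_s0c: "p \<ge> 1 \<Longrightarrow> Grel s0c p = 0"
proof -
  let ?t = "fps_const (xv 1) * fps_X :: gxy fps"
  let ?m = "\<lambda>a :: nat \<Rightarrow> gxy. Abs_fps (\<lambda>p. (-1) ^ p * a p)"
  have nth: "fps_nth (A * (1 + ?t)) k = fps_nth A k + (if k = 0 then 0 else xv 1 * fps_nth A (k - 1))"
    "fps_nth (A * (1 - ?t)) k = fps_nth A k - (if k = 0 then 0 else xv 1 * fps_nth A (k - 1))" for A k
  proof -
    have "A * (1 + ?t) = A + fps_X * (fps_const (xv 1) * A)"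
      and "A * (1 - ?t) = A - fps_X * (fps_const (xv 1) * A)"
      by (simp_all add: algebra_simps)
    then show "fps_nth (A * (1 + ?t)) k = fps_nth A k + (if k = 0 then 0 else xv 1 * fps_nth A (k - 1))"
      "fps_nth (A * (1 - ?t)) k = fps_nth A k - (if k = 0 then 0 else xv 1 * fps_nth A (k - 1))"
      by (simp_all only: fps_add_nth fps_sub_nth fps_X_mult_nth fps_mult_left_const_nth)
  qed
  have 1: "Abs_fps s0c * (1 - ?t) = Abs_fps cc * (1 + ?t)"
  proof (rule fps_ext)
    fix k
    show "fps_nth (Abs_fps s0c * (1 - ?t)) k = fps_nth (Abs_fps cc * (1 + ?t)) k"
      unfolding nth using s0c_Suc[of "k - 1"] by (cases k) (simp_all add: s0c_0 cc_0)
  qed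
  have 2: "?m s0c * (1 + ?t) = ?m cc * (1 - ?t)"
  proof (rule fps_ext)
    fix k
    show "fps_nth (?m s0c * (1 + ?t)) k = fps_nth (?m cc * (1 - ?t)) k"
    proof (cases k)
      case (Suc q)
      have "(-1) ^ k * (s0c k - xv 1 * s0c q) = (-1) ^ k * (cc k + xv 1 * cc q)"
        using s0c_Suc[of q] Suc by simp
      then show ?thesis
        unfolding nth using Suc by (simp add: algebra_simps)
    qed (simp add: nth s0c_0 cc_0)
  qed
  have 3: "?m cc * Abs_fps cc = 1" using Grel_iff_fps[of cc] cc_0 Grel_cc by blast
  define Z where "Z = ?m s0c * Abs_fps s0c - 1"
  have shuffle: "a * b * (c * d) = (a * c) * (b * d)" for a b c d :: "gxy fps"
    by (simp only: mult_ac)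
  have "(?m s0c * Abs_fps s0c) * ((1 + ?t) * (1 - ?t)) = (?m cc * Abs_fps cc) * ((1 - ?t) * (1 + ?t))"
    unfolding shuffle[of _ _ "1 + ?t"] shuffle[of _ _ "1 - ?t"] 1 2 ..
  then have "Z * ((1 + ?t) * (1 - ?t)) = 0"
    unfolding 3 mult.commute[of "1 - ?t"]
    by (simp only: Z_def left_diff_distrib[of "?m s0c * Abs_fps s0c"] mult_1_left diff_self)
  moreover have "z * ((1 + a * b) * (1 - a * b)) = z - b * (a * (b * (a * z)))"
    for z a b :: "gxy fps" by (simp add: algebra_simps)
  ultimately have eq: "Z = fps_X * (fps_const (xv 1) * (fps_X * (fps_const (xv 1) * Z)))"
    by (simp only: right_minus_eq)
  have "fps_nth Z k = 0" for k
  proof (induction k rule: less_induct)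
    case (less k)
    have "fps_nth Z k = (if k = 0 then 0 else xv 1 * (if k - 1 = 0 then 0 else xv 1 * fps_nth Z (k - 1 - 1)))"
      by (subst eq) (simp only: fps_X_mult_nth fps_mult_left_const_nth)
    then show ?case using less[of "k - 1 - 1"] by auto
  qed
  then have "Z = 0" by (simp add: fps_eq_iff)
  then have "?m s0c * Abs_fps s0c = 1" by (simp add: Z_def)
  then show "p \<ge> 1 \<Longrightarrow> Grel s0c p = 0" using Grel_iff_fps[of s0c] s0c_0 by blast
qed

lemma s0_act_ring_hom: "is_ring_hom s0_act"
  and s0_act_cc: "s0_act (cc p) = s0c p"
proof -
  note h = gamma_eval_ring_hom[OF s0c_0 Grel_s0c]
  show "is_ring_hom s0_act" unfolding s0_act_def by (rule peval_ring_hom[OF h(1)])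
  show "s0_act (cc p) = s0c p"
    using h is_ring_hom_zero[OF h(1)]
    by (simp add: s0_act_def cc_def mconst_def peval_single mono_eval_def)
qed

definition s_act :: "nat \<Rightarrow> gxy \<Rightarrow> gxy" where
  "s_act i = (if i = 0 then s0_act else perm_act (Transposition.transpose i (Suc i)))"

definition omega :: "gxy \<Rightarrow> gxy" where
  "omega = peval mconst (\<lambda>v. case v of XV k \<Rightarrow> - yv (Suc k) | YV k \<Rightarrow> - xv (Suc k))"

definition exact_div :: "'a::comm_ring_1 \<Rightarrow> 'a \<Rightarrow> 'a" where
  "exact_div f d = (THE q. d * q = f)"

definition ddx :: "nat \<Rightarrow> gxy \<Rightarrow> gxy" where
  "ddx i f = exact_div (f - s_act i f) (if i = 0 then - 2 * xv 1 else xv i - xv (Suc i))"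

definition ddy :: "nat \<Rightarrow> gxy \<Rightarrow> gxy" where
  "ddy i = omega \<circ> ddx i \<circ> omega"

text \<open>The constant term of an element of \<open>\<Gamma>[X, Y]\<close> is taken with respect to all of the
  \<open>c\<^sub>p\<close> (\<open>p \<ge> 1\<close>), \<open>x\<^sub>i\<close> and \<open>y\<^sub>i\<close>.\<close>

definition const_term :: "gxy \<Rightarrow> int" where
  "const_term f = gamma_eval (\<lambda>p. if p = 0 then 1 else 0) (Poly_Mapping.lookup f 0)"


section \<open>Words, length, symmetric and hyperoctahedral groups\<close>

definition word_prod :: "(nat \<Rightarrow> 'a \<Rightarrow> 'a) \<Rightarrow> nat list \<Rightarrow> 'a \<Rightarrow> 'a" where
  "word_prod g as = foldr (\<lambda>i h. g i \<circ> h) as id"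

text \<open>Length with respect to the generators \<open>g i\<close>, \<open>i \<in> I\<close>.\<close>

definition cox_length :: "(nat \<Rightarrow> 'a \<Rightarrow> 'a) \<Rightarrow> nat set \<Rightarrow> ('a \<Rightarrow> 'a) \<Rightarrow> nat" where
  "cox_length g I w = (LEAST k. \<exists>as. set as \<subseteq> I \<and> word_prod g as = w \<and> length as = k)"

definition reduced_word :: "(nat \<Rightarrow> 'a \<Rightarrow> 'a) \<Rightarrow> nat set \<Rightarrow> ('a \<Rightarrow> 'a) \<Rightarrow> nat list \<Rightarrow> bool" where
  "reduced_word g I w as \<longleftrightarrow>
     set as \<subseteq> I \<and> word_prod g as = w \<and> length as = cox_length g I w"

text \<open>Signed permutations of \<open>{1, \<dots>, k}\<close>, as odd permutations of the integers.\<close>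

definition W :: "nat \<Rightarrow> (int \<Rightarrow> int) set" where
  "W k = {w. w permutes {- int k..int k} \<and> (\<forall>i. w (- i) = - w i)}"

definition Winf :: "(int \<Rightarrow> int) set" where
  "Winf = (\<Union>k. W k)"

definition sgen :: "nat \<Rightarrow> int \<Rightarrow> int" where
  "sgen i = (if i = 0 then Transposition.transpose 1 (- 1)
     else Transposition.transpose (int i) (int i + 1) \<circ> Transposition.transpose (- int i) (- int i - 1))"

abbreviation ell :: "(int \<Rightarrow> int) \<Rightarrow> nat" where
  "ell \<equiv> cox_length sgen UNIV"


section \<open>Schubert polynomials\<close>

text \<open>Type A: \<open>\<SS>\<^bsub>w\<^sub>0\<^esub> = x\<^sub>1\<^bsup>n-1\<^esup> x\<^sub>2\<^bsup>n-2\<^esup> \<cdots> x\<^bsub>n-1\<^esub>\<close> and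
  \<open>\<SS>\<^bsub>\<pi>\<^esub> = \<partial>\<^bsub>a\<^sub>1\<^esub> \<cdots> \<partial>\<^bsub>a\<^sub>k\<^esub> \<SS>\<^bsub>w\<^sub>0\<^esub>\<close> for a reduced word
  \<open>a\<^sub>1 \<cdots> a\<^sub>k\<close> of \<open>\<pi>\<^sup>-\<^sup>1 w\<^sub>0\<close>, where \<open>w\<^sub>0\<close> is the longest element of \<open>S\<^sub>n\<close>. The result does
  not depend on the reduced word, nor on the choice of \<open>n\<close> with \<open>\<pi> \<in> S\<^sub>n\<close>.\<close>

definition w0A :: "nat \<Rightarrow> nat \<Rightarrow> nat" where
  "w0A n i = (if i \<in> {1..n} then n + 1 - i else i)"

definition schubertA :: "nat \<Rightarrow> (nat \<Rightarrow> nat) \<Rightarrow> gxy" where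
  "schubertA n \<pi> =
     foldr ddx
       (SOME as. reduced_word (\<lambda>i. Transposition.transpose i (Suc i)) {1..<n} (inv \<pi> \<circ> w0A n) as)
       (\<Prod>i=1..n. xv i ^ (n - i))"

definition is_schubertC_family :: "((int \<Rightarrow> int) \<Rightarrow> gxy) \<Rightarrow> bool" where
  "is_schubertC_family CC \<longleftrightarrow> (\<forall>w\<in>Winf.
      (\<forall>i. ddx i (CC w) = (if ell (w \<circ> sgen i) < ell w then CC (w \<circ> sgen i) else 0)) \<and>
      (\<forall>i. ddy i (CC w) = (if ell (sgen i \<circ> w) < ell w then CC (sgen i \<circ> w) else 0)) \<and>
      const_term (CC w) = (if w = id then 1 else 0))"

definition Y_to_zero :: "gxy \<Rightarrow> gxy" where
  "Y_to_zero = peval mconst (\<lambda>v. case v of XV k \<Rightarrow> xv (Suc k) | YV k \<Rightarrow> 0)"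


section \<open>The subrings of \<open>\<Gamma>[X\<^sub>n]\<close> and the polynomials \<open>Q\<close>-tilde\<close>

definition GX :: "nat \<Rightarrow> gxy set" where
  "GX n = {f. \<forall>m\<in>Poly_Mapping.keys f. Poly_Mapping.keys m \<subseteq> XV ` {..<n}}"

definition GX_sym :: "nat \<Rightarrow> gxy set" where
  "GX_sym n = {f \<in> GX n. \<forall>\<pi>. \<pi> permutes {1..n} \<longrightarrow> perm_act \<pi> f = f}"

definition elem_sym :: "nat \<Rightarrow> (nat \<Rightarrow> 'a::comm_ring_1) \<Rightarrow> int \<Rightarrow> 'a" where
  "elem_sym n z p = (\<Sum>S | S \<subseteq> {1..n} \<and> int (card S) = p. \<Prod>i\<in>S. z i)"

definition nc :: "nat \<Rightarrow> nat \<Rightarrow> gxy" where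
  "nc n p = (\<Sum>j=0..p. cc (p - j) * elem_sym n xv (int j))"

text \<open>\<open>\<int>[\<^sup>nc\<^sub>1, \<^sup>nc\<^sub>2, \<dots>]\<close>, the set of all integer polynomial expressions in the \<open>\<^sup>nc\<^sub>p\<close>,
  \<open>p \<ge> 1\<close>.\<close>

definition Gamma_n :: "nat \<Rightarrow> gxy set" where
  "Gamma_n n = range (peval of_int (\<lambda>k. nc n (Suc k)) :: (nat, int) mpol \<Rightarrow> gxy)"

definition strict_parts :: "nat \<Rightarrow> nat list set" where
  "strict_parts n = {\<mu>. sorted_wrt (>) \<mu> \<and> set \<mu> \<subseteq> {1..n}}"

text \<open>A monomial \<open>R = \<Prod> R\<^bsub>ij\<^esub>\<^bsup>k(i,j)\<^esup>\<close> in the raising operators is given by its exponents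
  \<open>k\<close> (positions count from \<open>0\<close>). As \<open>(1 - R)/(1 + R) = 1 + 2 \<Sum>\<^bsub>k\<ge>1\<^esub> (-1)\<^sup>k R\<^sup>k\<close>, its
  coefficient is the product of \<open>2 (-1)\<^bsup>k(i,j)\<^esup>\<close> over the \<open>(i,j)\<close> with \<open>k(i,j) \<noteq> 0\<close>. Only
  finitely many monomials act by a nonzero term, because \<open>e\<^sub>p = 0\<close> for \<open>p < 0\<close>.\<close>

definition raised :: "(nat \<times> nat \<Rightarrow>\<^sub>0 nat) \<Rightarrow> nat list \<Rightarrow> nat \<Rightarrow> int" where
  "raised k \<mu> i = int (\<mu> ! i)
     + (\<Sum>j\<in>{i<..<length \<mu>}. int (Poly_Mapping.lookup k (i, j)))
     - (\<Sum>j<i. int (Poly_Mapping.lookup k (j, i)))"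

definition Qtilde :: "nat \<Rightarrow> (nat \<Rightarrow> 'a::comm_ring_1) \<Rightarrow> nat list \<Rightarrow> 'a" where
  "Qtilde n z \<mu> = Sum_any (\<lambda>k :: nat \<times> nat \<Rightarrow>\<^sub>0 nat.
     if Poly_Mapping.keys k \<subseteq> {(i, j). i < j \<and> j < length \<mu>}
     then (\<Prod>r\<in>Poly_Mapping.keys k. 2 * (-1) ^ Poly_Mapping.lookup k r)
          * (\<Prod>i<length \<mu>. elem_sym n z (raised k \<mu> i))
     else 0)"


section \<open>Free modules with a finite basis\<close>

definition is_subring :: "'a::comm_ring_1 set \<Rightarrow> bool" where
  "is_subring R \<longleftrightarrow> 1 \<in> R \<and> (\<forall>a\<in>R. \<forall>b\<in>R. a - b \<in> R \<and> a * b \<in> R)"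

text \<open>\<open>S\<close> is a ring extension of \<open>R\<close> which as an \<open>R\<close>-module is free on the finite
  family \<open>b i\<close>, \<open>i \<in> I\<close>.\<close>

definition free_with_basis ::
    "'a::comm_ring_1 set \<Rightarrow> 'a set \<Rightarrow> 'i set \<Rightarrow> ('i \<Rightarrow> 'a) \<Rightarrow> bool" where
  "free_with_basis R S I b \<longleftrightarrow>
     is_subring R \<and> is_subring S \<and> R \<subseteq> S \<and> finite I \<and> b ` I \<subseteq> S \<and>
     (\<forall>f\<in>S. \<exists>!a. a \<in> I \<rightarrow>\<^sub>E R \<and> f = (\<Sum>i\<in>I. a i * b i))"

end

theory Submission
  imports Defs
begin

text \<open>Two arithmetic facts at 2 stand behind this outline. First, \<open>exact_div\<close> is
  a definite description, so a divided difference makes sense only if its denominator is not a zero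
  divisor; for \<open>- 2 * xv 1\<close> this means that Gamma has no 2-torsion. It is drawn from
  the relations modulo 2, where they become the squares c_p^2. The same fact lets the parity
  argument cancel the powers of 2 that the sign changes produce. Second, the type C family is given
  only by its recursions and constant terms, so its member at the identity must be shown to be 1,
  although a constant term sees a single coefficient. All operators kill this member, hence it is
  fixed by W_inf in both sets of variables; involving only finitely many x and y, it lies in Gamma,
  and an element of Gamma fixed by s_0 is an integer. The last point is again arithmetic at 2: an
  s_0-invariant combination of nonempty squarefree products has even coefficients, and halving them
  forever forces them to be 0.\<close>

text \<open>A ring on which divided difference operators act, with a family indexed by a finite Coxeter
  group that the operators lower along descents down to 1, is free over the invariants on that
  family: the operator of a longest element \<open>w\<close> among those that occur in an expansion returns the
  coefficient at \<open>w\<close>. This needs only that the operators are well defined on group elements, i.e.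
  the braid relations and Matsumoto's theorem. It yields the two bases of Schubert polynomials, over
  the invariants of \<open>S\<^sub>n\<close> and of \<open>W\<^sub>n\<close>.

  Let \<open>a\<^sub>p\<close> be the elementary symmetric polynomials in \<open>-X\<^sub>n\<close>. As \<open>c(t) c(-t) = 1\<close>, the products
  of the generating functions of \<open>\<^sup>nc\<close> and of \<open>a\<close> with their images under \<open>t \<mapsto> -t\<close> coincide, hence
  \<open>a\<^sub>p\<^sup>2 + 2 \<Sum> (-1)\<^sup>i a\<^bsub>p+i\<^esub> a\<^bsub>p-i\<^esub>\<close> lies in \<open>\<Gamma>\<^bsup>(n)\<^esup>\<close>, and the squarefree products of the
  \<open>a\<^sub>p\<close> span the symmetric polynomials over \<open>\<Gamma>\<^bsup>(n)\<^esup>\<close>. They are independent even over the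
  \<open>W\<^sub>n\<close>-invariants: the exponents of their leading monomials differ in parity, and sign changes
  separate the parities. Consequently the \<open>W\<^sub>n\<close>-invariants are \<open>\<Gamma>\<^bsup>(n)\<^esup>\<close>. The \<open>Q\<close>-tilde
  polynomials are related to the squarefree products by a unitriangular matrix.\<close>

section \<open>Subrings and ring homomorphisms\<close>

text \<open>Closure under differences and products matches \<open>is_subring\<close>; rule induction
  over this set reduces statements about homomorphisms to generators.\<close>

inductive_set ring_gen :: "'a::comm_ring_1 set \<Rightarrow> 'a set" for G where
  one: "1 \<in> ring_gen G"
| gen: "g \<in> G \<Longrightarrow> g \<in> ring_gen G"
| diff: "a \<in> ring_gen G \<Longrightarrow> b \<in> ring_gen G \<Longrightarrow> a - b \<in> ring_gen G"
| mult: "a \<in> ring_gen G \<Longrightarrow> b \<in> ring_gen G \<Longrightarrow> a * b \<in> ring_gen G"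

lemma is_subring_ring_gen: "is_subring (ring_gen G)"
  by (simp add: is_subring_def ring_gen.intros)

context
  fixes R :: "'a::comm_ring_1 set"
  assumes R: "is_subring R"
begin

lemma subring_one: "1 \<in> R" and subring_diff: "a \<in> R \<Longrightarrow> b \<in> R \<Longrightarrow> a - b \<in> R"
  and subring_mult: "a \<in> R \<Longrightarrow> b \<in> R \<Longrightarrow> a * b \<in> R"
  using R by (auto simp: is_subring_def)

lemma subring_zero: "0 \<in> R"
  using subring_diff[OF subring_one subring_one] by simp

lemma subring_uminus: "a \<in> R \<Longrightarrow> - a \<in> R"
  using subring_diff[OF subring_zero, of a] by simp

lemma subring_add: "a \<in> R \<Longrightarrow> b \<in> R \<Longrightarrow> a + b \<in> R"
  using subring_diff[of a "- b"] subring_uminus[of b] by simp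

lemma subring_sum: "(\<And>i. i \<in> A \<Longrightarrow> f i \<in> R) \<Longrightarrow> sum f A \<in> R"
  by (induction A rule: infinite_finite_induct) (auto simp: subring_zero subring_add)

lemma subring_prod: "(\<And>i. i \<in> A \<Longrightarrow> f i \<in> R) \<Longrightarrow> prod f A \<in> R"
  by (induction A rule: infinite_finite_induct) (auto simp: subring_one subring_mult)

lemma subring_power: "a \<in> R \<Longrightarrow> a ^ k \<in> R"
  by (induction k) (auto simp: subring_one subring_mult)

lemma subring_of_nat: "of_nat k \<in> R"
  by (induction k) (auto simp: subring_zero subring_one subring_add)

lemma subring_of_int: "of_int k \<in> R"
  by (cases k rule: int_cases2) (auto simp: subring_of_nat subring_uminus)

lemma subring_numeral: "numeral k \<in> R"
  using subring_of_nat[of "numeral k"] by simp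

lemma ring_gen_subset: "G \<subseteq> R \<Longrightarrow> ring_gen G \<subseteq> R"
proof
  fix x assume "G \<subseteq> R" "x \<in> ring_gen G"
  from this(2,1) show "x \<in> R"
    by induction (auto simp: subring_one subring_diff subring_mult)
qed

lemmas subring_intros = subring_one subring_zero subring_diff subring_mult subring_uminus
  subring_add subring_sum subring_prod subring_power subring_of_nat subring_of_int subring_numeral

end

lemmas ring_gen_intros = subring_intros[OF is_subring_ring_gen]

lemma ring_gen_mono: "G \<subseteq> H \<Longrightarrow> ring_gen G \<subseteq> ring_gen H"
  by (rule ring_gen_subset[OF is_subring_ring_gen]) (auto intro: ring_gen.gen)

text \<open>An element is built from finitely many generators, and initial segments are nested, so
  one bound serves both operands. This later leaves only finitely many x-variables in an element of
  Gamma[X, Y].\<close>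

lemma ring_gen_finite_range:
  assumes "f \<in> ring_gen (A \<union> range x)"
  shows "\<exists>D. f \<in> ring_gen (A \<union> x ` {..<D::nat})"
proof -
  have mono: "a \<in> ring_gen (A \<union> x ` {..<D'})" if "a \<in> ring_gen (A \<union> x ` {..<D})" "D \<le> D'" for a D D'
    by (rule subsetD[OF ring_gen_mono that(1)]) (use that(2) in auto)
  have both: "\<exists>D. a \<in> ring_gen (A \<union> x ` {..<D}) \<and> b \<in> ring_gen (A \<union> x ` {..<D})"
    if "\<exists>D. a \<in> ring_gen (A \<union> x ` {..<D})" "\<exists>D. b \<in> ring_gen (A \<union> x ` {..<D})" for a b
    using that mono by (meson max.cobounded1 max.cobounded2)
  show ?thesis
    using assms
  proof induction
    case (gen g)
    then consider "g \<in> A" | k where "g = x k" by blast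
    then show ?case
    proof cases
      case 1 then show ?thesis by (intro exI[of _ 0] ring_gen.gen) auto
    next
      case (2 k) then show ?thesis by (intro exI[of _ "Suc k"] ring_gen.gen) auto
    qed
  next
    case one
    show ?case by (rule exI) (rule ring_gen.one)
  next
    case (diff a b)
    then show ?case using both[of a b] by (auto intro: ring_gen.diff)
  next
    case (mult a b)
    then show ?case using both[of a b] by (auto intro: ring_gen.mult)
  qed
qed

section \<open>Ring homomorphisms on generated rings\<close>

lemma is_ring_homD:
  assumes "is_ring_hom h"
  shows "h 1 = 1" "h (a + b) = h a + h b" "h (a * b) = h a * h b"
  using assms by (auto simp: is_ring_hom_def)

lemma hom_uminus: "is_ring_hom h \<Longrightarrow> h (- a) = - h a"
  using is_ring_homD(2)[of h a "- a"] is_ring_hom_zero[of h]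
  by (simp add: eq_neg_iff_add_eq_0 add.commute)

lemma hom_diff: "is_ring_hom h \<Longrightarrow> h (a - b) = h a - h b"
  using is_ring_homD(2)[of h a "- b"] hom_uminus[of h b] by simp

lemma hom_sum: "is_ring_hom h \<Longrightarrow> h (sum f A) = (\<Sum>i\<in>A. h (f i))"
  by (induction A rule: infinite_finite_induct) (auto simp: is_ring_hom_zero is_ring_homD)

lemma hom_prod: "is_ring_hom h \<Longrightarrow> h (prod f A) = (\<Prod>i\<in>A. h (f i))"
  by (induction A rule: infinite_finite_induct) (auto simp: is_ring_homD)

lemma hom_power: "is_ring_hom h \<Longrightarrow> h (a ^ k) = h a ^ k"
  by (induction k) (auto simp: is_ring_homD)

lemma hom_of_nat: "is_ring_hom h \<Longrightarrow> h (of_nat k) = of_nat k"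
  by (induction k) (auto simp: is_ring_hom_zero is_ring_homD)

lemma hom_of_int: "is_ring_hom h \<Longrightarrow> h (of_int k) = of_int k"
  by (cases k rule: int_cases2) (auto simp: hom_of_nat hom_uminus)

lemma hom_numeral: "is_ring_hom h \<Longrightarrow> h (numeral k) = numeral k"
  using hom_of_nat[of h "numeral k"] by simp

lemmas hom_simps = is_ring_homD is_ring_hom_zero hom_uminus hom_diff hom_sum hom_prod hom_power
  hom_of_nat hom_of_int hom_numeral

lemma is_ring_hom_comp: "is_ring_hom h \<Longrightarrow> is_ring_hom k \<Longrightarrow> is_ring_hom (h \<circ> k)"
  by (simp add: is_ring_hom_def)

lemma hom_eq_on_ring_gen:
  assumes "is_ring_hom h" "is_ring_hom k" "\<And>g. g \<in> G \<Longrightarrow> h g = k g" "f \<in> ring_gen G"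
  shows "h f = k f"
  using assms(4) by induction (auto simp: hom_simps assms(1-3))

lemma hom_ring_gen:
  assumes "is_ring_hom h" "is_subring R" "\<And>g. g \<in> G \<Longrightarrow> h g \<in> R" "f \<in> ring_gen G"
  shows "h f \<in> R"
  using assms(4) by induction (auto simp: hom_simps assms(1-3) subring_intros[OF assms(2)])

section \<open>Polynomials as generated rings\<close>

lemma mono_eval_single: "mono_eval \<sigma> (Poly_Mapping.single v k) = \<sigma> v ^ k"
  by (cases "k = 0") (auto simp: mono_eval_def)

lemma mconst_hom_simps: "mconst (a + b) = mconst a + mconst b" "mconst (a * b) = mconst a * mconst b"
  "mconst 0 = 0" "mconst 1 = 1" "mconst (a - b) = mconst a - mconst b" "mconst (- a) = - mconst a"
  for a b :: "'a::comm_ring_1"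
  by (simp_all add: mconst_def single_add mult_single single_diff single_uminus)

lemma mvar_power: "mvar v ^ k = (Poly_Mapping.single (Poly_Mapping.single v k) 1 :: ('v, 'a::comm_ring_1) mpol)"
  by (induction k) (auto simp: mvar_def mult_single single_add[symmetric])

lemma mono_eval_mvar: "mono_eval mvar m = (Poly_Mapping.single m 1 :: ('v, 'a::comm_ring_1) mpol)"
proof -
  have "mono_eval mvar (\<Sum>v\<in>A. Poly_Mapping.single v (Poly_Mapping.lookup m v))
      = (Poly_Mapping.single (\<Sum>v\<in>A. Poly_Mapping.single v (Poly_Mapping.lookup m v)) 1 :: ('v, 'a) mpol)"
    if "finite A" for A
    using that
  proof induction
    case empty
    show ?case by (simp add: mono_eval_def)
  next
    case (insert v A)
    then show ?case
      by (simp add: mono_eval_add mono_eval_single mvar_power mult_single)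
  qed
  moreover have "(\<Sum>v\<in>Poly_Mapping.keys m. Poly_Mapping.single v (Poly_Mapping.lookup m v)) = m"
    by (rule poly_mapping_eqI) (auto simp: lookup_sum lookup_single when_def in_keys_iff sum.delta')
  ultimately show ?thesis using finite_keys[of m] by metis
qed

lemma single_eq_mono: "Poly_Mapping.single m a = mconst a * mono_eval mvar m"
  for a :: "'a::comm_ring_1"
  by (simp add: mono_eval_mvar mconst_def mult_single)

lemma mono_eval_in:
  assumes "is_subring R" "\<And>v. v \<in> Poly_Mapping.keys m \<Longrightarrow> \<sigma> v \<in> R"
  shows "mono_eval \<sigma> m \<in> R"
  unfolding mono_eval_def by (intro subring_intros[OF assms(1)] assms(2))

lemma mpol_in_subring:
  fixes f :: "('v, 'a::comm_ring_1) mpol"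
  assumes "is_subring R" "\<And>a. mconst a \<in> R"
    "\<And>m v. m \<in> Poly_Mapping.keys f \<Longrightarrow> v \<in> Poly_Mapping.keys m \<Longrightarrow> mvar v \<in> R"
  shows "f \<in> R"
proof -
  have "(\<Sum>m\<in>Poly_Mapping.keys f. Poly_Mapping.single m (Poly_Mapping.lookup f m)) \<in> R"
    unfolding single_eq_mono
    by (intro subring_sum[OF assms(1)] subring_mult[OF assms(1)] mono_eval_in assms)
  then show ?thesis using mpol_expand[of f] by simp
qed

lemma mconst_int: "mconst k = of_int k" for k :: int
proof -
  have "mconst (of_int k :: int) = (of_int k :: ('v, int) mpol)"
    by (rule hom_of_int[OF is_ring_hom_mconst])
  then show ?thesis by simp
qed

lemma mpol_int_ring_gen: "f \<in> ring_gen (range mvar)" for f :: "('v, int) mpol"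
  by (rule mpol_in_subring[OF is_subring_ring_gen])
     (auto simp: mconst_int intro: ring_gen_intros ring_gen.gen)

text \<open>\<open>Gamma_n\<close> is defined as the range of a substitution; as a generated ring it
  becomes accessible to induction on generators.\<close>

lemma range_peval: "range (peval of_int \<sigma> :: ('v, int) mpol \<Rightarrow> 'a::comm_ring_1) = ring_gen (range \<sigma>)"
proof
  note h = peval_ring_hom[OF is_ring_hom_of_int, of \<sigma>]
  show "range (peval of_int \<sigma>) \<subseteq> ring_gen (range \<sigma>)"
  proof clarify
    fix f :: "('v, int) mpol"
    show "peval of_int \<sigma> f \<in> ring_gen (range \<sigma>)"
      by (rule hom_ring_gen[OF h is_subring_ring_gen _ mpol_int_ring_gen])
         (auto simp: peval_mvar[OF is_ring_hom_of_int] intro: ring_gen.gen)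
  qed
  have "is_subring (range (peval of_int \<sigma> :: ('v, int) mpol \<Rightarrow> 'a))"
    unfolding is_subring_def
  proof (intro conjI ballI)
    show "1 \<in> range (peval of_int \<sigma> :: ('v, int) mpol \<Rightarrow> 'a)"
      using is_ring_homD(1)[OF h] by (metis rangeI)
    fix a b assume "a \<in> range (peval of_int \<sigma> :: ('v, int) mpol \<Rightarrow> 'a)" "b \<in> range (peval of_int \<sigma> :: ('v, int) mpol \<Rightarrow> 'a)"
    then obtain f g :: "('v, int) mpol" where "a = peval of_int \<sigma> f" "b = peval of_int \<sigma> g" by blast
    then have "a - b = peval of_int \<sigma> (f - g)" "a * b = peval of_int \<sigma> (f * g)"
      by (simp_all add: hom_diff[OF h] is_ring_homD(3)[OF h])
    then show "a - b \<in> range (peval of_int \<sigma> :: ('v, int) mpol \<Rightarrow> 'a)" "a * b \<in> range (peval of_int \<sigma> :: ('v, int) mpol \<Rightarrow> 'a)"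
      by blast+
  qed
  moreover have "range \<sigma> \<subseteq> range (peval of_int \<sigma> :: ('v, int) mpol \<Rightarrow> 'a)"
  proof clarify
    fix k
    have "\<sigma> k = peval of_int \<sigma> (mvar k)" by (simp add: peval_mvar[OF is_ring_hom_of_int])
    then show "\<sigma> k \<in> range (peval of_int \<sigma> :: ('v, int) mpol \<Rightarrow> 'a)" by blast
  qed
  ultimately show "ring_gen (range \<sigma>) \<subseteq> range (peval of_int \<sigma> :: ('v, int) mpol \<Rightarrow> 'a)"
    by (rule ring_gen_subset)
qed

section \<open>Generators of Gamma and of the polynomial rings over it\<close>

lemma is_ring_hom_abs_gamma: "is_ring_hom abs_gamma"
  by (simp add: is_ring_hom_def one_gamma.abs_eq plus_gamma.abs_eq times_gamma.abs_eq)

lemma gamma_abs: "\<exists>f. x = abs_gamma f"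
  by (rule exI[of _ "rep_gamma x"]) (simp add: Quotient3_abs_rep[OF Quotient3_gamma])

lemma abs_gamma_eq_0: "abs_gamma f = 0 \<longleftrightarrow> f \<in> Gideal"
proof -
  have "abs_gamma f = abs_gamma 0 \<longleftrightarrow> Geq f 0"
    by (rule gamma.abs_eq_iff)
  then show ?thesis by (simp add: zero_gamma.abs_eq Geq_def)
qed

lemma abs_gamma_cpol: "abs_gamma (cpol p) = gc p"
  by (simp add: gc.abs_eq)

lemma gamma_ring_gen: "x \<in> ring_gen (range gc)" for x :: gamma
proof -
  obtain f where f: "x = abs_gamma f" using gamma_abs by blast
  show ?thesis unfolding f
  proof (rule hom_ring_gen[OF is_ring_hom_abs_gamma is_subring_ring_gen _ mpol_int_ring_gen])
    fix g :: "(nat, int) mpol" assume "g \<in> range mvar"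
    then obtain k where "g = cpol (Suc k)" by auto
    then have "abs_gamma g = gc (Suc k)" by (simp only: abs_gamma_cpol)
    then show "abs_gamma g \<in> ring_gen (range gc)" by (auto intro: ring_gen.gen)
  qed
qed

lemma mconst_gamma_ring_gen: "mconst a \<in> ring_gen (range cc)" for a :: gamma
  by (rule hom_ring_gen[OF is_ring_hom_mconst is_subring_ring_gen _ gamma_ring_gen])
     (auto simp: cc_def[symmetric] intro: ring_gen.gen)

lemma GX_mconst: "mconst a \<in> GX n" by (simp add: GX_def mconst_def)

lemma GX_cc: "cc p \<in> GX n" by (simp add: cc_def GX_mconst)

lemma GX_xv: "i \<in> {1..n} \<Longrightarrow> xv i \<in> GX n"
  by (auto simp: GX_def xv_def mvar_def)

lemma is_subring_GX: "is_subring (GX n)"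
  unfolding is_subring_def
proof (intro conjI ballI)
  show "1 \<in> GX n" by (simp add: GX_def)
  fix f g assume f: "f \<in> GX n" and g: "g \<in> GX n"
  show "f - g \<in> GX n"
    using keys_diff[of f g] f g unfolding GX_def by blast
  show "f * g \<in> GX n"
  proof (unfold GX_def, intro CollectI ballI)
    fix m assume "m \<in> Poly_Mapping.keys (f * g)"
    then obtain a b where ab: "m = a + b" "a \<in> Poly_Mapping.keys f" "b \<in> Poly_Mapping.keys g"
      using keys_mult[of f g] by auto
    then show "Poly_Mapping.keys m \<subseteq> XV ` {..<n}"
      using f g Poly_Mapping.keys_add[of a b] unfolding GX_def by blast
  qed
qed

lemma GX_eq: "GX n = ring_gen (range cc \<union> xv ` {1..n})"
proof
  show "ring_gen (range cc \<union> xv ` {1..n}) \<subseteq> GX n"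
    by (rule ring_gen_subset[OF is_subring_GX]) (auto simp: GX_cc intro: GX_xv)
  show "GX n \<subseteq> ring_gen (range cc \<union> xv ` {1..n})"
  proof
    fix f assume f: "f \<in> GX n"
    show "f \<in> ring_gen (range cc \<union> xv ` {1..n})"
    proof (rule mpol_in_subring[OF is_subring_ring_gen])
      show "mconst a \<in> ring_gen (range cc \<union> xv ` {1..n})" for a :: gamma
        by (rule subsetD[OF ring_gen_mono mconst_gamma_ring_gen]) auto
      fix m v assume "m \<in> Poly_Mapping.keys f" "v \<in> Poly_Mapping.keys m"
      then obtain k where "v = XV k" "k < n" using f by (auto simp: GX_def)
      then have "mvar v = xv (Suc k)" "Suc k \<in> {1..n}" by (auto simp: xv_def)
      then show "mvar v \<in> ring_gen (range cc \<union> xv ` {1..n})" by (auto intro: ring_gen.gen)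
    qed
  qed
qed

lemma gxy_ring_gen: "f \<in> ring_gen (range cc \<union> (\<lambda>k. xv (Suc k)) ` UNIV \<union> (\<lambda>k. yv (Suc k)) ` UNIV)" (is "_ \<in> ?R")
proof (rule mpol_in_subring[OF is_subring_ring_gen])
  show "mconst a \<in> ?R" for a :: gamma
    by (rule subsetD[OF ring_gen_mono mconst_gamma_ring_gen]) auto
  show "mvar v \<in> ?R" for v
    by (cases v) (auto intro!: ring_gen.gen simp: xv_def yv_def)
qed

text \<open>Identities between automorphisms, such as the braid relations, are checked on c_p, x_i
  and y_i. Index 0 is left out because \<open>xv 0\<close> and \<open>xv 1\<close> are the same
  variable.\<close>

lemma gxy_hom_eqI:
  assumes "is_ring_hom h" "is_ring_hom k" "\<And>p. h (cc p) = k (cc p)"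
    "\<And>i. i \<ge> 1 \<Longrightarrow> h (xv i) = k (xv i)" "\<And>i. i \<ge> 1 \<Longrightarrow> h (yv i) = k (yv i)"
  shows "h f = k f"
proof (rule hom_eq_on_ring_gen[OF assms(1,2) _ gxy_ring_gen])
  fix g assume "g \<in> range cc \<union> (\<lambda>k. xv (Suc k)) ` UNIV \<union> (\<lambda>k. yv (Suc k)) ` UNIV"
  then show "h g = k g" using assms(3) assms(4)[of "Suc _"] assms(5)[of "Suc _"] by auto
qed

section \<open>\<open>\<Gamma>\<close> has no 2-torsion\<close>

definition evenp :: "('v, int) mpol \<Rightarrow> bool" where
  "evenp f \<longleftrightarrow> (\<exists>g. f = 2 * g)"

lemma lookup_two_mult: "Poly_Mapping.lookup (2 * g) m = 2 * Poly_Mapping.lookup g m"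
  for g :: "('v, 'a::comm_ring_1) mpol"
  by (simp only: mult_2 lookup_add)

lemma two_mult_cancel: "2 * f = 2 * g \<Longrightarrow> f = g" for f g :: "('v, int) mpol"
  by (rule poly_mapping_eqI) (metis lookup_two_mult mult_left_cancel zero_neq_numeral)

lemma evenp_iff: "evenp f \<longleftrightarrow> (\<forall>m. even (Poly_Mapping.lookup f m))" for f :: "('v, int) mpol"
proof
  assume "evenp f" then show "\<forall>m. even (Poly_Mapping.lookup f m)"
    by (auto simp: evenp_def lookup_two_mult)
next
  assume *: "\<forall>m. even (Poly_Mapping.lookup f m)"
  define g where "g = Poly_Mapping.map (\<lambda>k. k div 2) f"
  have "f = 2 * g"
    by (rule poly_mapping_eqI)
       (use * in \<open>auto simp: lookup_two_mult g_def Poly_Mapping.map.rep_eq when_def\<close>)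
  then show "evenp f" by (auto simp: evenp_def)
qed

text \<open>The exponent of c_p^2; the shift comes from \<open>cpol\<close>, where variable k stands
  for c_{k+1}.\<close>

definition sq_mono :: "nat \<Rightarrow> (nat \<Rightarrow>\<^sub>0 nat)" where
  "sq_mono p = Poly_Mapping.single (p - 1) 2"

lemma cpol_square: "p \<ge> 1 \<Longrightarrow> cpol p ^ 2 = Poly_Mapping.single (sq_mono p) 1"
  by (cases p) (auto simp: mvar_def power2_eq_square mult_single sq_mono_def single_add[symmetric] numeral_2_eq_2)

definition Grest :: "nat \<Rightarrow> (nat, int) mpol" where
  "Grest p = (\<Sum>i=1..p. (-1) ^ i * cpol (p + i) * cpol (p - i))"

lemma Grel_cpol: "Grel cpol p = cpol p ^ 2 + 2 * Grest p"
  by (simp add: Grel_def Grest_def)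

text \<open>One coefficient per relation, so that syzygies can be treated by induction on the set of
  indices.\<close>

lemma Gideal_sum: "f \<in> Gideal \<longleftrightarrow> (\<exists>A g. finite A \<and> A \<subseteq> {1..} \<and> f = (\<Sum>p\<in>A. g p * Grel cpol p))"
proof
  assume "f \<in> Gideal"
  then show "\<exists>A g. finite A \<and> A \<subseteq> {1..} \<and> f = (\<Sum>p\<in>A. g p * Grel cpol p)"
    unfolding Gideal_def
  proof (induction rule: module.span_induct_alt[OF module_times, consumes 1])
    case 1 show ?case by (intro exI[of _ "{}"]) auto
  next
    case (2 c x y)
    then obtain A g q where *: "finite A" "A \<subseteq> {1..}" "y = (\<Sum>p\<in>A. g p * Grel cpol p)" "x = Grel cpol q" "q \<ge> 1"
      by blast
    show ?case
    proof (intro exI conjI)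
      show "finite (insert q A)" "insert q A \<subseteq> {1..}" using * by auto
      let ?g' = "\<lambda>p. if p \<in> A then g p else 0"
      have "y = (\<Sum>p\<in>insert q A. ?g' p * Grel cpol p)"
        unfolding *(3) using * by (intro sum.mono_neutral_cong_left) auto
      moreover have "c * x = (\<Sum>p\<in>insert q A. (if p = q then c else 0) * Grel cpol p)"
        using * by (subst sum.remove[of _ q]) (auto intro!: sum.neutral)
      ultimately show "c * x + y = (\<Sum>p\<in>insert q A. ((if p = q then c else 0) + ?g' p) * Grel cpol p)"
        by (simp only: sum.distrib distrib_right)
    qed
  qed
next
  assume "\<exists>A g. finite A \<and> A \<subseteq> {1..} \<and> f = (\<Sum>p\<in>A. g p * Grel cpol p)"
  then obtain A g where A: "finite A" "A \<subseteq> {1..}" "f = (\<Sum>p\<in>A. g p * Grel cpol p)" by blast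
  show "f \<in> Gideal"
    unfolding Gideal_def A(3)
  proof (rule module.span_sum[OF module_times])
    fix p assume "p \<in> A"
    then have "Grel cpol p \<in> {Grel cpol p |p. p \<ge> 1}" using A(2) by auto
    then show "g p * Grel cpol p \<in> module.span (*) {Grel cpol p |p. p \<ge> 1}"
      by (intro module.span_scale[OF module_times] module.span_base[OF module_times])
  qed
qed

lemma lookup_mult_sq:
  "Poly_Mapping.lookup (g * Poly_Mapping.single k 1) m
     = (if \<exists>m'. m = m' + k then Poly_Mapping.lookup g (m - k) else 0)"
  for g :: "('v, 'a::comm_ring_1) mpol"
proof -
  have g: "g = (\<Sum>l\<in>Poly_Mapping.keys g. Poly_Mapping.single l (Poly_Mapping.lookup g l))"
    by (rule mpol_expand)
  have "Poly_Mapping.lookup (g * Poly_Mapping.single k 1) m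
      = (\<Sum>l\<in>Poly_Mapping.keys g. Poly_Mapping.lookup (Poly_Mapping.single (l + k) (Poly_Mapping.lookup g l)) m)"
    by (subst g) (simp add: sum_distrib_right mult_single lookup_sum)
  also have "\<dots> = (\<Sum>l\<in>Poly_Mapping.keys g. if l + k = m then Poly_Mapping.lookup g l else 0)"
    by (simp add: lookup_single when_def)
  also have "\<dots> = (if \<exists>m'. m = m' + k then Poly_Mapping.lookup g (m - k) else 0)"
  proof (cases "\<exists>m'. m = m' + k")
    case True
    then obtain m' where m': "m = m' + k" by blast
    then have "(\<Sum>l\<in>Poly_Mapping.keys g. if l + k = m then Poly_Mapping.lookup g l else 0)
      = (\<Sum>l\<in>Poly_Mapping.keys g. if l = m' then Poly_Mapping.lookup g l else 0)" by simp
    also have "\<dots> = Poly_Mapping.lookup g m'"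
      by (simp add: in_keys_iff)
    finally show ?thesis using m' by auto
  qed (auto intro!: sum.neutral)
  finally show ?thesis .
qed

text \<open>The squares \<open>c\<^sub>p\<^sup>2\<close> form a regular sequence modulo 2, so a syzygy modulo 2 of the relations
  is a combination of the trivial ones; this makes the coefficients even one at a time.\<close>

lemma Grel_syzygy_even:
  assumes "finite A" "A \<subseteq> {1..}" "evenp (\<Sum>p\<in>A. g p * Grel cpol p)"
  shows "\<exists>g'. (\<Sum>p\<in>A. g p * Grel cpol p) = 2 * (\<Sum>p\<in>A. g' p * Grel cpol p)"
  using assms
proof (induction A arbitrary: g rule: finite_induct)
  case empty show ?case by simp
next
  case (insert p A)
  let ?L = Poly_Mapping.lookup
  have p1: "p \<ge> 1" and A1: "A \<subseteq> {1..}" using insert.prems by auto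
  \<comment> \<open>Modulo 2 each relation is just a square.\<close>
  have ev: "evenp (\<Sum>q\<in>insert p A. g q * cpol q ^ 2)"
  proof -
    have gen: "s = q + 2 * r \<Longrightarrow> s = 2 * h \<Longrightarrow> q = 2 * (h - r)" for s q r h :: "(nat, int) mpol"
      by (simp add: algebra_simps)
    have "(\<Sum>q\<in>insert p A. g q * Grel cpol q) = (\<Sum>q\<in>insert p A. g q * cpol q ^ 2) + 2 * (\<Sum>q\<in>insert p A. g q * Grest q)"
      unfolding sum_distrib_left sum.distrib[symmetric]
      by (rule sum.cong) (simp_all add: Grel_cpol algebra_simps)
    moreover obtain h where "(\<Sum>q\<in>insert p A. g q * Grel cpol q) = 2 * h"
      using insert.prems(2) by (auto simp: evenp_def)
    ultimately have "(\<Sum>q\<in>insert p A. g q * cpol q ^ 2) = 2 * (h - (\<Sum>q\<in>insert p A. g q * Grest q))"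
      by (rule gen)
    then show ?thesis unfolding evenp_def by blast
  qed
  \<comment> \<open>An odd term m of \<open>g p\<close> makes m c_p^2 cancel modulo 2 against a
    multiple of some other c_q^2; as p and q differ, c_q^2 already divides m.\<close>
  have dv: "\<exists>q\<in>A. \<exists>m'. m = m' + sq_mono q" if odd: "odd (?L (g p) m)" for m
  proof (rule ccontr)
    assume no: "\<not> ?thesis"
    have neq: "\<not> (\<exists>m'. m + sq_mono p = m' + sq_mono q)" if q: "q \<in> A" for q
    proof
      assume "\<exists>m'. m + sq_mono p = m' + sq_mono q"
      then obtain m' where m': "m + sq_mono p = m' + sq_mono q" by blast
      have qp: "q - 1 \<noteq> p - 1" using q insert.hyps p1 A1 by (metis atLeast_iff diff_add_inverse2 insert_absorb insert_subset le_add_diff_inverse2 subsetD)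
      have "?L m (q - 1) \<ge> 2"
        using arg_cong[OF m', of "\<lambda>f. ?L f (q - 1)"] qp
        by (simp add: lookup_add sq_mono_def lookup_single)
      then have "m = (m - sq_mono q) + sq_mono q"
        by (intro poly_mapping_eqI) (auto simp: lookup_add lookup_minus sq_mono_def lookup_single when_def)
      then show False using no q by blast
    qed
    have "?L (\<Sum>q\<in>insert p A. g q * cpol q ^ 2) (m + sq_mono p)
      = ?L (g p * cpol p ^ 2) (m + sq_mono p) + (\<Sum>q\<in>A. ?L (g q * cpol q ^ 2) (m + sq_mono p))"
      using insert.hyps by (simp add: lookup_add lookup_sum)
    also have "(\<Sum>q\<in>A. ?L (g q * cpol q ^ 2) (m + sq_mono p)) = 0"
      using A1 neq by (intro sum.neutral ballI) (subst cpol_square, auto simp: lookup_mult_sq)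
    also have "?L (g p * cpol p ^ 2) (m + sq_mono p) = ?L (g p) m"
      using p1 by (auto simp: cpol_square lookup_mult_sq)
    finally have e: "?L (\<Sum>q\<in>insert p A. g q * cpol q ^ 2) (m + sq_mono p) = ?L (g p) m" by (simp only: add_0_right)
    from ev have "even (?L (\<Sum>q\<in>insert p A. g q * cpol q ^ 2) (m + sq_mono p))"
      unfolding evenp_iff by (rule spec)
    then show False using odd unfolding e by (rule notE[rotated])
  qed
  define K where "K = {m \<in> Poly_Mapping.keys (g p). odd (?L (g p) m)}"
  have finK: "finite K" by (simp add: K_def)
  define q where "q m = (SOME q. q \<in> A \<and> (\<exists>m'. m = m' + sq_mono q))" for m
  have q: "q m \<in> A \<and> (\<exists>m'. m = m' + sq_mono (q m))" if "m \<in> K" for m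
    unfolding q_def by (rule someI_ex) (use dv[of m] that in \<open>auto simp: K_def\<close>)
  have "evenp (g p - (\<Sum>m\<in>K. Poly_Mapping.single m 1))"
    unfolding evenp_iff
  proof
    fix m
    have "?L (\<Sum>m\<in>K. Poly_Mapping.single m 1) m = (if m \<in> K then 1 else 0 :: int)"
      using finK by (simp add: lookup_sum lookup_single when_def)
    then show "even (?L (g p - (\<Sum>m\<in>K. Poly_Mapping.single m 1)) m)"
      by (auto simp: lookup_minus K_def in_keys_iff)
  qed
  then obtain g2 where g2: "g p = (\<Sum>m\<in>K. Poly_Mapping.single m 1) + 2 * g2"
    unfolding evenp_def by (metis add.commute diff_eq_eq)
  \<comment> \<open>The odd monomials of \<open>g p\<close> are distributed among the squares that
    divide them.\<close>
  define h where "h r = (\<Sum>m\<in>{m\<in>K. q m = r}. Poly_Mapping.single (m - sq_mono r) (1::int))" for r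
  have "(\<Sum>m\<in>K. Poly_Mapping.single m (1::int)) = (\<Sum>r\<in>A. \<Sum>m\<in>{m\<in>K. q m = r}. Poly_Mapping.single m 1)"
    using finK insert.hyps(1) q by (subst sum.group) auto
  also have "\<dots> = (\<Sum>r\<in>A. h r * cpol r ^ 2)"
  proof (rule sum.cong[OF refl])
    fix r assume "r \<in> A"
    then have "cpol r ^ 2 = Poly_Mapping.single (sq_mono r) 1" using A1 by (intro cpol_square) auto
    then show "(\<Sum>m\<in>{m\<in>K. q m = r}. Poly_Mapping.single m 1) = h r * cpol r ^ 2"
      unfolding h_def sum_distrib_right
      by (intro sum.cong) (use q in \<open>auto simp: mult_single\<close>, metis diff_add_cancel add_diff_cancel_right')
  qed
  finally have gp: "g p = (\<Sum>r\<in>A. h r * cpol r ^ 2) + 2 * g2" using g2 by simp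
  \<comment> \<open>Passing from c_r^2 to the full relation changes only the even remainder.\<close>
  define g3 where "g3 = g2 - (\<Sum>r\<in>A. h r * Grest r)"
  have gp: "g p = (\<Sum>r\<in>A. h r * Grel cpol r) + 2 * g3"
    unfolding gp g3_def Grel_cpol
    by (simp add: algebra_simps sum.distrib sum_distrib_left sum_subtractf)
  \<comment> \<open>The trivial syzygy between relations p and r moves \<open>h r\<close> from the
    coefficient of the former to that of the latter. The coefficient left at p is even, and the
    induction hypothesis applies to \<open>A\<close>.\<close>
  define G where "G r = g r + h r * Grel cpol p" for r
  have eq: "(\<Sum>r\<in>insert p A. g r * Grel cpol r) = 2 * (g3 * Grel cpol p) + (\<Sum>r\<in>A. G r * Grel cpol r)"
    using insert.hyps
    by (simp add: gp G_def algebra_simps sum.distrib sum_distrib_left)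
  obtain k where "(\<Sum>r\<in>insert p A. g r * Grel cpol r) = 2 * k" using insert.prems(2) by (auto simp: evenp_def)
  then have "(\<Sum>r\<in>A. G r * Grel cpol r) = 2 * (k - g3 * Grel cpol p)"
    using eq by (simp add: algebra_simps)
  then have "evenp (\<Sum>r\<in>A. G r * Grel cpol r)" unfolding evenp_def by blast
  then obtain G' where G': "(\<Sum>r\<in>A. G r * Grel cpol r) = 2 * (\<Sum>r\<in>A. G' r * Grel cpol r)"
    using insert.IH[OF A1] by blast
  show ?case
  proof
    have "(\<Sum>r\<in>insert p A. (if r = p then g3 else G' r) * Grel cpol r)
        = g3 * Grel cpol p + (\<Sum>r\<in>A. G' r * Grel cpol r)"
      using insert.hyps by (auto intro!: sum.cong)
    then show "(\<Sum>r\<in>insert p A. g r * Grel cpol r) = 2 * (\<Sum>r\<in>insert p A. (if r = p then g3 else G' r) * Grel cpol r)"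
      unfolding eq G' by (simp only: distrib_left)
  qed
qed

text \<open>If 2f lies in the ideal, it is an even combination of the relations, hence by
  \<open>Grel_syzygy_even\<close> twice a combination; cancelling 2 in the polynomial ring puts f
  into the ideal.\<close>

lemma gamma_two_torsion_free: "2 * a = 0 \<Longrightarrow> a = 0" for a :: gamma
proof -
  assume a: "2 * a = 0"
  obtain f where f: "a = abs_gamma f" using gamma_abs by blast
  have "abs_gamma (2 * f) = 0"
    using a by (simp add: f hom_simps[OF is_ring_hom_abs_gamma])
  then obtain A g where A: "finite A" "A \<subseteq> {1..}" "2 * f = (\<Sum>p\<in>A. g p * Grel cpol p)"
    unfolding abs_gamma_eq_0 Gideal_sum by blast
  then have "evenp (\<Sum>p\<in>A. g p * Grel cpol p)" by (metis evenp_def)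
  from Grel_syzygy_even[OF A(1,2) this] obtain g' where
    "2 * f = 2 * (\<Sum>p\<in>A. g' p * Grel cpol p)" using A(3) by auto
  then have "f = (\<Sum>p\<in>A. g' p * Grel cpol p)" by (rule two_mult_cancel)
  then have "f \<in> Gideal" unfolding Gideal_sum using A by blast
  then show "a = 0" by (simp add: f abs_gamma_eq_0)
qed

section \<open>Divided differences\<close>

lemma lookup_mult_keys:
  "Poly_Mapping.lookup (f * g) k = (\<Sum>a\<in>Poly_Mapping.keys f. \<Sum>b\<in>Poly_Mapping.keys g.
     if a + b = k then Poly_Mapping.lookup f a * Poly_Mapping.lookup g b else 0)"
  for f g :: "('v, 'a::comm_ring_1) mpol"
proof -
  have "f * g = (\<Sum>a\<in>Poly_Mapping.keys f. \<Sum>b\<in>Poly_Mapping.keys g.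
      Poly_Mapping.single (a + b) (Poly_Mapping.lookup f a * Poly_Mapping.lookup g b))"
    by (subst mpol_expand[of f], subst mpol_expand[of g]) (simp only: sum_product mult_single)
  then show ?thesis by (simp add: lookup_sum lookup_single when_def)
qed

text \<open>The weight need not separate monomials: as \<open>bt\<close> alone has top weight in g,
  exponents from f and g with sum \<open>ak + bt\<close> must be \<open>ak\<close> and
  \<open>bt\<close>.\<close>

lemma lookup_mult_top:
  fixes f g :: "('v, 'a::comm_ring_1) mpol" and wt :: "('v \<Rightarrow>\<^sub>0 nat) \<Rightarrow> nat"
  assumes add: "\<And>m m'. wt (m + m') = wt m + wt m'"
    and f: "\<And>a. a \<in> Poly_Mapping.keys f \<Longrightarrow> wt a \<le> wt ak"
    and g: "\<And>b. b \<in> Poly_Mapping.keys g \<Longrightarrow> b \<noteq> bt \<Longrightarrow> wt b < wt bt"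
  shows "Poly_Mapping.lookup (f * g) (ak + bt) = Poly_Mapping.lookup f ak * Poly_Mapping.lookup g bt"
proof -
  have eq: "a + b = ak + bt \<longleftrightarrow> a = ak \<and> b = bt"
    if "a \<in> Poly_Mapping.keys f" "b \<in> Poly_Mapping.keys g" for a b
  proof
    assume e: "a + b = ak + bt"
    then have "wt a + wt b = wt ak + wt bt" using add by metis
    then have "b = bt" using f[OF that(1)] g[OF that(2)] by (cases "b = bt") auto
    then show "a = ak \<and> b = bt" using e by simp
  qed auto
  have "Poly_Mapping.lookup (f * g) (ak + bt) = (\<Sum>a\<in>Poly_Mapping.keys f. \<Sum>b\<in>Poly_Mapping.keys g.
      if a = ak \<and> b = bt then Poly_Mapping.lookup f a * Poly_Mapping.lookup g b else 0)"
    unfolding lookup_mult_keys by (intro sum.cong refl) (simp add: eq)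
  also have "\<dots> = (\<Sum>a\<in>Poly_Mapping.keys f. if a = ak then
      (\<Sum>b\<in>Poly_Mapping.keys g. if b = bt then Poly_Mapping.lookup f a * Poly_Mapping.lookup g b else 0) else 0)"
    by (intro sum.cong refl) auto
  also have "\<dots> = Poly_Mapping.lookup f ak * Poly_Mapping.lookup g bt"
    by (simp add: in_keys_iff)
  finally show ?thesis .
qed

section \<open>Non-zero-divisors\<close>

definition nzd :: "'a::comm_ring_1 \<Rightarrow> bool" where
  "nzd d \<longleftrightarrow> (\<forall>q. d * q = 0 \<longrightarrow> q = 0)"

lemma nzd_mult: "nzd a \<Longrightarrow> nzd b \<Longrightarrow> nzd (a * b)"
  unfolding nzd_def by (metis mult.assoc)

lemma nzd_uminus: "nzd a \<Longrightarrow> nzd (- a)"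
  by (auto simp: nzd_def)

lemma nzd_cancel: "nzd d \<Longrightarrow> d * p = d * q \<Longrightarrow> p = q"
  unfolding nzd_def by (metis right_diff_distrib right_minus_eq)

text \<open>A heaviest term of q meets the unique heaviest term of d, so a vanishing product would
  make the top coefficient of d a zero divisor.\<close>

lemma nzd_top:
  fixes d :: "('v, 'a::comm_ring_1) mpol" and wt :: "('v \<Rightarrow>\<^sub>0 nat) \<Rightarrow> nat"
  assumes add: "\<And>m m'. wt (m + m') = wt m + wt m'"
    and top: "\<And>m. m \<in> Poly_Mapping.keys d \<Longrightarrow> m \<noteq> bt \<Longrightarrow> wt m < wt bt"
    and c: "nzd (Poly_Mapping.lookup d bt)"
  shows "nzd d"
  unfolding nzd_def
proof (intro allI impI, rule ccontr)
  fix q assume z: "d * q = 0" and "q \<noteq> 0"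
  then have ne: "Poly_Mapping.keys q \<noteq> {}" by simp
  obtain ak where ak: "ak \<in> Poly_Mapping.keys q" "\<And>a. a \<in> Poly_Mapping.keys q \<Longrightarrow> wt a \<le> wt ak"
  proof -
    have "Max (wt ` Poly_Mapping.keys q) \<in> wt ` Poly_Mapping.keys q"
      by (rule Max_in) (use ne in auto)
    then obtain a where "a \<in> Poly_Mapping.keys q" "wt a = Max (wt ` Poly_Mapping.keys q)" by auto
    then show ?thesis using that[of a] by simp
  qed
  have "Poly_Mapping.lookup (q * d) (ak + bt) = Poly_Mapping.lookup q ak * Poly_Mapping.lookup d bt"
    by (rule lookup_mult_top[OF add ak(2) top])
  then have "Poly_Mapping.lookup d bt * Poly_Mapping.lookup q ak = 0"
    using z by (simp add: mult.commute)
  then show False using c ak(1) by (simp add: nzd_def in_keys_iff)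
qed

lemma nzd_two: "nzd (2 :: gxy)"
  unfolding nzd_def
proof (intro allI impI poly_mapping_eqI)
  fix q :: gxy and m assume "2 * q = 0"
  then have "2 * Poly_Mapping.lookup q m = 0" by (metis lookup_two_mult lookup_zero)
  then show "Poly_Mapping.lookup q m = Poly_Mapping.lookup 0 m" by (simp add: gamma_two_torsion_free)
qed

lemma nzd_one: "nzd 1" by (simp add: nzd_def)

lemma nzd_xv: "nzd (xv i)"
  \<comment> \<open>A single monomial needs no comparison, so the zero weight will do.\<close>
  by (rule nzd_top[where wt="\<lambda>_. 0" and bt="Poly_Mapping.single (XV (i - 1)) 1"])
     (auto simp: xv_def mvar_def nzd_one)

lemma nzd_xv_diff:
  assumes "i \<ge> 1" "j \<ge> 1" "i \<noteq> j"
  shows "nzd (xv i - xv j)" "nzd (xv i + xv j)"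
proof -
  have ne: "XV (i - 1) \<noteq> XV (j - 1)" using assms by auto
  let ?wt = "\<lambda>m. Poly_Mapping.lookup m (XV (i - 1))" and ?b = "Poly_Mapping.single (XV (i - 1)) (1::nat)"
  let ?c = "Poly_Mapping.single (XV (j - 1)) (1::nat)"
  have bc: "?b \<noteq> ?c" using ne by (metis lookup_single_eq lookup_single_not_eq zero_neq_one)
  have k: "Poly_Mapping.keys (xv i - xv j) \<subseteq> {?b, ?c}" "Poly_Mapping.keys (xv i + xv j) \<subseteq> {?b, ?c}"
    using keys_diff[of "xv i" "xv j"] Poly_Mapping.keys_add[of "xv i" "xv j"] by (auto simp: xv_def mvar_def)
  show "nzd (xv i - xv j)" "nzd (xv i + xv j)"
    by (rule nzd_top[where wt="?wt" and bt="?b"];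
        use ne k bc in \<open>auto simp: lookup_add lookup_minus xv_def mvar_def lookup_single when_def nzd_one\<close>)+
qed

definition ddenom :: "nat \<Rightarrow> gxy" where
  "ddenom i = (if i = 0 then - 2 * xv 1 else xv i - xv (Suc i))"

lemma nzd_ddenom: "nzd (ddenom i)"
  unfolding ddenom_def by (auto intro!: nzd_xv_diff nzd_uminus nzd_mult nzd_two nzd_xv)

text \<open>The description in \<open>exact_div\<close> singles out the quotient because the
  denominator can be cancelled.\<close>

lemma exact_div_eq: "nzd d \<Longrightarrow> d * q = f \<Longrightarrow> exact_div f d = q"
  unfolding exact_div_def by (rule the_equality) (auto intro: nzd_cancel)

section \<open>The action of the generators on Gamma[X, Y]\<close>

lemma is_ring_hom_perm_act: "is_ring_hom (perm_act \<pi>)"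
  unfolding perm_act_def by (rule peval_ring_hom[OF is_ring_hom_mconst])

lemma peval_mconst: "is_ring_hom \<phi> \<Longrightarrow> peval \<phi> \<sigma> (mconst a) = \<phi> a"
  by (simp add: mconst_def peval_single is_ring_hom_zero mono_eval_def)

lemma perm_act_simps:
  "perm_act \<pi> (cc p) = cc p" "i \<ge> 1 \<Longrightarrow> perm_act \<pi> (xv i) = xv (\<pi> i)" "i \<ge> 1 \<Longrightarrow> perm_act \<pi> (yv i) = yv i"
  by (simp_all add: perm_act_def cc_def xv_def yv_def peval_mconst[OF is_ring_hom_mconst]
      peval_mvar[OF is_ring_hom_mconst])

lemma s0_act_simps:
  "s0_act (xv 1) = - xv 1" "i \<ge> 2 \<Longrightarrow> s0_act (xv i) = xv i" "i \<ge> 1 \<Longrightarrow> s0_act (yv i) = yv i"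
  using gamma_eval_ring_hom(1)[OF s0c_0 Grel_s0c]
  by (auto simp: s0_act_def xv_def yv_def peval_mvar)

lemma is_ring_hom_s_act: "is_ring_hom (s_act i)"
  by (simp add: s_act_def s0_act_ring_hom is_ring_hom_perm_act)

lemmas s_act_hom = hom_simps[OF is_ring_hom_s_act]

lemma s_act_simps:
  "s_act i (cc p) = (if i = 0 then s0c p else cc p)"
  "j \<ge> 1 \<Longrightarrow> s_act i (xv j) = (if i = 0 then (if j = 1 then - xv 1 else xv j)
      else if j = i then xv (Suc i) else if j = Suc i then xv i else xv j)"
  "j \<ge> 1 \<Longrightarrow> s_act i (yv j) = yv j"
  by (auto simp: s_act_def s0_act_cc perm_act_simps s0_act_simps[simplified] Transposition.transpose_def)

text \<open>Applying s_0 to the recursion \<open>s0c_Suc\<close> gives a recursion for the images,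
  which the c_p satisfy as well.\<close>

lemma s0_s0c: "s_act 0 (s0c p) = cc p"
proof (induction p)
  case (Suc p)
  have "s_act 0 (s0c (Suc p) - xv 1 * s0c p) = s_act 0 (cc (Suc p) + xv 1 * cc p)"
    by (simp only: s0c_Suc)
  then have "s_act 0 (s0c (Suc p)) + xv 1 * cc p = s0c (Suc p) - xv 1 * s0c p"
    by (simp add: s_act_hom s_act_simps Suc.IH)
  then show ?case unfolding s0c_Suc by simp
qed (simp add: s0c_0 cc_0 s_act_hom)

lemma s_act_s_act: "s_act i (s_act i f) = f"
  by (rule gxy_hom_eqI[of "\<lambda>f. s_act i (s_act i f)" id, unfolded id_apply])
     (auto simp: is_ring_hom_def s_act_hom s_act_simps s0_s0c)

lemma s_act_GX:
  assumes "i < n" "f \<in> GX n"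
  shows "s_act i f \<in> GX n"
proof (rule hom_ring_gen[OF is_ring_hom_s_act is_subring_GX _ assms(2)[unfolded GX_eq]])
  fix g assume "g \<in> range cc \<union> xv ` {1..n}"
  moreover have "s0c p \<in> GX n" for p
    unfolding s0c_def using assms(1)
    by (intro subring_intros[OF is_subring_GX] GX_cc GX_xv) auto
  ultimately show "s_act i g \<in> GX n"
    using assms(1) by (auto simp: s_act_simps GX_cc intro!: GX_xv subring_intros[OF is_subring_GX])
qed

text \<open>The twisted Leibniz rule fg - s(fg) = (f - sf) g + sf (g - sg) carries divisibility by d
  from generators to the whole ring, with quotients staying in R.\<close>

lemma twisted_division_subring:
  assumes s: "is_ring_hom s" and R: "is_subring R" and sR: "\<And>f. f \<in> R \<Longrightarrow> s f \<in> R"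
  shows "is_subring {f \<in> R. \<exists>q\<in>R. d * q = f - s f}"
  unfolding is_subring_def
proof (intro conjI ballI)
  note Ri = subring_intros[OF R]
  show "1 \<in> {f \<in> R. \<exists>q\<in>R. d * q = f - s f}"
    using Ri(1,2) by (auto simp: hom_simps[OF s] intro!: bexI[of _ 0])
  fix f g assume "f \<in> {f \<in> R. \<exists>q\<in>R. d * q = f - s f}" "g \<in> {f \<in> R. \<exists>q\<in>R. d * q = f - s f}"
  then obtain p q where fg: "f \<in> R" "g \<in> R" "p \<in> R" "q \<in> R" "d * p = f - s f" "d * q = g - s g" by blast
  have "d * (p - q) = f - g - s (f - g)" by (simp add: algebra_simps hom_simps[OF s] fg)
  then show "f - g \<in> {f \<in> R. \<exists>q\<in>R. d * q = f - s f}" using fg Ri(3) by blast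
  have "d * (p * g + s f * q) = (d * p) * g + s f * (d * q)" by (simp add: algebra_simps)
  also have "\<dots> = f * g - s (f * g)" unfolding fg(5,6) by (simp add: algebra_simps hom_simps[OF s])
  finally have "d * (p * g + s f * q) = f * g - s (f * g)" .
  moreover have "p * g + s f * q \<in> R" using fg sR by (intro Ri(4,6)) auto
  ultimately show "f * g \<in> {f \<in> R. \<exists>q\<in>R. d * q = f - s f}" using fg Ri(4) by blast
qed

text \<open>Stated for a general R to yield both the existence of \<open>ddx\<close> on Gamma[X, Y]
  and its stability on Gamma[X_n].\<close>

lemma ddenom_quotient_gen:
  assumes R: "is_subring R" "i < n" "\<And>p. cc p \<in> R" "\<And>j. j \<in> {1..n} \<Longrightarrow> xv j \<in> R"
  shows "\<exists>q\<in>R. ddenom i * q = cc p - s_act i (cc p)"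
    and "j \<ge> 1 \<Longrightarrow> \<exists>q\<in>R. ddenom i * q = xv j - s_act i (xv j)"
proof -
  note Ri = subring_intros[OF R(1)]
  have "ddenom i * (if i = 0 then \<Sum>j=1..p. xv 1 ^ (j - 1) * cc (p - j) else 0) = cc p - s_act i (cc p)"
  proof (cases "i = 0")
    case True
    have "xv 1 * (xv 1 ^ (j - 1) * cc (p - j)) = xv 1 ^ j * cc (p - j)" if "j \<in> {1..p}" for j
      using that by (cases j) (auto simp: mult.assoc)
    then have "xv 1 * (\<Sum>j=1..p. xv 1 ^ (j - 1) * cc (p - j)) = (\<Sum>j=1..p. xv 1 ^ j * cc (p - j))"
      unfolding sum_distrib_left by (intro sum.cong) auto
    then show ?thesis using True by (simp add: ddenom_def s_act_simps s0c_def mult.assoc)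
  qed (simp add: s_act_simps)
  moreover have "(if i = 0 then \<Sum>j=1..p. xv 1 ^ (j - 1) * cc (p - j) else 0) \<in> R"
    using R(2) by (auto intro!: Ri R(3,4))
  ultimately show "\<exists>q\<in>R. ddenom i * q = cc p - s_act i (cc p)" by blast
  assume "j \<ge> 1"
  then have "ddenom i * (if i = 0 then if j = 1 then -1 else 0 else if j = i then 1 else if j = Suc i then -1 else 0)
     = xv j - s_act i (xv j)"
    by (auto simp: ddenom_def s_act_simps)
  moreover have "(if i = 0 then if j = 1 then -1 else 0 else if j = i then 1 else if j = Suc i then -1 else 0) \<in> R"
    by (auto intro!: Ri)
  ultimately show "\<exists>q\<in>R. ddenom i * q = xv j - s_act i (xv j)" by blast
qed

lemma ddenom_quotient: "\<exists>q. ddenom i * q = f - s_act i f"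
proof -
  have "f \<in> {f \<in> UNIV. \<exists>q\<in>UNIV. ddenom i * q = f - s_act i f}"
  proof (rule subsetD[OF ring_gen_subset[OF twisted_division_subring[OF is_ring_hom_s_act]] gxy_ring_gen])
    have y: "ddenom i * 0 = yv (Suc k) - s_act i (yv (Suc k))" for k by (simp add: s_act_simps)
    show "range cc \<union> (\<lambda>k. xv (Suc k)) ` UNIV \<union> (\<lambda>k. yv (Suc k)) ` UNIV
        \<subseteq> {f \<in> UNIV. \<exists>q\<in>UNIV. ddenom i * q = f - s_act i f}"
      using ddenom_quotient_gen(1)[of UNIV i "Suc i"] ddenom_quotient_gen(2)[of UNIV i "Suc i" "Suc _"] y
      by (fastforce simp: is_subring_def)
  qed (auto simp: is_subring_def)
  then show ?thesis by blast
qed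

lemma ddenom_quotient_GX:
  assumes "i < n" "f \<in> GX n"
  shows "\<exists>q\<in>GX n. ddenom i * q = f - s_act i f"
proof -
  have "f \<in> {f \<in> GX n. \<exists>q\<in>GX n. ddenom i * q = f - s_act i f}"
  proof (rule subsetD[OF ring_gen_subset[OF twisted_division_subring[OF is_ring_hom_s_act is_subring_GX]] assms(2)[unfolded GX_eq]])
    show "range cc \<union> xv ` {1..n} \<subseteq> {f \<in> GX n. \<exists>q\<in>GX n. ddenom i * q = f - s_act i f}"
      using ddenom_quotient_gen[OF is_subring_GX assms(1) GX_cc GX_xv] by (auto simp: GX_cc intro: GX_xv)
  qed (rule s_act_GX[OF assms(1)])
  then show ?thesis by blast
qed

lemma ddx_unique: "ddenom i * q = f - s_act i f \<Longrightarrow> ddx i f = q"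
  unfolding ddx_def ddenom_def[symmetric] by (rule exact_div_eq[OF nzd_ddenom])

lemma ddx_eq: "ddenom i * ddx i f = f - s_act i f"
  using ddenom_quotient[of i f] ddx_unique by blast

lemma ddx_GX: "i < n \<Longrightarrow> f \<in> GX n \<Longrightarrow> ddx i f \<in> GX n"
  using ddenom_quotient_GX[of i n f] ddx_unique by blast

lemma ddx_add: "ddx i (f + g) = ddx i f + ddx i g"
  by (rule ddx_unique) (simp add: distrib_left ddx_eq s_act_hom)

lemma ddx_zero: "ddx i 0 = 0"
  by (rule ddx_unique) (simp add: s_act_hom)

lemma ddx_scale: "s_act i a = a \<Longrightarrow> ddx i (a * f) = a * ddx i f"
  by (rule ddx_unique) (simp add: mult.left_commute[of "ddenom i"] ddx_eq s_act_hom right_diff_distrib)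

lemma ddx_eq_0: "ddx i f = 0 \<longleftrightarrow> s_act i f = f"
  using ddx_eq[of i f] ddx_unique[of i 0 f] by auto

lemma s_act_ddenom: "s_act i (ddenom i) = - ddenom i"
  by (auto simp: ddenom_def s_act_hom s_act_simps)

text \<open>Numerator and denominator of the quotient both change sign under
  \<open>s_act i\<close>.\<close>

lemma s_act_ddx: "s_act i (ddx i f) = ddx i f"
proof (rule ddx_unique[symmetric])
  have "s_act i (ddenom i * ddx i f) = s_act i (f - s_act i f)" by (simp only: ddx_eq)
  then have "- (ddenom i * s_act i (ddx i f)) = s_act i f - f"
    by (simp add: s_act_hom s_act_ddenom s_act_s_act)
  then show "ddenom i * s_act i (ddx i f) = f - s_act i f"
    by (metis minus_diff_eq minus_minus)
qed

lemma ddx_ddx: "ddx i (ddx i f) = 0"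
  by (simp add: ddx_eq_0 s_act_ddx)

section \<open>Braid relations\<close>

lemma s_act_comm:
  assumes "Suc i < j"
  shows "s_act i (s_act j f) = s_act j (s_act i f)"
proof (rule gxy_hom_eqI[of "\<lambda>f. s_act i (s_act j f)" "\<lambda>f. s_act j (s_act i f)"])
  show "s_act i (s_act j (cc p)) = s_act j (s_act i (cc p))" for p
    using assms by (auto simp: s_act_simps s0c_def s_act_hom)
qed (use assms in \<open>auto simp: is_ring_hom_def s_act_hom s_act_simps\<close>)

lemma s_act_braid3:
  assumes "i \<ge> 1"
  shows "s_act i (s_act (Suc i) (s_act i f)) = s_act (Suc i) (s_act i (s_act (Suc i) f))"
  by (rule gxy_hom_eqI[of "\<lambda>f. s_act i (s_act (Suc i) (s_act i f))" "\<lambda>f. s_act (Suc i) (s_act i (s_act (Suc i) f))"])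
     (use assms in \<open>auto simp: is_ring_hom_def s_act_hom s_act_simps\<close>)

text \<open>With x = x_1 and y = x_2, both sides are coefficients of c(t) (1 + xt)(1 + yt) / ((1 -
  xt)(1 - yt)), which is symmetric in x and y. They are compared through a common recursion of order
  two.\<close>

lemma s_act_braid4_cc: "s_act 0 (s_act 1 (s0c p)) = s_act 1 (s_act 0 (s_act 1 (s0c p)))"
proof -
  let ?x = "xv 1" and ?y = "xv 2"
  define u v w where "u p = s_act 1 (s0c p)" and "v p = s_act 0 (s_act 1 (s0c p))"
    and "w p = s_act 1 (s_act 0 (s_act 1 (s0c p)))" for p
  have act: "s_act 1 ?x = ?y" "s_act 1 ?y = ?x" "s_act 0 ?y = ?y" "s_act 0 ?x = - ?x"
    by (auto simp: s_act_simps numeral_2_eq_2)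
  \<comment> \<open>The recursions of \<open>u\<close>, \<open>v\<close>, \<open>w\<close> are the
    images of \<open>s0c_Suc\<close> under s_1, s_0 s_1 and s_1 s_0 s_1.\<close>
  have u: "u (Suc p) - ?y * u p = cc (Suc p) + ?y * cc p" for p
    using arg_cong[OF s0c_Suc[of p], of "s_act 1"] by (simp del: One_nat_def add: u_def s_act_hom act s_act_simps(1))
  have v: "v (Suc p) - ?y * v p = s0c (Suc p) + ?y * s0c p" for p
    using arg_cong[OF u[of p], of "s_act 0"] by (simp del: One_nat_def add: u_def v_def s_act_hom act s_act_simps(1))
  have w: "w (Suc p) - ?x * w p = u (Suc p) + ?x * u p" for p
    using arg_cong[OF v[of p], of "s_act 1"] by (simp del: One_nat_def add: u_def v_def w_def s_act_hom act)
  have zero: "u 0 = 1" "v 0 = 1" "w 0 = 1" by (simp_all add: u_def v_def w_def s0c_0 s_act_hom)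
  have c: "s0c (Suc p) = cc (Suc p) + ?x * cc p + ?x * s0c p" for p
    using s0c_Suc[of p] by (simp add: algebra_simps)
  have u': "u (Suc p) = cc (Suc p) + ?y * cc p + ?y * u p" for p
    using u[of p] by (simp add: algebra_simps)
  have v': "v (Suc p) = s0c (Suc p) + ?y * s0c p + ?y * v p" for p
    using v[of p] by (simp add: algebra_simps)
  have w': "w (Suc p) = u (Suc p) + ?x * u p + ?x * w p" for p
    using w[of p] by (simp add: algebra_simps)
  \<comment> \<open>The coefficient of c(t) (1 + xt)(1 + yt) at t^(p+2).\<close>
  define r where "r p = cc (Suc (Suc p)) + ?x * cc (Suc p) + ?y * (cc (Suc p) + ?x * cc p)" for p
  have v2: "v (Suc (Suc p)) = r p + (?x + ?y) * v (Suc p) - ?x * ?y * v p" for p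
    unfolding v'[of "Suc p"] c[of "Suc p"] r_def using v'[of p] c[of p] by (simp add: algebra_simps)
  have w2: "w (Suc (Suc p)) = r p + (?x + ?y) * w (Suc p) - ?x * ?y * w p" for p
    unfolding w'[of "Suc p"] u'[of "Suc p"] r_def using w'[of p] u'[of p] by (simp add: algebra_simps)
  have "v p = w p \<and> v (Suc p) = w (Suc p)"
  proof (induction p)
    case 0 show ?case unfolding v' w' c u' by (simp add: zero s0c_0 cc_0 algebra_simps)
  next
    case (Suc p) then show ?case using v2 w2 by simp
  qed
  then show ?thesis by (simp add: v_def w_def)
qed

lemma s_act_braid4: "s_act 0 (s_act 1 (s_act 0 (s_act 1 f))) = s_act 1 (s_act 0 (s_act 1 (s_act 0 f)))"
  by (rule gxy_hom_eqI[of "\<lambda>f. s_act 0 (s_act 1 (s_act 0 (s_act 1 f)))" "\<lambda>f. s_act 1 (s_act 0 (s_act 1 (s_act 0 f)))"])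
     (use s_act_braid4_cc in \<open>auto simp: is_ring_hom_def s_act_hom s_act_simps\<close>)

text \<open>Each denominator is invariant under the other reflection, so multiplication by both
  turns either side into the same alternating sum.\<close>

lemma ddx_comm:
  assumes "Suc i < j"
  shows "ddx i (ddx j f) = ddx j (ddx i f)"
proof (rule nzd_cancel[OF nzd_mult[OF nzd_ddenom nzd_ddenom]])
  have s: "s_act i (ddenom j) = ddenom j" "s_act j (ddenom i) = ddenom i"
    using assms by (auto simp: ddenom_def s_act_hom s_act_simps)
  have "ddenom i * ddenom j * ddx i (ddx j f) = ddenom i * ddx i (ddenom j * ddx j f)"
    by (simp add: ddx_scale s mult.assoc)
  also have "\<dots> = f - s_act j f - s_act i f + s_act i (s_act j f)"
    by (simp add: ddx_eq s_act_hom algebra_simps)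
  also have "\<dots> = f - s_act i f - s_act j f + s_act j (s_act i f)"
    by (simp add: s_act_comm[OF assms])
  also have "\<dots> = ddenom j * ddx j (ddenom i * ddx i f)"
    by (simp add: ddx_eq s_act_hom algebra_simps)
  also have "\<dots> = ddenom i * ddenom j * ddx j (ddx i f)"
    by (simp add: ddx_scale s mult_ac)
  finally show "ddenom i * ddenom j * ddx i (ddx j f) = ddenom i * ddenom j * ddx j (ddx i f)" .
qed

text \<open>After multiplication with the product of the positive roots, both sides of a braid
  relation become the antisymmetrization over the dihedral group.\<close>

lemma braid3_antisym:
  fixes s t :: "'a::comm_ring_1 \<Rightarrow> 'a" and p q :: 'a
  assumes s: "is_ring_hom s" and t: "is_ring_hom t"
    and "s p = - p" "t q = - q" "s q = p + q" "t p = p + q"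
    and a: "p * a = f - s f" "s a = a"
    and b: "q * b = a - t a" and c: "p * c = b - s b"
  shows "p * q * (p + q) * c = f - s f - t f + t (s f) + s (t f) - s (t (s f))"
proof -
  note h = hom_simps[OF s] hom_simps[OF t] assms(3-6)
  have ta: "(p + q) * t a = t f - t (s f)" using arg_cong[OF a(1), of t] by (simp add: h)
  have sta: "q * s (t a) = s (t f) - s (t (s f))" using arg_cong[OF ta, of s] by (simp add: h)
  have sb: "(p + q) * s b = a - s (t a)" using arg_cong[OF b, of s] by (simp add: h a)
  have "p * q * (p + q) * c = q * (p + q) * (p * c)" by (simp only: mult_ac)
  also have "\<dots> = (p + q) * (q * b) - q * ((p + q) * s b)" unfolding c by (simp add: algebra_simps)
  also have "\<dots> = p * a - (p + q) * t a + q * s (t a)" unfolding b sb by (simp add: algebra_simps)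
  also have "\<dots> = f - s f - t f + t (s f) + s (t f) - s (t (s f))"
    unfolding a ta sta by (simp add: algebra_simps)
  finally show ?thesis .
qed

lemma ddx_braid3:
  assumes "i \<ge> 1"
  shows "ddx i (ddx (Suc i) (ddx i f)) = ddx (Suc i) (ddx i (ddx (Suc i) f))"
proof -
  let ?s = "s_act i" and ?t = "s_act (Suc i)" and ?p = "ddenom i" and ?q = "ddenom (Suc i)"
  have st: "?s ?q = ?p + ?q" "?t ?p = ?p + ?q"
    using assms by (auto simp: ddenom_def s_act_hom s_act_simps)
  have "?p + ?q = xv i - xv (Suc (Suc i))" using assms by (simp add: ddenom_def)
  then have nz: "nzd (?p * ?q * (?p + ?q))"
    using assms by (auto intro!: nzd_mult nzd_ddenom nzd_xv_diff)
  have "?p * ?q * (?p + ?q) * ddx i (ddx (Suc i) (ddx i f)) = f - ?s f - ?t f + ?t (?s f) + ?s (?t f) - ?s (?t (?s f))"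
    by (rule braid3_antisym[OF is_ring_hom_s_act is_ring_hom_s_act s_act_ddenom s_act_ddenom st
          ddx_eq s_act_ddx ddx_eq ddx_eq])
  moreover have "?q * ?p * (?q + ?p) * ddx (Suc i) (ddx i (ddx (Suc i) f)) = f - ?t f - ?s f + ?s (?t f) + ?t (?s f) - ?t (?s (?t f))"
    by (rule braid3_antisym[OF is_ring_hom_s_act is_ring_hom_s_act s_act_ddenom s_act_ddenom _ _
          ddx_eq s_act_ddx ddx_eq ddx_eq]) (simp_all add: st add.commute)
  ultimately have "?p * ?q * (?p + ?q) * ddx i (ddx (Suc i) (ddx i f)) = ?p * ?q * (?p + ?q) * ddx (Suc i) (ddx i (ddx (Suc i) f))"
    by (simp add: s_act_braid3[OF assms] mult.commute[of ?q] add.commute[of ?q])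
  then show ?thesis by (rule nzd_cancel[OF nz])
qed

lemma ddx_braid4: "ddx 0 (ddx 1 (ddx 0 (ddx 1 f))) = ddx 1 (ddx 0 (ddx 1 (ddx 0 f)))"
proof -
  let ?s = "s_act 0" and ?t = "s_act 1" and ?x = "xv 1" and ?y = "xv 2"
  note hs = s_act_hom
  have act: "?t ?x = ?y" "?t ?y = ?x" "?s ?y = ?y" "?s ?x = - ?x"
    by (auto simp: s_act_simps numeral_2_eq_2)
  have d: "ddenom 0 = - 2 * ?x" "ddenom 1 = ?x - ?y" by (auto simp: ddenom_def numeral_2_eq_2)
  have D0: "- 2 * ?x * ddx 0 g = g - ?s g" and D1: "(?x - ?y) * ddx 1 g = g - ?t g" for g
    using ddx_eq[of 0 g] ddx_eq[of 1 g] by (simp_all only: d)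
  note inv = s_act_ddx
  \<comment> \<open>The positive roots of type C_2 up to sign: the two denominators and their images
    under s_1 and s_0.\<close>
  let ?D = "(- 2 * ?x) * (?x - ?y) * (- ?x - ?y) * (- 2 * ?y)"
  have one: "?D * ddx 0 (ddx 1 (ddx 0 (ddx 1 f))) =
     f - ?t f - ?s f + ?s (?t f) + ?t (?s f) - ?t (?s (?t f)) - ?s (?t (?s f)) + ?s (?t (?s (?t f)))"
  proof -
    define f1 g h k where "f1 = ddx 1 f" and "g = ddx 0 f1" and "h = ddx 1 g" and "k = ddx 0 h"
    have i: "?t f1 = f1" "?s g = g" "?t h = h" by (simp_all only: f1_def g_def h_def inv)
    \<comment> \<open>Each of the following equations is the defining equation of one quotient, or
      its image under a group element.\<close>
    have e1: "(?x - ?y) * f1 = f - ?t f" and e2: "- 2 * ?x * g = f1 - ?s f1"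
      and e3: "(?x - ?y) * h = g - ?t g" and e4: "- 2 * ?x * k = h - ?s h"
      by (simp_all only: f1_def g_def h_def k_def D0 D1)
    have e5: "(- ?x - ?y) * ?s h = g - ?s (?t g)" using arg_cong[OF e3, of ?s] by (simp del: One_nat_def add: hs act i)
    have e6: "- 2 * ?y * ?t g = f1 - ?t (?s f1)" using arg_cong[OF e2, of ?t] by (simp del: One_nat_def add: hs act i)
    have e7: "- 2 * ?y * ?s (?t g) = ?s f1 - ?s (?t (?s f1))" using arg_cong[OF e6, of ?s] by (simp del: One_nat_def add: hs act i)
    have e8: "(- ?x - ?y) * ?s f1 = ?s f - ?s (?t f)" using arg_cong[OF e1, of ?s] by (simp del: One_nat_def add: hs act i)
    have e9: "(- ?x - ?y) * ?t (?s f1) = ?t (?s f) - ?t (?s (?t f))"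
      using arg_cong[OF e8, of ?t] by (simp del: One_nat_def add: hs act i algebra_simps)
    have e10: "(?x - ?y) * ?s (?t (?s f1)) = ?s (?t (?s f)) - ?s (?t (?s (?t f)))"
      using arg_cong[OF e9, of ?s] by (simp del: One_nat_def add: hs act i algebra_simps)
    have "?D * k = (- 2 * ?y) * ((?x - ?y) * (- ?x - ?y) * (- 2 * ?x * k))" by (simp only: mult_ac)
    also have "(?x - ?y) * (- ?x - ?y) * (- 2 * ?x * k) = (- ?x - ?y) * ((?x - ?y) * h) - (?x - ?y) * ((- ?x - ?y) * ?s h)"
      unfolding e4 by (simp add: algebra_simps)
    also have "\<dots> = - 2 * ?x * g - (- ?x - ?y) * ?t g + (?x - ?y) * ?s (?t g)"
      unfolding e3 e5 by (simp add: algebra_simps)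
    also have "- 2 * ?y * \<dots> = - 2 * ?y * (- 2 * ?x * g) - (- ?x - ?y) * (- 2 * ?y * ?t g) + (?x - ?y) * (- 2 * ?y * ?s (?t g))"
      by (simp add: algebra_simps)
    also have "\<dots> = (?x - ?y) * f1 - (- ?x - ?y) * ?s f1 + (- ?x - ?y) * ?t (?s f1) - (?x - ?y) * ?s (?t (?s f1))"
      unfolding e2 e6 e7 by (simp add: algebra_simps)
    finally show ?thesis unfolding e1 e8 e9 e10 by (simp add: k_def h_def g_def f1_def algebra_simps)
  qed
  have two: "?D * ddx 1 (ddx 0 (ddx 1 (ddx 0 f))) =
     f - ?s f - ?t f + ?t (?s f) + ?s (?t f) - ?s (?t (?s f)) - ?t (?s (?t f)) + ?t (?s (?t (?s f)))"
  proof -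
    define f1 g h k where "f1 = ddx 0 f" and "g = ddx 1 f1" and "h = ddx 0 g" and "k = ddx 1 h"
    have i: "?s f1 = f1" "?t g = g" "?s h = h" by (simp_all only: f1_def g_def h_def inv)
    have e1: "- 2 * ?x * f1 = f - ?s f" and e2: "(?x - ?y) * g = f1 - ?t f1"
      and e3: "- 2 * ?x * h = g - ?s g" and e4: "(?x - ?y) * k = h - ?t h"
      by (simp_all only: f1_def g_def h_def k_def D0 D1)
    have e5: "- 2 * ?y * ?t h = g - ?t (?s g)" using arg_cong[OF e3, of ?t] by (simp del: One_nat_def add: hs act i)
    have e6: "(- ?x - ?y) * ?s g = f1 - ?s (?t f1)" using arg_cong[OF e2, of ?s] by (simp del: One_nat_def add: hs act i)
    have e7: "(- ?x - ?y) * ?t (?s g) = ?t f1 - ?t (?s (?t f1))"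
      using arg_cong[OF e6, of ?t] by (simp del: One_nat_def add: hs act i algebra_simps)
    have e8: "- 2 * ?y * ?t f1 = ?t f - ?t (?s f)" using arg_cong[OF e1, of ?t] by (simp del: One_nat_def add: hs act i)
    have e9: "- 2 * ?y * ?s (?t f1) = ?s (?t f) - ?s (?t (?s f))" using arg_cong[OF e8, of ?s] by (simp del: One_nat_def add: hs act i)
    have e10: "- 2 * ?x * ?t (?s (?t f1)) = ?t (?s (?t f)) - ?t (?s (?t (?s f)))"
      using arg_cong[OF e9, of ?t] by (simp del: One_nat_def add: hs act i)
    have "?D * k = (- ?x - ?y) * ((- 2 * ?x) * (- 2 * ?y) * ((?x - ?y) * k))" by (simp only: mult_ac)
    also have "(- 2 * ?x) * (- 2 * ?y) * ((?x - ?y) * k) = - 2 * ?y * (- 2 * ?x * h) - (- 2 * ?x) * (- 2 * ?y * ?t h)"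
      unfolding e4 by (simp add: algebra_simps)
    also have "\<dots> = 2 * ((?x - ?y) * g) - (- 2 * ?y) * ?s g + (- 2 * ?x) * ?t (?s g)"
      unfolding e3 e5 by (simp add: algebra_simps)
    also have "(- ?x - ?y) * \<dots> = 2 * (- ?x - ?y) * ((?x - ?y) * g) - (- 2 * ?y) * ((- ?x - ?y) * ?s g) + (- 2 * ?x) * ((- ?x - ?y) * ?t (?s g))"
      by (simp add: algebra_simps)
    also have "\<dots> = - 2 * ?x * f1 - (- 2 * ?y * ?t f1) + (- 2 * ?y * ?s (?t f1)) - (- 2 * ?x * ?t (?s (?t f1)))"
      unfolding e2 e6 e7 by (simp add: algebra_simps)
    finally show ?thesis unfolding e1 e8 e9 e10 by (simp add: k_def h_def g_def f1_def algebra_simps)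
  qed
  have "nzd (- (?x + ?y))" by (intro nzd_uminus nzd_xv_diff) auto
  then have "nzd (- ?x - ?y)" by simp
  moreover have "nzd (?x - ?y)" by (intro nzd_xv_diff) auto
  ultimately have nz: "nzd ?D"
    by (intro nzd_mult nzd_uminus[OF nzd_two] nzd_xv)
  show ?thesis
    by (rule nzd_cancel[OF nz]) (unfold one two, simp add: s_act_braid4[simplified] algebra_simps)
qed

section \<open>Spans and free modules over a subring\<close>

inductive_set rspan :: "'a::comm_ring_1 set \<Rightarrow> 'a set \<Rightarrow> 'a set" for R B where
  zero: "0 \<in> rspan R B"
| step: "x \<in> rspan R B \<Longrightarrow> r \<in> R \<Longrightarrow> b \<in> B \<Longrightarrow> x + r * b \<in> rspan R B"

lemma rspan_add:
  assumes "x \<in> rspan R B" "y \<in> rspan R B"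
  shows "x + y \<in> rspan R B"
  using assms(2)
proof induction
  case (step y r b)
  then show ?case using rspan.step[of "x + y" R B r b] by (simp add: add.assoc)
qed (use assms(1) in simp)

lemma rspan_sum: "(\<And>i. i \<in> A \<Longrightarrow> f i \<in> rspan R B) \<Longrightarrow> sum f A \<in> rspan R B"
  by (induction A rule: infinite_finite_induct) (auto simp: rspan.zero rspan_add)

lemma rspan_term: "r \<in> R \<Longrightarrow> b \<in> B \<Longrightarrow> r * b \<in> rspan R B"
  using rspan.step[OF rspan.zero] by simp

lemma rspan_base: "is_subring R \<Longrightarrow> b \<in> B \<Longrightarrow> b \<in> rspan R B"
  using rspan_term[OF subring_one, of R b B] by simp

lemma rspan_subset:
  assumes "\<And>r b. r \<in> R \<Longrightarrow> b \<in> B \<Longrightarrow> r * b \<in> rspan R' B'"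
  shows "rspan R B \<subseteq> rspan R' B'"
proof
  fix x assume "x \<in> rspan R B"
  then show "x \<in> rspan R' B'" by induction (auto intro: rspan.zero rspan_add assms)
qed

lemma rspan_mono: "R \<subseteq> R' \<Longrightarrow> B \<subseteq> B' \<Longrightarrow> rspan R B \<subseteq> rspan R' B'"
  by (rule rspan_subset) (auto intro: rspan_term)

lemma rspan_subset_ring:
  assumes "is_subring S" "R \<subseteq> S" "B \<subseteq> S"
  shows "rspan R B \<subseteq> S"
proof
  fix x assume "x \<in> rspan R B"
  then show "x \<in> S"
    by induction (use assms subring_zero subring_add subring_mult in \<open>blast+\<close>)
qed

text \<open>Multiplication by c may lead to a different spanning set \<open>B'\<close>; the tower of
  free modules needs this.\<close>

lemma rspan_mult_closed:
  assumes "x \<in> rspan R B" "\<And>b. b \<in> B \<Longrightarrow> c * b \<in> rspan R B'" "is_subring R"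
  shows "c * x \<in> rspan R B'"
proof -
  have sc: "r * y \<in> rspan R B'" if "r \<in> R" "y \<in> rspan R B'" for r y
    using that(2)
  proof induction
    case (step x r' b)
    then show ?case
      using rspan.step[of "r * x" R B' "r * r'" b] subring_mult[OF assms(3) that(1)]
      by (simp add: algebra_simps)
  qed (simp add: rspan.zero)
  show ?thesis
    using assms(1)
  proof induction
    case (step x r b)
    then show ?case
      using rspan_add[of "c * x" R B' "r * (c * b)"] sc[of r "c * b"] assms(2)[of b]
      by (simp add: algebra_simps)
  qed (simp add: rspan.zero)
qed

lemma rspan_scale: "is_subring R \<Longrightarrow> r \<in> R \<Longrightarrow> x \<in> rspan R B \<Longrightarrow> r * x \<in> rspan R B"
  by (rule rspan_mult_closed) (auto intro: rspan_term)

lemma rspan_diff: "is_subring R \<Longrightarrow> x \<in> rspan R B \<Longrightarrow> y \<in> rspan R B \<Longrightarrow> x - y \<in> rspan R B"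
  using rspan_scale[of R "-1" y B] rspan_add[of x R B "-1 * y"]
  by (simp add: subring_one subring_uminus)

lemma rspan_family:
  assumes "x \<in> rspan R (b ` I)" "is_subring R" "finite I"
  shows "\<exists>a\<in>I \<rightarrow> R. x = (\<Sum>i\<in>I. a i * b i)"
  using assms(1)
proof induction
  case zero
  then show ?case using subring_zero[OF assms(2)] by (intro bexI[of _ "\<lambda>_. 0"]) auto
next
  case (step x r c)
  then obtain a i where a: "a \<in> I \<rightarrow> R" "x = (\<Sum>i\<in>I. a i * b i)" "i \<in> I" "c = b i" by auto
  show ?case
  proof (intro bexI)
    show "(\<lambda>j. a j + (if j = i then r else 0)) \<in> I \<rightarrow> R"
      using a step subring_add[OF assms(2)] subring_zero[OF assms(2)] by (auto simp: Pi_iff)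
    have "(\<Sum>j\<in>I. (a j + (if j = i then r else 0)) * b j) = x + (\<Sum>j\<in>I. if j = i then r * b j else 0)"
      unfolding a(2) sum.distrib[symmetric] by (intro sum.cong) (auto simp: algebra_simps)
    then show "x + r * c = (\<Sum>j\<in>I. (a j + (if j = i then r else 0)) * b j)"
      using a assms(3) by simp
  qed
qed

text \<open>Formulated for an indexed family, so that a repeated member counts as a
  relation.\<close>

definition independent_over :: "'a::comm_ring_1 set \<Rightarrow> 'i set \<Rightarrow> ('i \<Rightarrow> 'a) \<Rightarrow> bool" where
  "independent_over R I b \<longleftrightarrow> (\<forall>a. (\<forall>i\<in>I. a i \<in> R) \<longrightarrow> (\<Sum>i\<in>I. a i * b i) = 0 \<longrightarrow> (\<forall>i\<in>I. a i = 0))"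

lemma independent_overD:
  "independent_over R I b \<Longrightarrow> (\<And>i. i \<in> I \<Longrightarrow> a i \<in> R) \<Longrightarrow> (\<Sum>i\<in>I. a i * b i) = 0 \<Longrightarrow> i \<in> I \<Longrightarrow> a i = 0"
  unfolding independent_over_def by blast

text \<open>Separating spanning from independence allows different scalars: spanning is proved over
  Gamma^(n), independence over the a priori larger ring of W_n-invariants.\<close>

lemma free_with_basis_iff:
  "free_with_basis R S I b \<longleftrightarrow> is_subring R \<and> is_subring S \<and> R \<subseteq> S \<and> finite I \<and> b ` I \<subseteq> S
     \<and> S \<subseteq> rspan R (b ` I) \<and> independent_over R I b"
proof
  assume *: "free_with_basis R S I b"
  then have R: "is_subring R" and S: "is_subring S" and fin: "finite I" and bS: "b ` I \<subseteq> S" "R \<subseteq> S"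
    and ex: "\<And>f. f \<in> S \<Longrightarrow> \<exists>!a. a \<in> I \<rightarrow>\<^sub>E R \<and> f = (\<Sum>i\<in>I. a i * b i)"
    by (auto simp: free_with_basis_def)
  have "S \<subseteq> rspan R (b ` I)"
  proof
    fix f assume "f \<in> S"
    then obtain a where a: "a \<in> I \<rightarrow>\<^sub>E R" "f = (\<Sum>i\<in>I. a i * b i)" using ex by blast
    show "f \<in> rspan R (b ` I)" unfolding a(2)
      by (intro rspan_sum rspan_term) (use a in auto)
  qed
  moreover have "independent_over R I b"
    unfolding independent_over_def
  proof (intro allI impI ballI)
    fix a i assume a: "\<forall>i\<in>I. a i \<in> R" "(\<Sum>i\<in>I. a i * b i) = 0" and i: "i \<in> I"
    have "restrict a I \<in> I \<rightarrow>\<^sub>E R \<and> 0 = (\<Sum>i\<in>I. restrict a I i * b i)" using a by auto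
    moreover have "(\<lambda>i\<in>I. 0) \<in> I \<rightarrow>\<^sub>E R \<and> 0 = (\<Sum>i\<in>I. (\<lambda>i\<in>I. 0) i * b i)"
      using subring_zero[OF R] by auto
    ultimately have "restrict a I = (\<lambda>i\<in>I. 0)" using ex[OF subring_zero[OF S]] by blast
    then have "restrict a I i = (\<lambda>i\<in>I. 0) i" by simp
    then show "a i = 0" using i by simp
  qed
  ultimately show "is_subring R \<and> is_subring S \<and> R \<subseteq> S \<and> finite I \<and> b ` I \<subseteq> S
     \<and> S \<subseteq> rspan R (b ` I) \<and> independent_over R I b" using R S fin bS by blast
next
  assume *: "is_subring R \<and> is_subring S \<and> R \<subseteq> S \<and> finite I \<and> b ` I \<subseteq> S
     \<and> S \<subseteq> rspan R (b ` I) \<and> independent_over R I b"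
  then have R: "is_subring R" and fin: "finite I" and ind: "independent_over R I b" by auto
  have "\<exists>!a. a \<in> I \<rightarrow>\<^sub>E R \<and> f = (\<Sum>i\<in>I. a i * b i)" if "f \<in> S" for f
  proof -
    obtain a where a: "a \<in> I \<rightarrow> R" "f = (\<Sum>i\<in>I. a i * b i)"
      using rspan_family[OF _ R fin, of f b] * \<open>f \<in> S\<close> by blast
    show ?thesis
    proof (rule ex1I[of _ "restrict a I"])
      show "restrict a I \<in> I \<rightarrow>\<^sub>E R \<and> f = (\<Sum>i\<in>I. restrict a I i * b i)" using a by auto
      fix a' assume a': "a' \<in> I \<rightarrow>\<^sub>E R \<and> f = (\<Sum>i\<in>I. a' i * b i)"
      have "(\<Sum>i\<in>I. (a' i - a i) * b i) = 0"
        using a' a(2) by (simp add: left_diff_distrib sum_subtractf)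
      then have "\<forall>i\<in>I. a' i - a i = 0"
        by (intro ballI independent_overD[OF ind, of "\<lambda>i. a' i - a i"] subring_diff[OF R])
           (use a a' in auto)
      then show "a' = restrict a I"
        using a' by (auto simp: fun_eq_iff PiE_iff extensional_def)
    qed
  qed
  then show "free_with_basis R S I b" using * by (auto simp: free_with_basis_def)
qed

text \<open>Elements expand first in the \<open>c j\<close>, then each coefficient expands in the
  \<open>b i\<close>; independence unwinds in the same order.\<close>

lemma free_with_basis_tower:
  assumes 1: "free_with_basis R S I b" and 2: "free_with_basis S T J c"
  shows "free_with_basis R T (I \<times> J) (\<lambda>(i, j). b i * c j)"
proof -
  let ?p = "\<lambda>(i, j). b i * c j"
  have R: "is_subring R" and S: "is_subring S" and T: "is_subring T" and sub: "R \<subseteq> S" "S \<subseteq> T" "b ` I \<subseteq> S" "c ` J \<subseteq> T"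
    and fin: "finite I" "finite J" and sp: "S \<subseteq> rspan R (b ` I)" "T \<subseteq> rspan S (c ` J)"
    and ind: "independent_over R I b" "independent_over S J c"
    using 1 2 by (auto simp: free_with_basis_iff)
  have "rspan S (c ` J) \<subseteq> rspan R (?p ` (I \<times> J))"
  proof (rule rspan_subset)
    fix s d assume s: "s \<in> S" and "d \<in> c ` J"
    then obtain j where j: "j \<in> J" "d = c j" by auto
    have "d * s \<in> rspan R (?p ` (I \<times> J))"
    proof (rule rspan_mult_closed[OF _ _ R])
      show "s \<in> rspan R (b ` I)" using s sp by blast
      fix e assume "e \<in> b ` I"
      then obtain i where "i \<in> I" "e = b i" by auto
      then have "d * e = ?p (i, j)" "(i, j) \<in> I \<times> J" using j by (auto simp: mult.commute)
      then show "d * e \<in> rspan R (?p ` (I \<times> J))"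
        using rspan_term[OF subring_one[OF R] imageI, of "(i, j)" "I \<times> J" ?p] by simp
    qed
    then show "s * d \<in> rspan R (?p ` (I \<times> J))" by (simp add: mult.commute)
  qed
  moreover have "independent_over R (I \<times> J) ?p"
    unfolding independent_over_def
  proof (intro allI impI ballI)
    fix a x assume a: "\<forall>i\<in>I \<times> J. a i \<in> R" "(\<Sum>i\<in>I \<times> J. a i * ?p i) = 0" and x: "x \<in> I \<times> J"
    have "(\<Sum>i\<in>I \<times> J. a i * ?p i) = (\<Sum>i\<in>I. \<Sum>j\<in>J. a (i, j) * (b i * c j))"
      unfolding sum.cartesian_product by (intro sum.cong) auto
    also have "\<dots> = (\<Sum>j\<in>J. (\<Sum>i\<in>I. a (i, j) * b i) * c j)"
      unfolding sum_distrib_right by (subst sum.swap) (simp add: mult.assoc)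
    finally have e: "(\<Sum>j\<in>J. (\<Sum>i\<in>I. a (i, j) * b i) * c j) = 0" using a by simp
    obtain i j where ij: "x = (i, j)" "i \<in> I" "j \<in> J" using x by auto
    have aS: "a (i, j) * b i \<in> S" if "i \<in> I" "j \<in> J" for i j
      using a(1) that sub by (intro subring_mult[OF S]) auto
    have "(\<Sum>i\<in>I. a (i, j) * b i) = 0"
      by (rule independent_overD[OF ind(2) _ e ij(3), of ]) (auto intro!: subring_sum[OF S] aS)
    then show "a x = 0" unfolding ij(1)
      by (intro independent_overD[OF ind(1), of "\<lambda>i. a (i, j)"]) (use a ij in auto)
  qed
  moreover have "?p ` (I \<times> J) \<subseteq> T"
    using sub by (auto intro!: subring_mult[OF T])
  ultimately show ?thesis unfolding free_with_basis_iff using R T sub fin sp by auto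
qed

lemma finite_max_element:
  fixes f :: "'c \<Rightarrow> nat"
  assumes "finite K" "K \<noteq> {}"
  shows "\<exists>x\<in>K. \<forall>y\<in>K. f y \<le> f x"
proof -
  have "Max (f ` K) \<in> f ` K" using assms by (intro Max_in) auto
  then obtain x where "x \<in> K" "f x = Max (f ` K)" by auto
  then show ?thesis using assms(1) by (intro bexI[of _ x]) auto
qed

text \<open>Only strict comparisons of \<open>\<mu>\<close> enter, so it may repeat values: a
  nonzero coefficient with largest \<open>\<mu>\<close> cannot be cancelled, since all corrections
  live strictly below.\<close>

lemma free_with_basis_unitriangular:
  fixes \<mu> :: "'i \<Rightarrow> nat"
  assumes F: "free_with_basis R S I b" and \<phi>: "bij_betw \<phi> J I"
    and tri: "\<And>j. j \<in> J \<Longrightarrow> b' j - b (\<phi> j) \<in> rspan R (b ` {i \<in> I. \<mu> i < \<mu> (\<phi> j)})"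
  shows "free_with_basis R S J b'"
proof -
  have R: "is_subring R" and S: "is_subring S" and sub: "R \<subseteq> S" "b ` I \<subseteq> S" and fin: "finite I"
    and sp: "S \<subseteq> rspan R (b ` I)" and ind: "independent_over R I b"
    using F by (auto simp: free_with_basis_iff)
  have finJ: "finite J" using \<phi> fin bij_betw_finite by blast
  have b'S: "b' j \<in> S" if "j \<in> J" for j
  proof -
    have "b' j - b (\<phi> j) \<in> S"
      using tri[OF that] rspan_subset_ring[OF S sub(1), of "b ` {i \<in> I. \<mu> i < \<mu> (\<phi> j)}"] sub(2) by blast
    moreover have "b (\<phi> j) \<in> S" using that \<phi> sub(2) by (auto simp: bij_betw_def)
    ultimately show ?thesis using subring_add[OF S, of "b' j - b (\<phi> j)" "b (\<phi> j)"] by simp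
  qed
  have "b i \<in> rspan R (b' ` J)" if "i \<in> I" for i
    using that
  proof (induction "\<mu> i" arbitrary: i rule: less_induct)
    case less
    obtain j where j: "j \<in> J" "\<phi> j = i" using \<phi> less.prems by (auto simp: bij_betw_def)
    have "rspan R (b ` {i \<in> I. \<mu> i < \<mu> (\<phi> j)}) \<subseteq> rspan R (b' ` J)"
      by (rule rspan_subset) (use less.hyps j in \<open>auto intro!: rspan_scale[OF R]\<close>)
    then have "b' j - b i \<in> rspan R (b' ` J)" using tri[OF j(1)] j by auto
    moreover have "b' j \<in> rspan R (b' ` J)"
      using rspan_term[OF subring_one[OF R], of "b' j" "b' ` J"] j by simp
    ultimately have "b' j - (b' j - b i) \<in> rspan R (b' ` J)" by (rule rspan_diff[OF R, rotated])
    then show ?case by simp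
  qed
  then have "rspan R (b ` I) \<subseteq> rspan R (b' ` J)"
    by (intro rspan_subset) (auto intro: rspan_scale[OF R])
  moreover have "independent_over R J b'"
    unfolding independent_over_def
  proof (intro allI impI, rule ccontr)
    fix a assume a: "\<forall>j\<in>J. a j \<in> R" and z: "(\<Sum>j\<in>J. a j * b' j) = 0" and ne: "\<not> (\<forall>j\<in>J. a j = 0)"
    define K where "K = {j \<in> J. a j \<noteq> 0}"
    have K: "finite K" "K \<noteq> {}" using finJ ne by (auto simp: K_def)
    obtain j0 where j0: "j0 \<in> K" "\<And>j. j \<in> K \<Longrightarrow> \<mu> (\<phi> j) \<le> \<mu> (\<phi> j0)"
      using finite_max_element[OF K, of "\<lambda>j. \<mu> (\<phi> j)"] by blast
    \<comment> \<open>The corrections are extended by zero, so that all sums run over the same index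
      set.\<close>
    have "\<exists>c. (\<forall>i\<in>I. c i \<in> R) \<and> (\<forall>i. \<not> \<mu> i < \<mu> (\<phi> j) \<longrightarrow> c i = 0) \<and> b' j - b (\<phi> j) = (\<Sum>i\<in>I. c i * b i)"
      if j: "j \<in> J" for j
    proof -
      obtain c where c: "c \<in> {i \<in> I. \<mu> i < \<mu> (\<phi> j)} \<rightarrow> R" "b' j - b (\<phi> j) = (\<Sum>i\<in>{i \<in> I. \<mu> i < \<mu> (\<phi> j)}. c i * b i)"
        using rspan_family[OF tri[OF j] R] fin by auto
      let ?c = "\<lambda>i. if i \<in> I \<and> \<mu> i < \<mu> (\<phi> j) then c i else 0"
      have "(\<Sum>i\<in>{i \<in> I. \<mu> i < \<mu> (\<phi> j)}. c i * b i) = (\<Sum>i\<in>I. ?c i * b i)"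
        using fin by (intro sum.mono_neutral_cong_left) auto
      then show ?thesis using c subring_zero[OF R] by (intro exI[of _ ?c]) (auto simp: Pi_iff)
    qed
    then obtain c where c: "\<And>j i. j \<in> J \<Longrightarrow> i \<in> I \<Longrightarrow> c j i \<in> R" "\<And>j i. j \<in> J \<Longrightarrow> \<not> \<mu> i < \<mu> (\<phi> j) \<Longrightarrow> c j i = 0"
      "\<And>j. j \<in> J \<Longrightarrow> b' j - b (\<phi> j) = (\<Sum>i\<in>I. c j i * b i)" by metis
    define \<psi> where "\<psi> = inv_into J \<phi>"
    have \<psi>: "\<psi> i \<in> J" "\<phi> (\<psi> i) = i" if "i \<in> I" for i
      using that \<phi> by (auto simp: \<psi>_def bij_betw_def f_inv_into_f inv_into_into)
    have \<psi>\<phi>: "\<psi> (\<phi> j) = j" "\<phi> j \<in> I" if "j \<in> J" for j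
      using that \<phi> by (auto simp: \<psi>_def bij_betw_def)
    have "(\<Sum>j\<in>J. a j * b' j) = (\<Sum>j\<in>J. a j * b (\<phi> j)) + (\<Sum>j\<in>J. a j * (b' j - b (\<phi> j)))"
      unfolding sum.distrib[symmetric] by (simp add: algebra_simps)
    also have "(\<Sum>j\<in>J. a j * b (\<phi> j)) = (\<Sum>i\<in>I. a (\<psi> i) * b i)"
      by (rule sum.reindex_bij_witness[of _ \<psi> \<phi>]) (auto simp: \<psi> \<psi>\<phi>)
    also have "(\<Sum>j\<in>J. a j * (b' j - b (\<phi> j))) = (\<Sum>i\<in>I. (\<Sum>j\<in>J. a j * c j i) * b i)"
      unfolding sum_distrib_right by (subst sum.swap) (simp add: c(3) sum_distrib_left mult.assoc)
    finally have "(\<Sum>i\<in>I. (a (\<psi> i) + (\<Sum>j\<in>J. a j * c j i)) * b i) = 0"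
      using z by (simp add: sum.distrib distrib_right)
    moreover have "\<phi> j0 \<in> I" "j0 \<in> J" using j0 \<psi>\<phi> by (auto simp: K_def)
    ultimately have "a (\<psi> (\<phi> j0)) + (\<Sum>j\<in>J. a j * c j (\<phi> j0)) = 0"
      by (intro independent_overD[OF ind, of "\<lambda>i. a (\<psi> i) + (\<Sum>j\<in>J. a j * c j i)"])
         (auto intro!: subring_intros[OF R] simp: a \<psi> c)
    moreover have "a j * c j (\<phi> j0) = 0" if "j \<in> J" for j
    proof (cases "j \<in> K")
      case True then show ?thesis using j0(2)[OF True] c(2)[OF that, of "\<phi> j0"] by simp
    qed (use that in \<open>auto simp: K_def\<close>)
    ultimately show False using j0 \<psi>\<phi>[of j0] by (auto simp: K_def)
  qed
  ultimately show ?thesis unfolding free_with_basis_iff using R S sub finJ sp b'S by auto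
qed

section \<open>Words in Coxeter generators\<close>

lemma word_prod_simps: "word_prod g [] = id" "word_prod g (i # as) = g i \<circ> word_prod g as"
  by (simp_all add: word_prod_def)

lemma word_prod_append: "word_prod g (as @ bs) = word_prod g as \<circ> word_prod g bs"
  by (induction as) (auto simp: word_prod_simps comp_assoc)

text \<open>A statistic that each generator changes by exactly one, and that some generator lowers
  at every element but the identity, must be the word length. So lengths can be computed as
  inversion counts.\<close>

locale coxeter_length =
  fixes g :: "nat \<Rightarrow> 'a \<Rightarrow> 'a" and I :: "nat set" and G :: "('a \<Rightarrow> 'a) set" and L :: "('a \<Rightarrow> 'a) \<Rightarrow> nat"
  assumes id_in: "id \<in> G"
    and gen_in: "w \<in> G \<Longrightarrow> i \<in> I \<Longrightarrow> w \<circ> g i \<in> G"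
    and gen_gen: "i \<in> I \<Longrightarrow> g i \<circ> g i = id"
    and L_id: "L id = 0"
    and L_step: "w \<in> G \<Longrightarrow> i \<in> I \<Longrightarrow> L (w \<circ> g i) = Suc (L w) \<or> L w = Suc (L (w \<circ> g i))"
    and descent: "w \<in> G \<Longrightarrow> w \<noteq> id \<Longrightarrow> \<exists>i\<in>I. L (w \<circ> g i) < L w"
begin

lemma gen_gen_comp: "i \<in> I \<Longrightarrow> w \<circ> g i \<circ> g i = w"
  by (simp add: comp_assoc gen_gen)

lemma word_in: "set as \<subseteq> I \<Longrightarrow> word_prod g as \<in> G"
  by (induction as rule: rev_induct) (auto simp: word_prod_append word_prod_simps id_in intro: gen_in)

lemma word_snoc: "word_prod g (as @ [i]) = word_prod g as \<circ> g i"
  by (simp add: word_prod_append word_prod_simps)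

lemma L_word_le: "set as \<subseteq> I \<Longrightarrow> L (word_prod g as) \<le> length as"
proof (induction as rule: rev_induct)
  case (snoc i as)
  then have "L (word_prod g as) \<le> length as" "set as \<subseteq> I" "i \<in> I" by auto
  then show "L (word_prod g (as @ [i])) \<le> length (as @ [i])"
    using L_step[OF word_in, of as i] by (auto simp: word_snoc)
qed (simp add: word_prod_simps L_id)

lemma shortest_word: "w \<in> G \<Longrightarrow> \<exists>as. set as \<subseteq> I \<and> word_prod g as = w \<and> length as = L w"
proof (induction "L w" arbitrary: w rule: less_induct)
  case less
  show ?case
  proof (cases "w = id")
    case True then show ?thesis by (intro exI[of _ "[]"]) (auto simp: word_prod_simps L_id)
  next
    case False
    then obtain i where i: "i \<in> I" "L (w \<circ> g i) < L w" using descent less by blast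
    then obtain as where as: "set as \<subseteq> I" "word_prod g as = w \<circ> g i" "length as = L (w \<circ> g i)"
      using less.hyps[OF i(2) gen_in[OF less.prems i(1)]] by blast
    then show ?thesis
      using i L_step[OF less.prems i(1)] gen_gen_comp[OF i(1), of w]
      by (intro exI[of _ "as @ [i]"]) (auto simp: word_snoc)
  qed
qed

lemma cox_length_eq: "w \<in> G \<Longrightarrow> cox_length g I w = L w"
  unfolding cox_length_def
  by (rule Least_equality) (use shortest_word L_word_le in auto)

lemma reduced_word_iff:
  "w \<in> G \<Longrightarrow> reduced_word g I w as \<longleftrightarrow> set as \<subseteq> I \<and> word_prod g as = w \<and> length as = L w"
  by (simp add: reduced_word_def cox_length_eq)

end

text \<open>No group action on the ring is assumed: the kernel of \<open>D i\<close> plays the role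
  of the invariants of the i-th generator. \<open>dihedral\<close> is what exchanging last letters
  in a reduced word requires: two descents of w end reduced words with a common initial part, and
  the operators of the two final parts agree.\<close>

locale nil_coxeter = coxeter_length g I G L
  for g :: "nat \<Rightarrow> 'a \<Rightarrow> 'a" and I G L +
  fixes D :: "nat \<Rightarrow> 'b::comm_ring_1 \<Rightarrow> 'b"
  assumes D_D: "i \<in> I \<Longrightarrow> D i (D i f) = 0"
    and D_add: "i \<in> I \<Longrightarrow> D i (f + h) = D i f + D i h"
    and D_scale: "i \<in> I \<Longrightarrow> D i a = 0 \<Longrightarrow> D i (a * f) = a * D i f"
    and dihedral: "w \<in> G \<Longrightarrow> i \<in> I \<Longrightarrow> j \<in> I \<Longrightarrow> i < j \<Longrightarrow> L (w \<circ> g i) < L w \<Longrightarrow> L (w \<circ> g j) < L w \<Longrightarrow>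
      \<exists>u\<in>G. \<exists>as bs. set as \<subseteq> I \<and> set bs \<subseteq> I \<and> w = u \<circ> word_prod g (as @ [i]) \<and> w = u \<circ> word_prod g (bs @ [j])
        \<and> L w = L u + Suc (length as) \<and> L w = L u + Suc (length bs)
        \<and> (\<forall>f. foldr D (as @ [i]) f = foldr D (bs @ [j]) f)"
begin

lemma D_zero: "i \<in> I \<Longrightarrow> D i 0 = 0"
  using D_add[of i 0 0] by simp

lemma foldr_D_zero: "set as \<subseteq> I \<Longrightarrow> foldr D as 0 = 0"
  by (induction as) (auto simp: D_zero)

lemma foldr_D_add: "set as \<subseteq> I \<Longrightarrow> foldr D as (f + h) = foldr D as f + foldr D as h"
  by (induction as) (auto simp: D_add)

lemma foldr_D_scale: "set as \<subseteq> I \<Longrightarrow> (\<And>i. i \<in> I \<Longrightarrow> D i a = 0) \<Longrightarrow> foldr D as (a * f) = a * foldr D as f"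
  by (induction as) (auto simp: D_scale)

lemma foldr_D_sum: "set as \<subseteq> I \<Longrightarrow> foldr D as (sum f A) = (\<Sum>x\<in>A. foldr D as (f x))"
  by (induction A rule: infinite_finite_induct) (auto simp: foldr_D_zero foldr_D_add)

text \<open>Matsumoto's theorem, by induction on the length: two different last letters of reduced
  words are descents, which the dihedral axiom connects.\<close>

lemma foldr_D_reduced:
  assumes "set as \<subseteq> I" "set bs \<subseteq> I" "word_prod g as = word_prod g bs"
    "length as = L (word_prod g as)" "length bs = L (word_prod g bs)"
  shows "foldr D as f = foldr D bs f"
  using assms
proof (induction "length as" arbitrary: as bs f rule: less_induct)
  case less
  show ?case
  proof (cases as rule: rev_cases)
    case Nil then show ?thesis using less.prems by auto
  next
    case (snoc as' i)
    then obtain bs' j where bs: "bs = bs' @ [j]" using less.prems by (cases bs rule: rev_cases) auto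
    define w where "w = word_prod g as"
    have w: "w \<in> G" "w = word_prod g bs" "w = word_prod g as' \<circ> g i" "w = word_prod g bs' \<circ> g j"
      using less.prems word_in[of as] by (auto simp: w_def snoc bs word_snoc)
    have I: "i \<in> I" "j \<in> I" "set as' \<subseteq> I" "set bs' \<subseteq> I" using less.prems snoc bs by auto
    have as': "word_prod g as' = w \<circ> g i" and bs': "word_prod g bs' = w \<circ> g j"
      using w gen_gen_comp[OF I(1)] gen_gen_comp[OF I(2)] by metis+
    have len: "length as' = L (w \<circ> g i)" "L (w \<circ> g i) < L w" "length bs' = L (w \<circ> g j)" "L (w \<circ> g j) < L w"
      using less.prems L_word_le[OF I(3)] L_word_le[OF I(4)] L_step[OF w(1) I(1)] L_step[OF w(1) I(2)]
      unfolding as' bs' w(2)[symmetric] w_def[symmetric] by (auto simp: snoc bs)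
    show ?thesis
    proof (cases "i = j")
      case True
      then show ?thesis
        using less.hyps[of as' bs'] len I as' bs' by (auto simp: snoc bs)
    next
      case False
      obtain u cs ds where u: "u \<in> G" "set cs \<subseteq> I" "set ds \<subseteq> I"
        "w = u \<circ> word_prod g (cs @ [i])" "w = u \<circ> word_prod g (ds @ [j])"
        "L w = L u + Suc (length cs)" "L w = L u + Suc (length ds)"
        "\<And>f. foldr D (cs @ [i]) f = foldr D (ds @ [j]) f"
        using dihedral[OF w(1) I(1,2)] dihedral[OF w(1) I(2,1)] len False by (metis linorder_neqE_nat)
      \<comment> \<open>The words \<open>us @ cs @ [i]\<close> and \<open>us @ ds @ [j]\<close> link
        \<open>as\<close> to \<open>bs\<close>; the induction hypothesis is used after removing an
        equal last letter.\<close>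
      obtain us where us: "set us \<subseteq> I" "word_prod g us = u" "length us = L u" using shortest_word[OF u(1)] by blast
      have "w = u \<circ> word_prod g cs \<circ> g i" "w = u \<circ> word_prod g ds \<circ> g j"
        using u(4,5) by (simp_all add: word_snoc comp_assoc)
      then have e: "word_prod g (us @ cs) = w \<circ> g i" "word_prod g (us @ ds) = w \<circ> g j"
        using gen_gen_comp[OF I(1)] gen_gen_comp[OF I(2)] us by (metis word_prod_append)+
      have l: "length (us @ cs) = L (w \<circ> g i)" "length (us @ ds) = L (w \<circ> g j)"
        using u us L_step[OF w(1) I(1)] L_step[OF w(1) I(2)] len by auto
      have "foldr D as f = foldr D as' (D i f)" by (simp add: snoc)
      also have "\<dots> = foldr D (us @ cs) (D i f)"
        by (rule less.hyps) (use snoc I u us e l as' len in auto)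
      also have "\<dots> = foldr D us (foldr D (cs @ [i]) f)" by simp
      also have "\<dots> = foldr D (us @ ds) (D j f)" unfolding u(8) by simp
      also have "\<dots> = foldr D bs' (D j f)"
        by (rule less.hyps) (use snoc bs less.prems I u us e l bs' len in auto)
      finally show ?thesis by (simp add: bs)
    qed
  qed
qed

text \<open>The first letter, from the left, that fails to lengthen the word is a descent of a
  reduced initial part. By Matsumoto's theorem that part may be rewritten to end in the same letter,
  and \<open>D i\<close> squares to 0.\<close>

lemma foldr_D_nonreduced:
  assumes "set as \<subseteq> I" "L (word_prod g as) < length as"
  shows "foldr D as f = 0"
  using assms
proof (induction as arbitrary: f rule: rev_induct)
  case (snoc i as)
  have I: "set as \<subseteq> I" "i \<in> I" using snoc by auto
  let ?w = "word_prod g as"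
  show ?case
  proof (cases "L ?w < length as")
    case True then show ?thesis using snoc.IH[OF I(1)] by simp
  next
    case False
    then have L: "L ?w = length as" using L_word_le[OF I(1)] by simp
    have "L (word_prod g (as @ [i])) < length (as @ [i])" by (rule snoc.prems)
    then have "L (?w \<circ> g i) < Suc (length as)" by (simp add: word_snoc)
    then have d: "L ?w = Suc (L (?w \<circ> g i))"
      using L L_step[OF word_in[OF I(1)] I(2)] by linarith
    obtain ys where ys: "set ys \<subseteq> I" "word_prod g ys = ?w \<circ> g i" "length ys = L (?w \<circ> g i)"
      using shortest_word gen_in word_in I by blast
    have "foldr D as (D i f) = foldr D (ys @ [i]) (D i f)"
      by (rule foldr_D_reduced) (use ys I L d in \<open>auto simp: word_snoc gen_gen_comp\<close>)
    then show ?thesis using ys I by (simp add: D_D foldr_D_zero)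
  qed
qed simp

definition Inv :: "'b set \<Rightarrow> 'b set" where
  "Inv S = {f \<in> S. \<forall>i\<in>I. D i f = 0}"

theorem free_over_Inv:
  assumes S: "is_subring S" and fin: "finite G" and DS: "\<And>i f. i \<in> I \<Longrightarrow> f \<in> S \<Longrightarrow> D i f \<in> S"
    and bS: "\<And>w. w \<in> G \<Longrightarrow> b w \<in> S" and b_id: "b id = 1"
    and Db: "\<And>w i. w \<in> G \<Longrightarrow> i \<in> I \<Longrightarrow> D i (b w) = (if L (w \<circ> g i) < L w then b (w \<circ> g i) else 0)"
  shows "free_with_basis (Inv S) S G b"
proof -
  have D1: "D i 1 = 0" if "i \<in> I" for i
    using Db[OF id_in that] by (simp add: L_id b_id)
  have Ddiff: "D i (f - h) = D i f - D i h" if "i \<in> I" for i f h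
    using D_add[OF that, of "f - h" h] by simp
  have R: "is_subring (Inv S)"
    unfolding is_subring_def Inv_def
    using D1 Ddiff D_scale subring_intros(1,3,4)[OF S] by (auto simp: D_zero)
  have DI: "D i a = 0" if "a \<in> Inv S" "i \<in> I" for i a using that by (auto simp: Inv_def)
  have foldr_S: "foldr D as f \<in> S" if "set as \<subseteq> I" "f \<in> S" for as f
    using that by (induction as) (auto intro: DS)
  \<comment> \<open>Each letter, read from the right, strips a descent off w or gives 0; as w is not
    longer than the word, only an exact match ends at \<open>b id\<close>.\<close>
  have fb: "foldr D as (b w) = (if word_prod g as = w then 1 else 0)"
    if "set as \<subseteq> I" "L (word_prod g as) = length as" "w \<in> G" "L w \<le> length as" for as w
    using that
  proof (induction as arbitrary: w rule: rev_induct)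
    case Nil
    then have "w = id" using descent[of w] by auto
    then show "foldr D [] (b w) = (if word_prod g [] = w then 1 else 0)"
      by (simp add: b_id word_prod_simps)
  next
    case (snoc i as)
    have I: "set as \<subseteq> I" "i \<in> I" using snoc.prems(1) by auto
    have len: "L (word_prod g (as @ [i])) = length (as @ [i])" by (rule snoc.prems)
    then have red: "L (word_prod g as) = length as"
      using L_word_le[OF I(1)] L_step[OF word_in[OF I(1)] I(2)] by (auto simp: word_snoc)
    have iff: "word_prod g as \<circ> g i = w \<longleftrightarrow> word_prod g as = w \<circ> g i"
      using gen_gen_comp[OF I(2)] by metis
    show "foldr D (as @ [i]) (b w) = (if word_prod g (as @ [i]) = w then 1 else 0)"
    proof (cases "L (w \<circ> g i) < L w")
      case True
      then have "L (w \<circ> g i) \<le> length as" using snoc.prems(4) L_step[OF snoc.prems(3) I(2)] by auto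
      then have "foldr D as (b (w \<circ> g i)) = (if word_prod g as = w \<circ> g i then 1 else 0)"
        by (rule snoc.IH[OF I(1) red gen_in[OF snoc.prems(3) I(2)]])
      then show ?thesis
        using True by (simp add: Db[OF snoc.prems(3) I(2)] word_snoc iff)
    next
      case False
      have "word_prod g as \<circ> g i \<noteq> w"
        using False red len by (auto simp: word_snoc gen_gen_comp I)
      then show ?thesis using False I by (simp add: Db[OF snoc.prems(3) I(2)] word_snoc foldr_D_zero)
    qed
  qed
  define rw where "rw w = (SOME as. set as \<subseteq> I \<and> word_prod g as = w \<and> length as = L w)" for w
  have rw: "set (rw w) \<subseteq> I" "word_prod g (rw w) = w" "length (rw w) = L w" if "w \<in> G" for w
    using someI_ex[OF shortest_word[OF that]] by (auto simp: rw_def)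
  have fsum: "foldr D (rw u) (\<Sum>v\<in>G. a v * b v) = (\<Sum>v\<in>G. (if u = v then a v else 0))"
    if u: "u \<in> G" and aI: "\<And>v. v \<in> G \<Longrightarrow> a v \<in> Inv S"
      and aL: "\<And>v. v \<in> G \<Longrightarrow> a v \<noteq> 0 \<Longrightarrow> L v \<le> L u" for u a
  proof -
    have "foldr D (rw u) (a v * b v) = (if u = v then a v else 0)" if v: "v \<in> G" for v
    proof (cases "a v = 0")
      case False
      then show ?thesis
        using foldr_D_scale[OF rw(1)[OF u] DI[OF aI[OF v]], of "b v"] fb[of "rw u" v] rw[OF u] aL[OF v] v
        by simp
    qed (simp add: foldr_D_zero rw u)
    then show ?thesis unfolding foldr_D_sum[OF rw(1)[OF u]] by (rule sum.cong[OF refl])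
  qed
  \<comment> \<open>Downward induction on length: if all operators of length above k kill f, those
    of length k give invariant coefficients, and subtracting the corresponding terms lowers the
    bound to k.\<close>
  have descend: "f \<in> rspan (Inv S) (b ` G)" if "f \<in> S" "\<And>v. v \<in> G \<Longrightarrow> L v \<ge> k \<Longrightarrow> foldr D (rw v) f = 0" for f k
    using that
  proof (induction k arbitrary: f)
    case 0
    then have "foldr D (rw id) f = 0" using id_in by blast
    moreover have "rw id = []" using rw[OF id_in] by (simp add: L_id)
    ultimately show ?case by (simp add: rspan.zero)
  next
    case (Suc k)
    define a where "a v = (if L v = k then foldr D (rw v) f else 0)" for v
    have aI: "a v \<in> Inv S" if v: "v \<in> G" for v
    proof (cases "L v = k")
      case True
      \<comment> \<open>A further letter gives either a nonreduced word or the operator of an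
        element of length k + 1; both vanish on f.\<close>
      have "D i (foldr D (rw v) f) = 0" if i: "i \<in> I" for i
      proof (cases "L (word_prod g (i # rw v)) < length (i # rw v)")
        case True
        then have "foldr D (i # rw v) f = 0" by (intro foldr_D_nonreduced) (use i rw v in auto)
        then show ?thesis by simp
      next
        case False
        let ?w = "word_prod g (i # rw v)"
        have set: "set (i # rw v) \<subseteq> I" using i rw v by auto
        have w: "?w \<in> G" by (rule word_in[OF set])
        have Lw: "L ?w = length (i # rw v)" using False L_word_le[OF set] by simp
        have "foldr D (i # rw v) f = foldr D (rw ?w) f"
          by (rule foldr_D_reduced) (use set rw[OF w] Lw in auto)
        also have "\<dots> = 0" using Suc.prems(2)[OF w] Lw rw[OF v] \<open>L v = k\<close> by simp
        finally show ?thesis by simp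
      qed
      then show ?thesis using True foldr_S rw v Suc.prems by (auto simp: a_def Inv_def)
    qed (simp add: a_def subring_zero[OF R])
    have "f - (\<Sum>v\<in>G. a v * b v) \<in> rspan (Inv S) (b ` G)"
    proof (rule Suc.IH)
      have aS: "a v \<in> S" if "v \<in> G" for v using aI[OF that] by (simp add: Inv_def)
      show "f - (\<Sum>v\<in>G. a v * b v) \<in> S"
        using Suc.prems aS bS by (intro subring_diff[OF S] subring_sum[OF S] subring_mult[OF S]) auto
      fix u assume u: "u \<in> G" "L u \<ge> k"
      have "foldr D (rw u) (\<Sum>v\<in>G. a v * b v) = (\<Sum>v\<in>G. (if u = v then a v else 0))"
        by (rule fsum[OF u(1) aI]) (use u in \<open>auto simp: a_def split: if_splits\<close>)
      also have "\<dots> = a u" using fin u by simp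
      finally have "foldr D (rw u) (f - (\<Sum>v\<in>G. a v * b v)) = foldr D (rw u) f - a u"
        using foldr_D_add[OF rw(1)[OF u(1)], of "f - (\<Sum>v\<in>G. a v * b v)" "\<Sum>v\<in>G. a v * b v"] by simp
      then show "foldr D (rw u) (f - (\<Sum>v\<in>G. a v * b v)) = 0"
        using Suc.prems(2)[OF u(1)] u by (auto simp: a_def)
    qed
    moreover have "(\<Sum>v\<in>G. a v * b v) \<in> rspan (Inv S) (b ` G)"
      by (intro rspan_sum rspan_term aI) auto
    ultimately show ?case using rspan_add by fastforce
  qed
  have span: "S \<subseteq> rspan (Inv S) (b ` G)"
  proof (intro subsetI)
    fix f assume f: "f \<in> S"
    \<comment> \<open>Above the maximal length the vanishing condition is vacuous, which starts the
      descent.\<close>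
    have "\<not> L v \<ge> Suc (Max (L ` G))" if "v \<in> G" for v using Max_ge[of "L ` G" "L v"] fin that by fastforce
    then show "f \<in> rspan (Inv S) (b ` G)"
      using descend[OF f, of "Suc (Max (L ` G))"] by blast
  qed
  have "independent_over (Inv S) G b"
    unfolding independent_over_def
  proof (intro allI impI, rule ccontr)
    fix a assume a: "\<forall>v\<in>G. a v \<in> Inv S" and z: "(\<Sum>v\<in>G. a v * b v) = 0" and ne: "\<not> (\<forall>v\<in>G. a v = 0)"
    define K where "K = {v \<in> G. a v \<noteq> 0}"
    have K: "finite K" "K \<noteq> {}" using fin ne by (auto simp: K_def)
    obtain u where u: "u \<in> K" "\<And>v. v \<in> K \<Longrightarrow> L v \<le> L u"
      using finite_max_element[OF K, of L] by blast
    have "foldr D (rw u) (\<Sum>v\<in>G. a v * b v) = (\<Sum>v\<in>G. (if u = v then a v else 0))"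
      by (rule fsum) (use u a in \<open>auto simp: K_def\<close>)
    also have "\<dots> = a u" using fin u by (simp add: K_def)
    finally show False using z u rw foldr_D_zero by (auto simp: K_def)
  qed
  then show ?thesis
    unfolding free_with_basis_iff using R S fin bS span by (auto simp: Inv_def)
qed

end

section \<open>The dihedral condition from commutation and braid relations\<close>

context coxeter_length
begin

lemma L_descend: "w \<in> G \<Longrightarrow> i \<in> I \<Longrightarrow> L (w \<circ> g i) < L w \<Longrightarrow> L w = Suc (L (w \<circ> g i))"
  using L_step by fastforce

text \<open>Here and in the next two lemmas u is w stripped of the longest element of the dihedral
  subgroup generated by i and j. Only the chain of descents beginning with i is followed; the other
  word has the same length.\<close>

lemma dihedral_comm:
  assumes "w \<in> G" "i \<in> I" "j \<in> I" "g i \<circ> g j = g j \<circ> g i" "\<And>f. D i (D j f) = D j (D i f)"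
    "L (w \<circ> g i) < L w" "L (w \<circ> g i \<circ> g j) < L (w \<circ> g i)"
  shows "\<exists>u\<in>G. \<exists>as bs. set as \<subseteq> I \<and> set bs \<subseteq> I \<and> w = u \<circ> word_prod g (as @ [i]) \<and> w = u \<circ> word_prod g (bs @ [j])
        \<and> L w = L u + Suc (length as) \<and> L w = L u + Suc (length bs)
        \<and> (\<forall>f. foldr D (as @ [i]) f = foldr D (bs @ [j]) f)"
proof (intro bexI exI conjI)
  let ?u = "w \<circ> g i \<circ> g j"
  show "?u \<in> G" using assms by (intro gen_in)
  have "w = ?u \<circ> g j \<circ> g i" by (simp only: gen_gen_comp assms)
  then have ji: "w = ?u \<circ> (g j \<circ> g i)" by (simp only: comp_assoc)
  have ij: "w = ?u \<circ> (g i \<circ> g j)" using ji unfolding assms(4)[symmetric] .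
  show "w = ?u \<circ> word_prod g ([j] @ [i])" "w = ?u \<circ> word_prod g ([i] @ [j])"
    using ji ij by (simp_all add: word_prod_simps comp_assoc)
  show "L w = L ?u + Suc (length [j])" "L w = L ?u + Suc (length [i])"
    using L_descend[OF assms(1,2,6)] L_descend[OF gen_in[OF assms(1,2)] assms(3,7)] by auto
qed (use assms in auto)

lemma dihedral_braid3:
  assumes "w \<in> G" "i \<in> I" "j \<in> I" "g i \<circ> g j \<circ> g i = g j \<circ> g i \<circ> g j"
    "\<And>f. D i (D j (D i f)) = D j (D i (D j f))"
    "L (w \<circ> g i) < L w" "L (w \<circ> g i \<circ> g j) < L (w \<circ> g i)" "L (w \<circ> g i \<circ> g j \<circ> g i) < L (w \<circ> g i \<circ> g j)"
  shows "\<exists>u\<in>G. \<exists>as bs. set as \<subseteq> I \<and> set bs \<subseteq> I \<and> w = u \<circ> word_prod g (as @ [i]) \<and> w = u \<circ> word_prod g (bs @ [j])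
        \<and> L w = L u + Suc (length as) \<and> L w = L u + Suc (length bs)
        \<and> (\<forall>f. foldr D (as @ [i]) f = foldr D (bs @ [j]) f)"
proof (intro bexI exI conjI)
  let ?u = "w \<circ> g i \<circ> g j \<circ> g i"
  show "?u \<in> G" using assms by (intro gen_in)
  have iji: "w = ?u \<circ> g i \<circ> g j \<circ> g i" by (simp only: gen_gen_comp assms)
  then have iji: "w = ?u \<circ> (g i \<circ> g j \<circ> g i)" by (simp only: comp_assoc)
  have jij: "w = ?u \<circ> (g j \<circ> g i \<circ> g j)" using iji unfolding assms(4) .
  show "w = ?u \<circ> word_prod g ([i, j] @ [i])" "w = ?u \<circ> word_prod g ([j, i] @ [j])"
    using iji jij by (simp_all add: word_prod_simps comp_assoc)
  show "L w = L ?u + Suc (length [i, j])" "L w = L ?u + Suc (length [j, i])"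
    using L_descend[OF assms(1,2,6)] L_descend[OF gen_in[OF assms(1,2)] assms(3,7)]
      L_descend[OF gen_in[OF gen_in[OF assms(1,2)] assms(3)] assms(2,8)] by auto
qed (use assms in auto)

lemma dihedral_braid4:
  assumes "w \<in> G" "i \<in> I" "j \<in> I" "g j \<circ> g i \<circ> g j \<circ> g i = g i \<circ> g j \<circ> g i \<circ> g j"
    "\<And>f. D j (D i (D j (D i f))) = D i (D j (D i (D j f)))"
    "L (w \<circ> g i) < L w" "L (w \<circ> g i \<circ> g j) < L (w \<circ> g i)" "L (w \<circ> g i \<circ> g j \<circ> g i) < L (w \<circ> g i \<circ> g j)"
    "L (w \<circ> g i \<circ> g j \<circ> g i \<circ> g j) < L (w \<circ> g i \<circ> g j \<circ> g i)"
  shows "\<exists>u\<in>G. \<exists>as bs. set as \<subseteq> I \<and> set bs \<subseteq> I \<and> w = u \<circ> word_prod g (as @ [i]) \<and> w = u \<circ> word_prod g (bs @ [j])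
        \<and> L w = L u + Suc (length as) \<and> L w = L u + Suc (length bs)
        \<and> (\<forall>f. foldr D (as @ [i]) f = foldr D (bs @ [j]) f)"
proof (intro bexI exI conjI)
  let ?u = "w \<circ> g i \<circ> g j \<circ> g i \<circ> g j"
  show "?u \<in> G" using assms by (intro gen_in)
  have "w = ?u \<circ> g j \<circ> g i \<circ> g j \<circ> g i" by (simp only: gen_gen_comp assms)
  then have 1: "w = ?u \<circ> (g j \<circ> g i \<circ> g j \<circ> g i)" by (simp only: comp_assoc)
  have 2: "w = ?u \<circ> (g i \<circ> g j \<circ> g i \<circ> g j)" using 1 unfolding assms(4) .
  show "w = ?u \<circ> word_prod g ([j, i, j] @ [i])" "w = ?u \<circ> word_prod g ([i, j, i] @ [j])"
    using 1 2 by (simp_all add: word_prod_simps comp_assoc)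
  show "L w = L ?u + Suc (length [j, i, j])" "L w = L ?u + Suc (length [i, j, i])"
    using L_descend[OF assms(1,2,6)] L_descend[OF gen_in[OF assms(1,2)] assms(3,7)]
      L_descend[OF gen_in[OF gen_in[OF assms(1,2)] assms(3)] assms(2,8)]
      L_descend[OF gen_in[OF gen_in[OF gen_in[OF assms(1,2)] assms(3)] assms(2)] assms(3,9)] by auto
qed (use assms in auto)

end

section \<open>Lengths in the symmetric and hyperoctahedral groups\<close>

text \<open>A simple reflection permutes the pairs outside A and reverses the property on A, so only
  A affects the count of inversions. Writing this without subtraction suits natural numbers, and F
  may be infinite as long as the counted set is finite.\<close>

lemma card_flip:
  assumes s: "\<And>r. r \<in> F - A \<Longrightarrow> s r \<in> F - A \<and> s (s r) = r" and A: "finite A" "A \<subseteq> F"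
    and P: "finite {r \<in> F. P r}" "\<And>r. r \<in> A \<Longrightarrow> P (s r) \<longleftrightarrow> \<not> P r"
  shows "card {r \<in> F. P (s r)} + card {r \<in> A. P r} = card {r \<in> F. P r} + card {r \<in> A. \<not> P r}"
proof -
  have eq: "{r \<in> F. P (s r)} = s ` {r \<in> F - A. P r} \<union> {r \<in> A. \<not> P r}"
  proof (intro equalityI subsetI)
    fix r assume r: "r \<in> {r \<in> F. P (s r)}"
    show "r \<in> s ` {r \<in> F - A. P r} \<union> {r \<in> A. \<not> P r}"
    proof (cases "r \<in> A")
      case False
      then have "r \<in> F - A" using r by auto
      then have "s (s r) = r" "s r \<in> {r \<in> F - A. P r}" using s[of r] r by auto
      then show ?thesis by (metis UnI1 imageI)
    qed (use r P in auto)
  next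
    fix r assume r: "r \<in> s ` {r \<in> F - A. P r} \<union> {r \<in> A. \<not> P r}"
    then show "r \<in> {r \<in> F. P (s r)}" using s P(2) A by auto
  qed
  have inj: "inj_on s {r \<in> F - A. P r}"
    by (rule inj_on_inverseI[of _ s]) (use s in auto)
  have fin: "finite {r \<in> F - A. P r}" by (rule finite_subset[OF _ P(1)]) auto
  have "card {r \<in> F. P (s r)} = card (s ` {r \<in> F - A. P r}) + card {r \<in> A. \<not> P r}"
    unfolding eq using fin A s by (intro card_Un_disjoint) auto
  also have "card (s ` {r \<in> F - A. P r}) = card {r \<in> F - A. P r}" by (rule card_image[OF inj])
  finally have 1: "card {r \<in> F. P (s r)} = card {r \<in> F - A. P r} + card {r \<in> A. \<not> P r}" .
  have "{r \<in> F. P r} = {r \<in> F - A. P r} \<union> {r \<in> A. P r}" using A by auto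
  moreover have "card ({r \<in> F - A. P r} \<union> {r \<in> A. P r}) = card {r \<in> F - A. P r} + card {r \<in> A. P r}"
    using fin A by (intro card_Un_disjoint) auto
  ultimately show ?thesis using 1 by simp
qed

section \<open>Signed permutations\<close>

lemma sgen_apply:
  "sgen i x = (if i = 0 then (if x = 1 then -1 else if x = -1 then 1 else x)
     else if x = int i then int i + 1 else if x = int i + 1 then int i
     else if x = - int i then - int i - 1 else if x = - int i - 1 then - int i else x)"
  by (auto simp: sgen_def Transposition.transpose_def)

lemma sgen_sgen: "sgen i \<circ> sgen i = id"
  by (auto simp: fun_eq_iff sgen_apply)

lemma sgen_sgen_apply: "sgen i (sgen i x) = x"
  using sgen_sgen[of i] by (simp add: fun_eq_iff)

lemma sgen_moved:
  "sgen i x \<noteq> x \<Longrightarrow> \<bar>x\<bar> \<le> int i + 1 \<and> \<bar>sgen i x\<bar> \<le> int i + 1"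
  "sgen i x \<noteq> x \<Longrightarrow> \<bar>x\<bar> \<ge> int i \<and> \<bar>sgen i x\<bar> \<ge> int i"
  by (auto simp: sgen_apply split: if_splits)

lemma sgen_comm:
  assumes "Suc i < j"
  shows "sgen i \<circ> sgen j = sgen j \<circ> sgen i"
proof
  fix x
  show "(sgen i \<circ> sgen j) x = (sgen j \<circ> sgen i) x"
  proof (cases "\<bar>x\<bar> < int j")
    case True
    then have "sgen j x = x" using sgen_moved(2)[of j x] by linarith
    moreover have "\<bar>sgen i x\<bar> < int j" using True sgen_moved(1)[of i x] assms by linarith
    then have "sgen j (sgen i x) = sgen i x" using sgen_moved(2)[of j "sgen i x"] by linarith
    ultimately show ?thesis by simp
  next
    case False
    then have "sgen i x = x" using sgen_moved(1)[of i x] assms by linarith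
    moreover have "\<bar>sgen j x\<bar> \<ge> int j" using False sgen_moved(2)[of j x] by linarith
    then have "sgen i (sgen j x) = sgen j x" using sgen_moved(1)[of i "sgen j x"] assms by linarith
    ultimately show ?thesis by simp
  qed
qed

lemma sgen_braid3:
  assumes "i \<ge> 1"
  shows "sgen i \<circ> sgen (Suc i) \<circ> sgen i = sgen (Suc i) \<circ> sgen i \<circ> sgen (Suc i)"
proof
  fix x :: int
  show "(sgen i \<circ> sgen (Suc i) \<circ> sgen i) x = (sgen (Suc i) \<circ> sgen i \<circ> sgen (Suc i)) x"
  proof (cases "x \<in> {int i, int i + 1, int i + 2, - int i, - int i - 1, - int i - 2}")
    case True then show ?thesis using assms by (elim insertE emptyE; simp add: sgen_apply)
  next
    case False
    then have "sgen i x = x" "sgen (Suc i) x = x" using assms by (auto simp: sgen_apply)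
    then show ?thesis by simp
  qed
qed

lemma sgen_braid4: "sgen 1 \<circ> sgen 0 \<circ> sgen 1 \<circ> sgen 0 = sgen 0 \<circ> sgen 1 \<circ> sgen 0 \<circ> sgen 1"
proof
  fix x :: int
  show "(sgen 1 \<circ> sgen 0 \<circ> sgen 1 \<circ> sgen 0) x = (sgen 0 \<circ> sgen 1 \<circ> sgen 0 \<circ> sgen 1) x"
  proof (cases "x \<in> {1, -1, 2, -2}")
    case True then show ?thesis by (elim insertE emptyE; simp add: sgen_apply)
  next
    case False
    then have "sgen 0 x = x" "sgen 1 x = x" by (auto simp: sgen_apply)
    then show ?thesis by simp
  qed
qed

lemma sgen_odd: "sgen i (- x) = - sgen i x"
  by (auto simp: sgen_apply)

lemma W_mono: "m \<le> n \<Longrightarrow> W m \<subseteq> W n"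
  unfolding W_def by (auto intro: permutes_subset)

lemma sgen_permutes: "i < n \<Longrightarrow> sgen i permutes {- int n..int n}"
proof (rule bij_imp_permutes)
  assume i: "i < n"
  show "bij_betw (sgen i) {- int n..int n} {- int n..int n}"
    by (rule bij_betw_byWitness[of _ "sgen i"]) (use i in \<open>auto simp: sgen_sgen_apply\<close>, auto simp: sgen_apply)
  show "x \<notin> {- int n..int n} \<Longrightarrow> sgen i x = x" for x using i by (auto simp: sgen_apply)
qed

lemma W_comp_sgen: "w \<in> W n \<Longrightarrow> i < n \<Longrightarrow> w \<circ> sgen i \<in> W n"
  unfolding W_def by (auto simp: sgen_odd intro: permutes_compose[OF sgen_permutes])

lemma Winf_comp_sgen: "w \<in> Winf \<Longrightarrow> w \<circ> sgen i \<in> Winf"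
proof -
  assume "w \<in> Winf"
  then obtain k where "w \<in> W k" by (auto simp: Winf_def)
  then have "w \<in> W (max k (Suc i))" using W_mono[of k "max k (Suc i)"] by auto
  then have "w \<circ> sgen i \<in> W (max k (Suc i))" by (rule W_comp_sgen) auto
  then show ?thesis by (auto simp: Winf_def)
qed

lemma finite_W: "finite (W n)"
  by (rule finite_subset[OF _ finite_permutations[of "{- int n..int n}"]]) (auto simp: W_def)

lemma id_W: "id \<in> W n"
  by (simp add: W_def permutes_id)

lemma Winf_props:
  assumes "w \<in> Winf"
  shows "inj w" "w (- x) = - w x" "w x = 0 \<longleftrightarrow> x = 0"
proof -
  obtain k where w: "w permutes {- int k..int k}" and o: "\<And>i. w (- i) = - w i"
    using assms by (auto simp: Winf_def W_def)
  show "inj w" "w (- x) = - w x" by (rule permutes_inj[OF w]) (rule o)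
  have "w 0 = 0" using o[of 0] by simp
  then show "w x = 0 \<longleftrightarrow> x = 0" using permutes_inj[OF w] by (metis injD)
qed

text \<open>Negative arguments are included, so for odd w the pairs (i, j) and (-j, -i) are
  inversions together; only the pairs (-j, j) are their own mirror images.\<close>

definition C_inversions :: "(int \<Rightarrow> int) \<Rightarrow> (int \<times> int) set" where
  "C_inversions w = {(i, j). i < j \<and> i \<noteq> 0 \<and> j \<noteq> 0 \<and> w i > w j}"

text \<open>A self-mirrored inversion (-j, j) occurs once and means a negative value at j; adding
  the number of these j makes every inverted reflection count twice, whence the halving.\<close>

definition C_length :: "(int \<Rightarrow> int) \<Rightarrow> nat" where
  "C_length w = (card (C_inversions w) + card {j. j > 0 \<and> w j < 0}) div 2"

definition C_descent :: "(int \<Rightarrow> int) \<Rightarrow> nat \<Rightarrow> bool" where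
  "C_descent w k = (if k = 0 then w 1 < 0 else w (int k) > w (int k + 1))"

lemma finite_C_inversions:
  assumes "w \<in> Winf"
  shows "finite (C_inversions w)" "finite {j. j > 0 \<and> w j < 0}"
proof -
  obtain k where w: "w permutes {- int k..int k}" using assms by (auto simp: Winf_def W_def)
  have out: "w x = x" if "x < - int k \<or> x > int k" for x
    using permutes_not_in[OF w, of x] that by auto
  have bd: "- int k \<le> w x \<and> w x \<le> int k" if "- int k \<le> x" "x \<le> int k" for x
    using permutes_in_image[OF w, of x] that by auto
  have "C_inversions w \<subseteq> {- int k..int k} \<times> {- int k..int k}"
  proof
    fix r assume r: "r \<in> C_inversions w"
    obtain i j where ij: "r = (i, j)" "i < j" "w j < w i" using r by (auto simp: C_inversions_def)
    have "- int k \<le> i \<and> i \<le> int k \<and> - int k \<le> j \<and> j \<le> int k"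
      using ij(2,3) out[of i] out[of j] bd[of i] bd[of j] by linarith
    then show "r \<in> {- int k..int k} \<times> {- int k..int k}" using ij(1) by auto
  qed
  then show "finite (C_inversions w)" by (rule finite_subset) auto
  have "{j. j > 0 \<and> w j < 0} \<subseteq> {- int k..int k}"
  proof
    fix j assume "j \<in> {j. j > 0 \<and> w j < 0}"
    then show "j \<in> {- int k..int k}" using out[of j] by (cases "j > int k") auto
  qed
  then show "finite {j. j > 0 \<and> w j < 0}" by (rule finite_subset) auto
qed

lemma C_length_sgen:
  assumes w: "w \<in> Winf"
  shows "if C_descent w k then C_length w = Suc (C_length (w \<circ> sgen k)) else C_length (w \<circ> sgen k) = Suc (C_length w)"
proof -
  note wp = Winf_props[OF w]
  let ?F = "{(i, j). i < j \<and> i \<noteq> 0 \<and> j \<noteq> (0::int)}"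
  let ?P = "\<lambda>(i, j). w i > w j"
  let ?s = "\<lambda>(i, j). (sgen k i, sgen k j)"
  \<comment> \<open>The pairs whose order s_k reverses: one for k = 0, otherwise one and its mirror
    image.\<close>
  let ?A = "if k = 0 then {(-1, 1)} else {(int k, int k + 1), (- int k - 1, - int k)}"
  have inv: "C_inversions w = {r \<in> ?F. ?P r}" "C_inversions (w \<circ> sgen k) = {r \<in> ?F. ?P (?s r)}"
    by (auto simp: C_inversions_def)
  have 1: "card {r \<in> ?F. ?P (?s r)} + card {r \<in> ?A. ?P r} = card {r \<in> ?F. ?P r} + card {r \<in> ?A. \<not> ?P r}"
  proof (rule card_flip)
    show "?s r \<in> ?F - ?A \<and> ?s (?s r) = r" if "r \<in> ?F - ?A" for r
    proof (cases "k = 0")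
      case True then show ?thesis using that by (auto simp: sgen_apply split: if_splits)
    next
      case False
      obtain i j where r0: "r = (i, j)" by (cases r)
      then have r: "r = (i, j)" "i < j" "i \<noteq> 0" "j \<noteq> 0"
        "\<not> (i = int k \<and> j = int k + 1)" "\<not> (i = - int k - 1 \<and> j = - int k)"
        using that False by auto
      have "sgen k i < sgen k j \<and> sgen k i \<noteq> 0 \<and> sgen k j \<noteq> 0 \<and> \<not> (sgen k i = int k \<and> sgen k j = int k + 1)
         \<and> \<not> (sgen k i = - int k - 1 \<and> sgen k j = - int k)"
        using r(2-) False unfolding sgen_apply by (smt (verit) of_nat_0_less_iff neq0_conv)
      then show ?thesis using False r by (auto simp: sgen_sgen_apply)
    qed
    show "finite {r \<in> ?F. ?P r}" using finite_C_inversions[OF w] by (simp add: inv)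
    show "?P (?s r) \<longleftrightarrow> \<not> ?P r" if "r \<in> ?A" for r
    proof (cases "k = 0")
      case True
      then show ?thesis using that wp(2)[of 1] wp(3)[of 1] by (auto simp: sgen_apply)
    next
      case False
      have "w (int k) \<noteq> w (int k + 1)" using inj_eq[OF wp(1)] by simp
      moreover have "w (- int k - 1) = - w (int k + 1)" using wp(2)[of "int k + 1"] by simp
      ultimately show ?thesis using that False wp(2)[of "int k"] by (auto simp: sgen_apply)
    qed
  qed auto
  \<comment> \<open>Only s_0 maps a positive number to a negative one.\<close>
  let ?F' = "{j. j > (0::int)}" and ?A' = "if k = 0 then {1} else {} :: int set"
  have 2: "card {r \<in> ?F'. w (sgen k r) < 0} + card {r \<in> ?A'. w r < 0} = card {r \<in> ?F'. w r < 0} + card {r \<in> ?A'. \<not> w r < 0}"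
  proof (rule card_flip)
    show "sgen k r \<in> ?F' - ?A' \<and> sgen k (sgen k r) = r" if "r \<in> ?F' - ?A'" for r
      using that by (auto simp: sgen_apply split: if_splits)
    show "finite {r \<in> ?F'. w r < 0}" using finite_C_inversions[OF w] by simp
    show "w (sgen k r) < 0 \<longleftrightarrow> \<not> w r < 0" if "r \<in> ?A'" for r
      using that wp(2)[of 1] wp(3)[of 1] by (auto simp: sgen_apply split: if_splits)
  qed auto
  have 3: "card {r \<in> ?A. ?P r} + card {r \<in> ?A'. w r < 0} = (if C_descent w k then 2 else 0)
      \<and> card {r \<in> ?A. \<not> ?P r} + card {r \<in> ?A'. \<not> w r < 0} = (if C_descent w k then 0 else 2)"
  proof (cases "k = 0")
    case True
    have e: "{r \<in> ?A. ?P r} = (if w 1 < 0 then {(-1, 1)} else {})" "{r \<in> ?A. \<not> ?P r} = (if w 1 < 0 then {} else {(-1, 1)})"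
      "{r \<in> ?A'. w r < 0} = (if w 1 < 0 then {1} else {})" "{r \<in> ?A'. \<not> w r < 0} = (if w 1 < 0 then {} else {1})"
      using True wp(2)[of 1] wp(3)[of 1] by auto
    show ?thesis unfolding e using True by (simp add: C_descent_def)
  next
    case False
    have ne: "w (int k) \<noteq> w (int k + 1)" using inj_eq[OF wp(1)] by simp
    have m: "w (- int k - 1) = - w (int k + 1)" using wp(2)[of "int k + 1"] by simp
    have e: "{r \<in> ?A. ?P r} = (if w (int k) > w (int k + 1) then ?A else {})" "{r \<in> ?A. \<not> ?P r} = (if w (int k) > w (int k + 1) then {} else ?A)"
      using False m wp(2)[of "int k"] ne by auto
    have "card ?A = 2" using False by auto
    then show ?thesis unfolding e using False by (simp add: C_descent_def)
  qed
  have neg: "{j. j > 0 \<and> w j < 0} = {r \<in> ?F'. w r < 0}" "{j. j > 0 \<and> (w \<circ> sgen k) j < 0} = {r \<in> ?F'. w (sgen k r) < 0}"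
    by auto
  \<comment> \<open>Totals that differ by 2 have halves that differ by 1, even after
    rounding.\<close>
  have "if d then (a + b) div 2 = Suc ((a' + b') div 2) else (a' + b') div 2 = Suc ((a + b) div 2)"
    if "a' + p = a + q" "b' + p' = b + q'"
      "p + p' = (if d then 2 else 0) \<and> q + q' = (if d then 0 else 2)" for d and a a' b b' p p' q q' :: nat
  proof (cases d)
    case True then have "a + b = a' + b' + 2" using that by auto
    then show ?thesis using True by simp
  next
    case False then have "a' + b' = a + b + 2" using that by auto
    then show ?thesis using False by simp
  qed
  from this[OF 1 2 3] show ?thesis unfolding C_length_def inv neg .
qed

lemma C_length_less_iff: "w \<in> Winf \<Longrightarrow> C_length (w \<circ> sgen k) < C_length w \<longleftrightarrow> C_descent w k"
  using C_length_sgen[of w k] by (auto split: if_splits)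

lemma W_Winf: "w \<in> W n \<Longrightarrow> w \<in> Winf"
  by (auto simp: Winf_def)

text \<open>Without descents w increases strictly on 0..n; a lower bound climbs from 0, an upper
  bound comes down from n, and oddness settles the negative arguments.\<close>

lemma W_no_descent:
  assumes w: "w \<in> W n" and nd: "\<And>k. k < n \<Longrightarrow> \<not> C_descent w k"
  shows "w = id"
proof -
  have p: "w permutes {- int n..int n}" using w by (auto simp: W_def)
  note wp = Winf_props[OF W_Winf[OF w]]
  have step: "w (int k) < w (int k + 1)" if "k < n" for k
  proof (cases "k = 0")
    case True
    then show ?thesis using nd[OF that] wp(3)[of 1] wp(3)[of 0] by (auto simp: C_descent_def)
  next
    case False
    have "w (int k) \<noteq> w (int k + 1)" using inj_eq[OF wp(1)] by simp
    then show ?thesis using nd[OF that] False by (auto simp: C_descent_def)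
  qed
  have low: "k \<le> n \<Longrightarrow> w (int k) \<ge> int k" for k
  proof (induction k)
    case (Suc k)
    then show ?case using step[of k] by (auto simp: add.commute)
  qed (use wp(3)[of 0] in simp)
  have up: "k \<le> n \<Longrightarrow> w (int (n - k)) \<le> int (n - k)" for k
  proof (induction k)
    case 0
    then show ?case using permutes_in_image[OF p, of "int n"] by auto
  next
    case (Suc k)
    have "int (n - k) = int (n - Suc k) + 1" using Suc by auto
    then show ?case using step[of "n - Suc k"] Suc by auto
  qed
  have pos: "w (int k) = int k" if "k \<le> n" for k
    using low[OF that] up[of "n - k"] that by auto
  have "w x = x" for x
  proof (cases "x \<in> {- int n..int n}")
    case True
    show ?thesis
    proof (cases "x \<ge> 0")
      case True then show ?thesis using pos[of "nat x"] \<open>x \<in> _\<close> by auto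
    next
      case False then show ?thesis using pos[of "nat (- x)"] wp(2)[of "- x"] \<open>x \<in> _\<close> by auto
    qed
  qed (use permutes_not_in[OF p] in auto)
  then show ?thesis by (simp add: fun_eq_iff)
qed

lemma C_length_id: "C_length id = 0"
proof -
  have "C_inversions id = {}" "{j. j > 0 \<and> id j < (0::int)} = {}" by (auto simp: C_inversions_def)
  then show ?thesis unfolding C_length_def by (simp only: card.empty)
qed

lemma coxeter_W: "coxeter_length sgen {..<n} (W n) C_length"
proof
  show "\<exists>i\<in>{..<n}. C_length (w \<circ> sgen i) < C_length w" if "w \<in> W n" "w \<noteq> id" for w
    using W_no_descent[OF that(1)] that C_length_less_iff[OF W_Winf[OF that(1)]] by blast
  show "C_length (w \<circ> sgen i) = Suc (C_length w) \<or> C_length w = Suc (C_length (w \<circ> sgen i))"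
    if "w \<in> W n" for w i
    using C_length_sgen[OF W_Winf[OF that], of i] by (auto split: if_splits)
qed (auto simp: id_W W_comp_sgen sgen_sgen C_length_id)

text \<open>\<open>ell\<close> is defined with all generators; sharing the statistic
  \<open>C_length\<close> identifies it with the length inside each \<open>W n\<close>.\<close>

lemma coxeter_Winf: "coxeter_length sgen UNIV Winf C_length"
proof
  show "\<exists>i\<in>UNIV. C_length (w \<circ> sgen i) < C_length w" if w: "w \<in> Winf" "w \<noteq> id" for w
  proof -
    obtain n where "w \<in> W n" using w(1) by (auto simp: Winf_def)
    then show ?thesis using W_no_descent[of w n] w C_length_less_iff[OF w(1)] by blast
  qed
  show "C_length (w \<circ> sgen i) = Suc (C_length w) \<or> C_length w = Suc (C_length (w \<circ> sgen i))"
    if "w \<in> Winf" for w i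
    using C_length_sgen[OF that, of i] by (auto split: if_splits)
qed (auto simp: id_W W_Winf[OF id_W] Winf_comp_sgen sgen_sgen C_length_id)

lemma ell_eq: "w \<in> Winf \<Longrightarrow> ell w = C_length w"
  by (rule coxeter_length.cox_length_eq[OF coxeter_Winf])

lemma nil_coxeter_W: "nil_coxeter sgen {..<n} (W n) C_length ddx"
proof (rule nil_coxeter.intro[OF coxeter_W], unfold_locales)
  interpret coxeter_length sgen "{..<n}" "W n" C_length by (rule coxeter_W)
  fix w i j
  assume w: "w \<in> W n" and ij: "i \<in> {..<n}" "j \<in> {..<n}" "i < j"
    and d: "C_length (w \<circ> sgen i) < C_length w" "C_length (w \<circ> sgen j) < C_length w"
  have I: "w \<circ> sgen i \<in> Winf" "w \<circ> sgen i \<circ> sgen j \<in> Winf" "w \<circ> sgen i \<circ> sgen j \<circ> sgen i \<in> Winf"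
    using W_Winf[OF w] by (auto intro: Winf_comp_sgen)
  have D: "C_descent w i" "C_descent w j" using d C_length_less_iff[OF W_Winf[OF w]] by auto
  note wp = Winf_props[OF W_Winf[OF w]]
  \<comment> \<open>The Dynkin diagram: distant nodes, a simple bond between positive neighbours,
    and the double bond between 0 and 1.\<close>
  consider "Suc i < j" | "i \<ge> 1" "j = Suc i" | "i = 0" "j = 1" using ij(3) by linarith
  then show "\<exists>u\<in>W n. \<exists>as bs. set as \<subseteq> {..<n} \<and> set bs \<subseteq> {..<n} \<and> w = u \<circ> word_prod sgen (as @ [i]) \<and> w = u \<circ> word_prod sgen (bs @ [j])
        \<and> C_length w = C_length u + Suc (length as) \<and> C_length w = C_length u + Suc (length bs)
        \<and> (\<forall>f. foldr ddx (as @ [i]) f = foldr ddx (bs @ [j]) f)"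
  proof cases
    case 1
    have "C_descent (w \<circ> sgen i) j" using D 1 by (auto simp: C_descent_def sgen_apply)
    then show ?thesis
      using 1 d I by (intro dihedral_comm[OF w ij(1,2)] sgen_comm ddx_comm) (auto simp: C_length_less_iff)
  next
    case 2
    have "C_descent (w \<circ> sgen i) j" "C_descent (w \<circ> sgen i \<circ> sgen j) i"
      using D 2 by (auto simp: C_descent_def sgen_apply add.commute)
    then show ?thesis
      using 2 d I
      by (intro dihedral_braid3[OF w ij(1,2)]) (auto simp: C_length_less_iff sgen_braid3 ddx_braid3)
  next
    case 3
    have D: "w 1 < 0" "w 2 < w 1" using D 3 by (auto simp: C_descent_def)
    moreover have "w (- 1) = - w 1" "w (- 2) = - w 2" by (rule wp(2))+
    ultimately have "C_descent (w \<circ> sgen i) j" "C_descent (w \<circ> sgen i \<circ> sgen j) i" "C_descent (w \<circ> sgen i \<circ> sgen j \<circ> sgen i) j"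
      using 3 by (auto simp: C_descent_def sgen_apply)
    then show ?thesis
      using 3 d I ddx_braid4[symmetric] sgen_braid4
      by (intro dihedral_braid4[OF w ij(1,2)]) (auto simp: C_length_less_iff)
  qed
qed (auto simp: ddx_ddx ddx_add ddx_scale ddx_eq_0)

section \<open>The symmetric group\<close>

definition A_gen :: "nat \<Rightarrow> nat \<Rightarrow> nat" where
  "A_gen i = Transposition.transpose i (Suc i)"

definition A_inversions :: "(nat \<Rightarrow> nat) \<Rightarrow> (nat \<times> nat) set" where
  "A_inversions w = {(i, j). i < j \<and> w i > w j}"

definition A_length :: "(nat \<Rightarrow> nat) \<Rightarrow> nat" where
  "A_length w = card (A_inversions w)"

lemma A_gen_apply: "A_gen i x = (if x = i then Suc i else if x = Suc i then i else x)"
  by (auto simp: A_gen_def Transposition.transpose_def)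

lemma A_inversions_subset:
  assumes "w permutes {1..n}"
  shows "A_inversions w \<subseteq> {(i, j). 1 \<le> i \<and> i < j \<and> j \<le> n}"
proof
  fix r assume r: "r \<in> A_inversions w"
  obtain i j where ij': "r = (i, j)" "i < j" "w j < w i" using r by (auto simp: A_inversions_def)
  then have ij: "i < j" "w j < w i" by auto
  have out: "w x = x" if "x < 1 \<or> x > n" for x using permutes_not_in[OF assms, of x] that by auto
  have bd: "1 \<le> w x \<and> w x \<le> n" if "1 \<le> x" "x \<le> n" for x using permutes_in_image[OF assms, of x] that by auto
  have "1 \<le> i \<and> j \<le> n"
    using ij out[of i] out[of j] bd[of i] bd[of j] by linarith
  then show "r \<in> {(i, j). 1 \<le> i \<and> i < j \<and> j \<le> n}" using ij' by auto
qed

lemma finite_A_pairs: "finite {(i, j). 1 \<le> i \<and> i < j \<and> j \<le> (n::nat)}"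
  by (rule finite_subset[of _ "{..n} \<times> {..n}"]) auto

lemma A_length_gen:
  assumes w: "w permutes {1..n}"
  shows "if w k > w (Suc k) then A_length w = Suc (A_length (w \<circ> A_gen k)) else A_length (w \<circ> A_gen k) = Suc (A_length w)"
proof -
  let ?F = "{(i, j). i < (j::nat)}"
  let ?P = "\<lambda>(i, j). w i > w j"
  let ?s = "\<lambda>(i, j). (A_gen k i, A_gen k j)"
  have inv: "A_inversions w = {r \<in> ?F. ?P r}" "A_inversions (w \<circ> A_gen k) = {r \<in> ?F. ?P (?s r)}"
    by (auto simp: A_inversions_def)
  have ne: "w k \<noteq> w (Suc k)" using inj_eq[OF permutes_inj[OF w]] by simp
  have "card {r \<in> ?F. ?P (?s r)} + card {r \<in> {(k, Suc k)}. ?P r} = card {r \<in> ?F. ?P r} + card {r \<in> {(k, Suc k)}. \<not> ?P r}"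
  proof (rule card_flip)
    show "?s r \<in> ?F - {(k, Suc k)} \<and> ?s (?s r) = r" if "r \<in> ?F - {(k, Suc k)}" for r
      using that by (auto simp: A_gen_apply split: if_splits)
    show "finite {r \<in> ?F. ?P r}"
      unfolding inv(1)[symmetric] by (rule finite_subset[OF A_inversions_subset[OF w] finite_A_pairs])
    show "?P (?s r) \<longleftrightarrow> \<not> ?P r" if "r \<in> {(k, Suc k)}" for r
      using that ne by (auto simp: A_gen_apply)
  qed auto
  moreover have "{r \<in> {(k, Suc k)}. ?P r} = (if w k > w (Suc k) then {(k, Suc k)} else {})"
    "{r \<in> {(k, Suc k)}. \<not> ?P r} = (if w k > w (Suc k) then {} else {(k, Suc k)})" by auto
  ultimately show ?thesis unfolding A_length_def inv by (auto split: if_splits)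
qed

lemma A_length_less_iff: "w permutes {1..n} \<Longrightarrow> A_length (w \<circ> A_gen k) < A_length w \<longleftrightarrow> w k > w (Suc k)"
  using A_length_gen[of w n k] by (auto split: if_splits)

lemma A_no_descent:
  assumes w: "w permutes {1..n}" and nd: "\<And>k. k \<in> {1..<n} \<Longrightarrow> \<not> w k > w (Suc k)"
  shows "w = id"
proof -
  have step: "w k < w (Suc k)" if "k \<in> {1..<n}" for k
    using nd[OF that] permutes_inj[OF w] by (metis injD linorder_neqE_nat n_not_Suc_n)
  have low: "k \<in> {1..n} \<Longrightarrow> w k \<ge> k" for k
  proof (induction k)
    case (Suc k)
    then show ?case using step[of k] permutes_in_image[OF w, of "Suc 0"] by (cases "k = 0") auto
  qed simp
  have up: "k < n \<Longrightarrow> w (n - k) \<le> n - k" for k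
  proof (induction k)
    case 0
    then show ?case using permutes_in_image[OF w, of n] by auto
  next
    case (Suc k)
    have "n - k = Suc (n - Suc k)" "n - Suc k \<in> {1..<n}" using Suc.prems by auto
    then show ?case using step[of "n - Suc k"] Suc by auto
  qed
  have "w x = x" for x
  proof (cases "x \<in> {1..n}")
    case True then show ?thesis using low[of x] up[of "n - x"] by auto
  qed (use permutes_not_in[OF w] in auto)
  then show ?thesis by (simp add: fun_eq_iff)
qed

lemma A_gen_permutes: "k \<in> {1..<n} \<Longrightarrow> A_gen k permutes {1..n}"
  unfolding A_gen_def by (intro permutes_swap_id) auto

lemma coxeter_A: "coxeter_length A_gen {1..<n} {w. w permutes {1..n}} A_length"
proof
  show "\<exists>i\<in>{1..<n}. A_length (w \<circ> A_gen i) < A_length w" if "w \<in> {w. w permutes {1..n}}" "w \<noteq> id" for w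
    using A_no_descent[of w n] that A_length_less_iff[of w n] by blast
  show "A_length (w \<circ> A_gen i) = Suc (A_length w) \<or> A_length w = Suc (A_length (w \<circ> A_gen i))"
    if "w \<in> {w. w permutes {1..n}}" for w i
    using A_length_gen[of w n i] that by (auto split: if_splits)
  show "A_gen i \<circ> A_gen i = id" for i by (auto simp: fun_eq_iff A_gen_apply)
  have "A_inversions id = {}" by (auto simp: A_inversions_def)
  then show "A_length id = 0" by (simp only: A_length_def card.empty)
  show "id \<in> {w. w permutes {1..n}}" by (simp add: permutes_id)
  show "w \<circ> A_gen i \<in> {w. w permutes {1..n}}" if "w \<in> {w. w permutes {1..n}}" "i \<in> {1..<n}" for w i
    using permutes_compose[OF A_gen_permutes[OF that(2)]] that(1) by blast
qed

lemma nil_coxeter_A: "nil_coxeter A_gen {1..<n} {w. w permutes {1..n}} A_length ddx"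
proof (rule nil_coxeter.intro[OF coxeter_A], unfold_locales)
  interpret coxeter_length A_gen "{1..<n}" "{w. w permutes {1..n}}" A_length by (rule coxeter_A)
  fix w i j
  assume w: "w \<in> {w. w permutes {1..n}}" and ij: "i \<in> {1..<n}" "j \<in> {1..<n}" "i < j"
    and d: "A_length (w \<circ> A_gen i) < A_length w" "A_length (w \<circ> A_gen j) < A_length w"
  have I: "w \<circ> A_gen i permutes {1..n}" "w \<circ> A_gen i \<circ> A_gen j permutes {1..n}"
    using gen_in[OF w ij(1)] gen_in[OF gen_in[OF w ij(1)] ij(2)] by auto
  have D: "w (Suc i) < w i" "w (Suc j) < w j" using d w A_length_less_iff[of w n] by auto
  consider "Suc i < j" | "j = Suc i" using ij(3) by linarith
  then show "\<exists>u\<in>{w. w permutes {1..n}}. \<exists>as bs. set as \<subseteq> {1..<n} \<and> set bs \<subseteq> {1..<n} \<and> w = u \<circ> word_prod A_gen (as @ [i]) \<and> w = u \<circ> word_prod A_gen (bs @ [j])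
        \<and> A_length w = A_length u + Suc (length as) \<and> A_length w = A_length u + Suc (length bs)
        \<and> (\<forall>f. foldr ddx (as @ [i]) f = foldr ddx (bs @ [j]) f)"
  proof cases
    case 1
    have "(w \<circ> A_gen i) (Suc j) < (w \<circ> A_gen i) j" using D 1 by (auto simp: A_gen_apply)
    moreover have "A_gen i \<circ> A_gen j = A_gen j \<circ> A_gen i" using 1 by (auto simp: fun_eq_iff A_gen_apply)
    ultimately show ?thesis
      using 1 d by (intro dihedral_comm[OF w ij(1,2)] ddx_comm) (auto simp: A_length_less_iff[OF I(1)])
  next
    case 2
    have "(w \<circ> A_gen i) (Suc j) < (w \<circ> A_gen i) j" "(w \<circ> A_gen i \<circ> A_gen j) (Suc i) < (w \<circ> A_gen i \<circ> A_gen j) i"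
      using D 2 by (auto simp: A_gen_apply)
    then have "A_length (w \<circ> A_gen i \<circ> A_gen j) < A_length (w \<circ> A_gen i)"
      "A_length (w \<circ> A_gen i \<circ> A_gen j \<circ> A_gen i) < A_length (w \<circ> A_gen i \<circ> A_gen j)"
      using A_length_less_iff[OF I(1)] A_length_less_iff[OF I(2)] by auto
    moreover have "A_gen i \<circ> A_gen j \<circ> A_gen i = A_gen j \<circ> A_gen i \<circ> A_gen j" using 2 by (auto simp: fun_eq_iff A_gen_apply)
    ultimately show ?thesis
      using 2 d ij
      by (intro dihedral_braid3[OF w ij(1,2)]) (auto simp: ddx_braid3)
  qed
qed (auto simp: ddx_ddx ddx_add ddx_scale ddx_eq_0)

section \<open>Type A Schubert polynomials\<close>

definition A_pairs :: "nat \<Rightarrow> (nat \<times> nat) set" where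
  "A_pairs n = {(i, j). 1 \<le> i \<and> i < j \<and> j \<le> n}"

lemma w0A_permutes: "w0A n permutes {1..n}"
proof (rule bij_imp_permutes)
  show "bij_betw (w0A n) {1..n} {1..n}"
    by (rule bij_betw_byWitness[of _ "w0A n"]) (auto simp: w0A_def)
qed (auto simp: w0A_def)

lemma w0A_w0A: "w0A n \<circ> w0A n = id"
  by (auto simp: fun_eq_iff w0A_def)

text \<open>Right multiplication by w_0 complements the inversions, read through the reflection of
  (i, j) to (n + 1 - j, n + 1 - i).\<close>

lemma A_length_w0A:
  assumes "w permutes {1..n}"
  shows "A_length (w \<circ> w0A n) + A_length w = card (A_pairs n)"
proof -
  let ?f = "\<lambda>(i, j). (n + 1 - j, n + 1 - i)"
  note fin = finite_A_pairs[of n, folded A_pairs_def]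
  have sub: "A_inversions w \<subseteq> A_pairs n"
    using A_inversions_subset[OF assms] by (simp add: A_pairs_def)
  have sub': "A_inversions (w \<circ> w0A n) \<subseteq> A_pairs n"
    using A_inversions_subset[OF permutes_compose[OF w0A_permutes assms]] by (simp add: A_pairs_def)
  have iff: "r \<in> A_inversions (w \<circ> w0A n) \<longleftrightarrow> ?f r \<in> A_pairs n - A_inversions w" if r: "r \<in> A_pairs n" for r
  proof -
    obtain i j where ij: "r = (i, j)" "1 \<le> i" "i < j" "j \<le> n" using r by (auto simp: A_pairs_def)
    have "w (n + 1 - j) \<noteq> w (n + 1 - i)" using inj_eq[OF permutes_inj[OF assms]] ij by auto
    then show ?thesis using ij by (auto simp: A_inversions_def A_pairs_def w0A_def)
  qed
  have "bij_betw ?f (A_inversions (w \<circ> w0A n)) (A_pairs n - A_inversions w)"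
  proof (rule bij_betw_byWitness[of _ ?f])
    show "\<forall>r\<in>A_inversions (w \<circ> w0A n). ?f (?f r) = r" using sub' by (auto simp: A_pairs_def)
    show "\<forall>r\<in>A_pairs n - A_inversions w. ?f (?f r) = r" by (auto simp: A_pairs_def)
    show "?f ` A_inversions (w \<circ> w0A n) \<subseteq> A_pairs n - A_inversions w" using iff sub' by blast
    show "?f ` (A_pairs n - A_inversions w) \<subseteq> A_inversions (w \<circ> w0A n)"
    proof
      fix x assume "x \<in> ?f ` (A_pairs n - A_inversions w)"
      then obtain r where r: "r \<in> A_pairs n - A_inversions w" "x = ?f r" by blast
      then have "x \<in> A_pairs n" "?f x = r" by (auto simp: A_pairs_def)
      then show "x \<in> A_inversions (w \<circ> w0A n)" using iff[of x] r by auto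
    qed
  qed
  then have "A_length (w \<circ> w0A n) = card (A_pairs n - A_inversions w)"
    unfolding A_length_def by (rule bij_betw_same_card)
  also have "\<dots> = card (A_pairs n) - A_length w"
    unfolding A_length_def using sub fin by (intro card_Diff_subset) (auto intro: finite_subset)
  finally show ?thesis using card_mono[OF fin sub] by (simp add: A_length_def)
qed

lemma A_length_inv:
  assumes "w permutes {1..n}"
  shows "A_length (inv w) = A_length w"
proof -
  note b = permutes_inverses[OF assms]
  have "bij_betw (\<lambda>(i, j). (w j, w i)) (A_inversions w) (A_inversions (inv w))"
    by (rule bij_betw_byWitness[of _ "\<lambda>(i, j). (inv w j, inv w i)"]) (auto simp: A_inversions_def b)
  then show ?thesis unfolding A_length_def by (metis bij_betw_same_card)
qed

definition x_delta :: "nat \<Rightarrow> gxy" where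
  "x_delta n = (\<Prod>i=1..n. xv i ^ (n - i))"

lemma x_delta_GX: "x_delta n \<in> GX n"
  unfolding x_delta_def by (intro subring_intros[OF is_subring_GX] GX_xv)

text \<open>The hypothesis keeps \<open>\<sigma>\<close> away from index 0, where \<open>xv\<close>
  repeats x_1.\<close>

lemma perm_act_comp:
  assumes "\<And>k. k \<ge> 1 \<Longrightarrow> \<sigma> k \<ge> 1"
  shows "perm_act (\<pi> \<circ> \<sigma>) f = perm_act \<pi> (perm_act \<sigma> f)"
  by (rule gxy_hom_eqI[of "perm_act (\<pi> \<circ> \<sigma>)" "\<lambda>f. perm_act \<pi> (perm_act \<sigma> f)"])
     (use is_ring_hom_perm_act in \<open>auto simp: is_ring_hom_def perm_act_simps assms[simplified]\<close>)

lemma s_act_perm_act: "i \<ge> 1 \<Longrightarrow> s_act i = perm_act (A_gen i)"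
  by (simp add: s_act_def A_gen_def)

text \<open>Adjacent transpositions generate S_n. In this form the symmetric elements are the
  invariants that \<open>free_over_Inv\<close> speaks of.\<close>

lemma GX_sym_eq_Inv: "GX_sym n = {f \<in> GX n. \<forall>i\<in>{1..<n}. ddx i f = 0}"
proof (intro equalityI subsetI)
  fix f assume f: "f \<in> GX_sym n"
  then have "perm_act (A_gen i) f = f" if "i \<in> {1..<n}" for i
    using A_gen_permutes[OF that] by (auto simp: GX_sym_def)
  then show "f \<in> {f \<in> GX n. \<forall>i\<in>{1..<n}. ddx i f = 0}"
    using f by (auto simp: GX_sym_def ddx_eq_0 s_act_perm_act)
next
  fix f assume f: "f \<in> {f \<in> GX n. \<forall>i\<in>{1..<n}. ddx i f = 0}"
  then have s: "perm_act (A_gen i) f = f" if "i \<in> {1..<n}" for i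
    using that by (auto simp: ddx_eq_0 s_act_perm_act)
  have pos: "w k \<ge> 1" if "w permutes {1..n}" "k \<ge> 1" for w and k :: nat
    using that permutes_in_image[OF that(1), of k] permutes_not_in[OF that(1), of k] by (cases "k \<in> {1..n}") auto
  have w: "perm_act (word_prod A_gen as) f = f" if "set as \<subseteq> {1..<n}" for as
    using that
  proof (induction as)
    case Nil
    have "perm_act id f = f"
      by (rule gxy_hom_eqI[of "perm_act id" "\<lambda>f. f"])
         (use is_ring_hom_perm_act in \<open>auto simp: is_ring_hom_def perm_act_simps\<close>)
    then show "perm_act (word_prod A_gen []) f = f" by (simp only: word_prod_simps)
  next
    case (Cons i as)
    have p: "word_prod A_gen as permutes {1..n}"
      using coxeter_length.word_in[OF coxeter_A, of as n] Cons.prems by auto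
    have "perm_act (A_gen i \<circ> word_prod A_gen as) f = perm_act (A_gen i) (perm_act (word_prod A_gen as) f)"
      by (rule perm_act_comp) (rule pos[OF p])
    moreover have "perm_act (word_prod A_gen as) f = f" using Cons by simp
    ultimately show "perm_act (word_prod A_gen (i # as)) f = f"
      using Cons.prems s by (simp only: word_prod_simps) simp
  qed
  have "perm_act \<pi> f = f" if \<pi>: "\<pi> permutes {1..n}" for \<pi>
    using coxeter_length.shortest_word[OF coxeter_A, of \<pi> n] \<pi> w by auto
  then show "f \<in> GX_sym n" using f by (auto simp: GX_sym_def)
qed

text \<open>A reduced word of w_0. Letters act from the right, so the block m, ..., 1 applies 1
  first and lowers the staircase monomial for m + 1 variables to the one for m.\<close>

fun w0_word :: "nat \<Rightarrow> nat list" where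
  "w0_word 0 = []"
| "w0_word (Suc m) = w0_word m @ rev [1..<Suc m]"

lemma sum_staircase: "(\<Sum>i=1..Suc n. Suc n - i) = (\<Sum>i=1..n. n - i) + n"
proof -
  have "(\<Sum>i=1..Suc n. Suc n - i) = (\<Sum>i=1..n. Suc n - i)" by simp
  also have "\<dots> = (\<Sum>i=1..n. (n - i) + 1)" by (intro sum.cong) auto
  finally show ?thesis by (simp only: sum.distrib) simp
qed

lemma card_A_pairs: "card (A_pairs n) = (\<Sum>i=1..n. n - i)"
proof (induction n)
  case 0
  have "A_pairs 0 = {}" by (auto simp: A_pairs_def)
  then show ?case by simp
next
  case (Suc n)
  have "A_pairs (Suc n) = A_pairs n \<union> (\<lambda>i. (i, Suc n)) ` {1..n}"
    by (auto simp: A_pairs_def)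
  moreover have "card (A_pairs n \<union> (\<lambda>i. (i, Suc n)) ` {1..n}) = card (A_pairs n) + card ((\<lambda>i. (i, Suc n)) ` {1..n})"
    using finite_A_pairs[of n] by (intro card_Un_disjoint) (auto simp: A_pairs_def)
  moreover have "card ((\<lambda>i. (i, Suc n)) ` {1..n}) = n"
    by (subst card_image) (auto simp: inj_on_def)
  ultimately show ?case using Suc.IH unfolding sum_staircase by simp
qed

lemma length_w0_word: "length (w0_word n) = card (A_pairs n)"
  unfolding card_A_pairs
  by (induction n) (simp_all only: w0_word.simps sum_staircase length_append length_rev, simp_all)

lemma set_w0_word: "set (w0_word n) \<subseteq> {1..<n}"
  by (induction n) auto

lemma ddx_xv: "i \<ge> 1 \<Longrightarrow> ddx i (xv i) = 1"
  by (rule ddx_unique) (simp add: ddenom_def s_act_simps)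

lemma s_act_prod_xv:
  assumes "i \<ge> 1" "\<And>j. j \<in> S \<Longrightarrow> j \<ge> 1 \<and> j \<noteq> i \<and> j \<noteq> Suc i"
  shows "s_act i (\<Prod>j\<in>S. xv j ^ e j) = (\<Prod>j\<in>S. xv j ^ e j)"
  unfolding s_act_hom using assms by (intro prod.cong) (auto simp: s_act_hom s_act_simps)

lemma foldr_ddx_x_delta: "foldr ddx (w0_word n) (x_delta n) = 1"
proof (induction n)
  case (Suc n)
  \<comment> \<open>After the operators 1, ..., k each of the first k exponents has dropped by
    one.\<close>
  let ?F = "\<lambda>k. \<Prod>i=1..Suc n. xv i ^ (if i \<le> k then n - i else Suc n - i)"
  have step: "ddx (Suc k) (?F k) = ?F (Suc k)" if k: "k < n" for k
  proof -
    let ?i = "Suc k" and ?R = "{1..Suc n} - {Suc k, Suc (Suc k)}"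
    let ?C = "\<Prod>i\<in>?R. xv i ^ (if i \<le> k then n - i else Suc n - i)"
    have split: "prod g {1..Suc n} = g ?i * (g (Suc ?i) * prod g ?R)" for g :: "nat \<Rightarrow> gxy"
    proof -
      have "prod g {1..Suc n} = g ?i * prod g ({1..Suc n} - {?i})" using k by (intro prod.remove) auto
      also have "prod g ({1..Suc n} - {?i}) = g (Suc ?i) * prod g ({1..Suc n} - {?i} - {Suc ?i})"
        using k by (intro prod.remove) auto
      also have "{1..Suc n} - {?i} - {Suc ?i} = ?R" by auto
      finally show ?thesis .
    qed
    \<comment> \<open>The exponents of x_{k+1} and x_{k+2} differ by one, so the monomial is x_{k+1}
      times an invariant of s_{k+1}.\<close>
    have 1: "?F k = (xv ?i ^ (n - ?i) * xv (Suc ?i) ^ (n - ?i) * ?C) * xv ?i"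
      unfolding split using k by (simp add: Suc_diff_Suc[symmetric] mult_ac)
    have C': "(\<Prod>i\<in>?R. xv i ^ (if i \<le> Suc k then n - i else Suc n - i)) = ?C"
      by (intro prod.cong) auto
    have 2: "?F (Suc k) = xv ?i ^ (n - ?i) * xv (Suc ?i) ^ (n - ?i) * ?C"
      unfolding split C' using k by (simp add: mult_ac)
    have "s_act ?i ?C = ?C" by (rule s_act_prod_xv) auto
    then have "s_act ?i (xv ?i ^ (n - ?i) * xv (Suc ?i) ^ (n - ?i) * ?C) = xv ?i ^ (n - ?i) * xv (Suc ?i) ^ (n - ?i) * ?C"
      by (simp add: s_act_hom s_act_simps mult_ac)
    then show ?thesis unfolding 1 2 by (simp add: ddx_scale ddx_xv)
  qed
  have "k \<le> n \<Longrightarrow> foldr ddx (rev [1..<Suc k]) (x_delta (Suc n)) = ?F k" for k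
  proof (induction k)
    case 0
    show ?case by (simp add: x_delta_def)
  next
    case (Suc k)
    then show ?case using step[of k] by simp
  qed
  from this[of n] have "foldr ddx (rev [1..<Suc n]) (x_delta (Suc n)) = ?F n" by simp
  also have "?F n = x_delta n" by (simp add: x_delta_def)
  finally show ?case using Suc.IH by (simp del: upt_Suc)
qed (simp add: x_delta_def)

context
  fixes n :: nat
begin

interpretation A: nil_coxeter A_gen "{1..<n}" "{w. w permutes {1..n}}" A_length ddx
  by (rule nil_coxeter_A)

text \<open>Matsumoto's theorem frees the definition from the word chosen by
  \<open>SOME\<close>.\<close>

lemma schubertA_word:
  assumes "\<pi> permutes {1..n}" "set as \<subseteq> {1..<n}" "word_prod A_gen as = inv \<pi> \<circ> w0A n"
    "length as = A_length (inv \<pi> \<circ> w0A n)"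
  shows "schubertA n \<pi> = foldr ddx as (x_delta n)"
proof -
  have w: "inv \<pi> \<circ> w0A n \<in> {w. w permutes {1..n}}"
    using permutes_compose[OF w0A_permutes permutes_inv[OF assms(1)]] by simp
  define bs where "bs = (SOME as. reduced_word A_gen {1..<n} (inv \<pi> \<circ> w0A n) as)"
  have "reduced_word A_gen {1..<n} (inv \<pi> \<circ> w0A n) as" using A.reduced_word_iff[OF w] assms by auto
  then have "reduced_word A_gen {1..<n} (inv \<pi> \<circ> w0A n) bs" unfolding bs_def by (rule someI)
  then have bs: "set bs \<subseteq> {1..<n}" "word_prod A_gen bs = inv \<pi> \<circ> w0A n" "length bs = A_length (inv \<pi> \<circ> w0A n)"
    using A.reduced_word_iff[OF w] by auto
  have "(\<lambda>i. Transposition.transpose i (Suc i)) = A_gen" by (simp add: A_gen_def fun_eq_iff)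
  then have "schubertA n \<pi> = foldr ddx bs (x_delta n)"
    by (simp add: schubertA_def x_delta_def bs_def)
  also have "\<dots> = foldr ddx as (x_delta n)"
    by (rule A.foldr_D_reduced) (use assms bs in auto)
  finally show ?thesis .
qed

lemma schubertA_has_word:
  assumes "\<pi> permutes {1..n}"
  obtains as where "set as \<subseteq> {1..<n}" "word_prod A_gen as = inv \<pi> \<circ> w0A n"
    "length as = A_length (inv \<pi> \<circ> w0A n)" "schubertA n \<pi> = foldr ddx as (x_delta n)"
proof -
  have w: "inv \<pi> \<circ> w0A n \<in> {w. w permutes {1..n}}"
    using permutes_compose[OF w0A_permutes permutes_inv[OF assms]] by simp
  show ?thesis using A.shortest_word[OF w] schubertA_word[OF assms] that by metis
qed

lemma schubertA_GX:
  assumes "\<pi> permutes {1..n}"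
  shows "schubertA n \<pi> \<in> GX n"
proof -
  have "foldr ddx as f \<in> GX n" if "set as \<subseteq> {1..<n}" "f \<in> GX n" for as f
    using that by (induction as) (auto intro: ddx_GX)
  then show ?thesis using schubertA_has_word[OF assms] x_delta_GX by metis
qed

text \<open>Putting i in front of a word of \<pi>^{-1} w_0 gives a word of (\<pi> s_i)^{-1} w_0.
  Lengths are complementary by \<open>A_length_w0A\<close>, so the new word is reduced exactly when
  i is a descent of \<pi>.\<close>

lemma ddx_schubertA:
  assumes \<pi>: "\<pi> permutes {1..n}" and i: "i \<in> {1..<n}"
  shows "ddx i (schubertA n \<pi>) = (if A_length (\<pi> \<circ> A_gen i) < A_length \<pi> then schubertA n (\<pi> \<circ> A_gen i) else 0)"
proof -
  obtain as where as: "set as \<subseteq> {1..<n}" "word_prod A_gen as = inv \<pi> \<circ> w0A n"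
    "length as = A_length (inv \<pi> \<circ> w0A n)" "schubertA n \<pi> = foldr ddx as (x_delta n)"
    using schubertA_has_word[OF \<pi>] .
  have \<pi>i: "\<pi> \<circ> A_gen i permutes {1..n}" using A.gen_in[of \<pi> i] \<pi> i by simp
  have "inv (\<pi> \<circ> A_gen i) = inv (A_gen i) \<circ> inv \<pi>"
    by (rule o_inv_distrib[OF permutes_bij[OF \<pi>] permutes_bij[OF A_gen_permutes[OF i]]])
  also have "inv (A_gen i) = A_gen i" by (simp add: A_gen_def)
  finally have word: "word_prod A_gen (i # as) = inv (\<pi> \<circ> A_gen i) \<circ> w0A n"
    by (simp only: word_prod_simps as(2) comp_assoc)
  have len: "A_length (inv \<rho> \<circ> w0A n) + A_length \<rho> = card (A_pairs n)" if "\<rho> permutes {1..n}" for \<rho>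
    using A_length_w0A[OF permutes_inv[OF that]] A_length_inv[OF that] by simp
  note L = len[OF \<pi>] len[OF \<pi>i] A.L_step[of \<pi> i]
  show ?thesis
  proof (cases "A_length (\<pi> \<circ> A_gen i) < A_length \<pi>")
    case True
    have "schubertA n (\<pi> \<circ> A_gen i) = foldr ddx (i # as) (x_delta n)"
      by (rule schubertA_word[OF \<pi>i _ word]) (use L True as i \<pi> in auto)
    then show ?thesis using True as by simp
  next
    case False
    have "foldr ddx (i # as) (x_delta n) = 0"
      by (rule A.foldr_D_nonreduced) (use i as in simp, unfold word, use L False as i \<pi> in auto)
    then show ?thesis using False as by simp
  qed
qed

text \<open>The product of \<open>w0_word\<close> is not computed. Its operator takes the nonzero
  value 1 on the staircase monomial, so the word is reduced, and w_0 is the only permutation of that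
  length.\<close>

lemma schubertA_id: "schubertA n id = 1"
proof -
  let ?v = "word_prod A_gen (w0_word n)"
  have v: "?v \<in> {w. w permutes {1..n}}" by (rule A.word_in[OF set_w0_word])
  have "\<not> A_length ?v < length (w0_word n)"
    using A.foldr_D_nonreduced[OF set_w0_word, of "x_delta n"] foldr_ddx_x_delta[of n] by auto
  then have Lv: "A_length ?v = card (A_pairs n)"
    using A.L_word_le[OF set_w0_word] length_w0_word[of n] by simp
  then have "A_length (?v \<circ> w0A n) = 0" using A_length_w0A[of ?v n] v by simp
  then have "?v \<circ> w0A n = id"
    using A.descent[of "?v \<circ> w0A n"] permutes_compose[OF w0A_permutes] v by auto
  then have "?v \<circ> w0A n \<circ> w0A n = w0A n" by simp
  then have "?v = w0A n" by (simp only: comp_assoc w0A_w0A comp_id)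
  then have "schubertA n id = foldr ddx (w0_word n) (x_delta n)"
    using Lv by (intro schubertA_word permutes_id set_w0_word) (simp_all add: length_w0_word)
  then show ?thesis by (simp add: foldr_ddx_x_delta)
qed

theorem schubertA_basis:
  "free_with_basis (GX_sym n) (GX n) {\<pi>. \<pi> permutes {1..n}} (schubertA n)"
proof -
  have "free_with_basis (A.Inv (GX n)) (GX n) {\<pi>. \<pi> permutes {1..n}} (schubertA n)"
    by (rule A.free_over_Inv)
       (auto simp: is_subring_GX finite_permutations ddx_GX schubertA_GX schubertA_id ddx_schubertA)
  then show ?thesis unfolding A.Inv_def GX_sym_eq_Inv .
qed

end

section \<open>Symmetric polynomials\<close>

text \<open>The a_p of the overview, indexed by natural numbers.\<close>

definition esn :: "nat \<Rightarrow> nat \<Rightarrow> gxy" where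
  "esn n p = elem_sym n (\<lambda>i. - xv i) (int p)"

lemma elem_sym_0: "elem_sym n z 0 = 1"
proof -
  have "{S. S \<subseteq> {1..n} \<and> int (card S) = 0} = {{}}" by (auto dest: finite_subset)
  then show ?thesis by (simp add: elem_sym_def)
qed

lemma elem_sym_0_Suc: "elem_sym 0 z (int (Suc p)) = 0"
proof -
  have "{S. S \<subseteq> {1..(0::nat)} \<and> int (card S) = int (Suc p)} = {}" by auto
  then show ?thesis unfolding elem_sym_def by (simp only: sum.empty)
qed

lemma elem_sym_Suc:
  "elem_sym (Suc n) z (int (Suc p)) = elem_sym n z (int (Suc p)) + z (Suc n) * elem_sym n z (int p)"
proof -
  let ?A = "{S. S \<subseteq> {1..n} \<and> int (card S) = int (Suc p)}" and ?B = "{S. S \<subseteq> {1..n} \<and> int (card S) = int p}"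
  have fin: "finite S" and notin: "Suc n \<notin> S" if "S \<subseteq> {1..n}" for S using that by (auto dest: finite_subset)
  have eq: "{S. S \<subseteq> {1..Suc n} \<and> int (card S) = int (Suc p)} = ?A \<union> insert (Suc n) ` ?B"
  proof (intro equalityI subsetI)
    fix S assume S: "S \<in> {S. S \<subseteq> {1..Suc n} \<and> int (card S) = int (Suc p)}"
    show "S \<in> ?A \<union> insert (Suc n) ` ?B"
    proof (cases "Suc n \<in> S")
      case True
      then have "S = insert (Suc n) (S - {Suc n})" "card (S - {Suc n}) = p"
        using S by auto
      moreover have "S - {Suc n} \<subseteq> {1..n}" using S by (auto simp: le_Suc_eq)
      ultimately show ?thesis by blast
    next
      case False
      then show ?thesis using S by (auto simp: le_Suc_eq)
    qed
  qed (auto simp: fin notin)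
  have "elem_sym (Suc n) z (int (Suc p)) = (\<Sum>S\<in>?A. \<Prod>i\<in>S. z i) + (\<Sum>S\<in>insert (Suc n) ` ?B. \<Prod>i\<in>S. z i)"
    unfolding elem_sym_def eq by (rule sum.union_disjoint) (auto intro: finite_subset[of _ "Pow {1..n}"])
  also have "(\<Sum>S\<in>insert (Suc n) ` ?B. \<Prod>i\<in>S. z i) = (\<Sum>S\<in>?B. \<Prod>i\<in>insert (Suc n) S. z i)"
    by (subst sum.reindex) (auto simp: inj_on_def notin dest!: insert_ident[THEN iffD1, rotated 2])
  also have "\<dots> = (\<Sum>S\<in>?B. z (Suc n) * (\<Prod>i\<in>S. z i))"
    by (intro sum.cong) (auto simp: fin notin)
  finally show ?thesis by (simp add: elem_sym_def sum_distrib_left)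
qed

lemma elem_sym_fps:
  "Abs_fps (\<lambda>p. elem_sym n z (int p)) = (\<Prod>i=1..n. 1 + fps_const (z i) * fps_X)"
proof (induction n)
  case 0
  show ?case
  proof (rule fps_ext)
    fix k
    show "fps_nth (Abs_fps (\<lambda>p. elem_sym 0 z (int p))) k = fps_nth (\<Prod>i=1..0. 1 + fps_const (z i) * fps_X) k"
      using elem_sym_0_Suc[of z "k - 1"] elem_sym_0[of 0 z] by (cases k) simp_all
  qed
next
  case (Suc n)
  let ?E = "\<lambda>n. Abs_fps (\<lambda>p. elem_sym n z (int p))"
  have "?E (Suc n) = ?E n * (1 + fps_const (z (Suc n)) * fps_X)"
  proof (rule fps_ext)
    fix k
    have "?E n * (1 + fps_const (z (Suc n)) * fps_X) = ?E n + fps_X * (fps_const (z (Suc n)) * ?E n)"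
      by (simp add: algebra_simps)
    then have "fps_nth (?E n * (1 + fps_const (z (Suc n)) * fps_X)) k
        = fps_nth (?E n) k + (if k = 0 then 0 else z (Suc n) * fps_nth (?E n) (k - 1))"
      by (simp only: fps_add_nth fps_X_mult_nth fps_mult_left_const_nth)
    then show "fps_nth (?E (Suc n)) k = fps_nth (?E n * (1 + fps_const (z (Suc n)) * fps_X)) k"
      using elem_sym_Suc[of n z "k - 1"] elem_sym_0[of n z] elem_sym_0[of "Suc n" z] by (cases k) simp_all
  qed
  then show ?case using Suc.IH by simp
qed

lemma fps_linear_prod_nth_0:
  fixes z :: "'i \<Rightarrow> 'a::comm_ring_1"
  assumes "finite S" "card S < j"
  shows "fps_nth (\<Prod>i\<in>S. 1 + fps_const (z i) * fps_X) j = 0"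
  using assms
proof (induction S arbitrary: j rule: finite_induct)
  case (insert i S)
  let ?P = "\<Prod>i\<in>S. 1 + fps_const (z i) * fps_X"
  have "(1 + fps_const (z i) * fps_X) * ?P = ?P + fps_X * (fps_const (z i) * ?P)"
    by (simp add: algebra_simps)
  then have "fps_nth ((1 + fps_const (z i) * fps_X) * ?P) j
      = fps_nth ?P j + (if j = 0 then 0 else z i * fps_nth ?P (j - 1))"
    by (simp only: fps_add_nth fps_X_mult_nth fps_mult_left_const_nth)
  then show ?case using insert by simp
qed simp

lemma esn_0: "esn n 0 = 1"
  by (simp add: esn_def elem_sym_0)

lemma esn_fps: "Abs_fps (esn n) = (\<Prod>i=1..n. 1 + fps_const (- xv i) * fps_X)"
  using elem_sym_fps[of n "\<lambda>i. - xv i"] by (simp add: esn_def[abs_def])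

lemma esn_eq_0: "p > n \<Longrightarrow> esn n p = 0"
  using fps_linear_prod_nth_0[of "{1..n}" p "\<lambda>i. - xv i"] unfolding esn_fps[symmetric] by simp

lemma esn_GX: "esn n p \<in> GX n"
  unfolding esn_def elem_sym_def by (intro subring_intros[OF is_subring_GX] GX_xv) auto

lemma s_act_esn:
  assumes "i \<in> {1..<n}"
  shows "s_act i (esn n p) = esn n p"
proof -
  let ?\<S> = "{S. S \<subseteq> {1..n} \<and> int (card S) = int p}"
  have inv: "A_gen i ` A_gen i ` S = S" for S
    unfolding image_image by (simp add: A_gen_apply cong: if_cong)
       (auto simp: image_iff)
  have inj: "inj (A_gen i)" by (rule permutes_inj[OF A_gen_permutes[OF assms]])
  have mem: "A_gen i ` S \<in> ?\<S>" if "S \<in> ?\<S>" for S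
    using that assms card_image[OF inj_on_subset[OF inj subset_UNIV], of S]
    by (auto simp: A_gen_apply split: if_splits)
  have "s_act i (esn n p) = (\<Sum>S\<in>?\<S>. \<Prod>t\<in>S. - xv (A_gen i t))"
    unfolding esn_def elem_sym_def s_act_hom
  proof (intro sum.cong prod.cong refl)
    fix S t assume "S \<in> ?\<S>" "t \<in> S"
    then have "t \<ge> 1" by auto
    then show "- s_act i (xv t) = - xv (A_gen i t)" using assms by (auto simp: s_act_simps A_gen_apply)
  qed
  also have "\<dots> = (\<Sum>S\<in>?\<S>. \<Prod>t\<in>A_gen i ` S. - xv t)"
    by (intro sum.cong refl) (simp add: prod.reindex[OF inj_on_subset[OF inj subset_UNIV]])
  also have "\<dots> = (\<Sum>S\<in>?\<S>. \<Prod>t\<in>S. - xv t)"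
    by (rule sum.reindex_bij_witness[of _ "\<lambda>S. A_gen i ` S" "\<lambda>S. A_gen i ` S"]) (use mem inv in auto)
  finally show ?thesis by (simp add: esn_def elem_sym_def)
qed

text \<open>A priori smaller than \<open>GX_sym n\<close>; equality, in \<open>GX_sym_eq\<close>, is
  the fundamental theorem on symmetric polynomials over Gamma.\<close>

definition sym_gen :: "nat \<Rightarrow> gxy set" where
  "sym_gen n = ring_gen (range cc \<union> range (esn n))"

lemma is_subring_GX_sym: "is_subring (GX_sym n)"
  using schubertA_basis[of n] by (simp add: free_with_basis_def)

lemma sym_gen_subset: "sym_gen n \<subseteq> GX_sym n"
  unfolding sym_gen_def
proof (rule ring_gen_subset[OF is_subring_GX_sym])
  show "range cc \<union> range (esn n) \<subseteq> GX_sym n"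
    by (auto simp: GX_sym_eq_Inv GX_cc esn_GX ddx_eq_0 s_act_esn s_act_simps)
qed

lemma is_subring_sym_gen: "is_subring (sym_gen n)"
  unfolding sym_gen_def by (rule is_subring_ring_gen)

text \<open>As x^m falls back to lower powers, their span is closed under multiplication by x and
  hence a ring.\<close>

lemma monic_extension_span:
  assumes R: "is_subring R" and m: "m \<ge> 1" and x: "x ^ m \<in> rspan R {x ^ e | e. e < m}"
  shows "ring_gen (insert x R) \<subseteq> rspan R {x ^ e | e. e < m}" (is "_ \<subseteq> ?M")
proof (rule ring_gen_subset)
  have base: "x ^ e \<in> ?M" if "e < m" for e
    using rspan_term[OF subring_one[OF R], of "x ^ e" "{x ^ e | e. e < m}"] that by auto
  have xM: "x * y \<in> ?M" if "y \<in> ?M" for y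
  proof (rule rspan_mult_closed[OF that _ R])
    fix b assume "b \<in> {x ^ e | e. e < m}"
    then obtain e where e: "b = x ^ e" "e < m" by blast
    show "x * b \<in> ?M"
    proof (cases "Suc e < m")
      case True then show ?thesis using base[of "Suc e"] e by simp
    next
      case False then have "m = Suc e" using e by simp
      then show ?thesis using x e by simp
    qed
  qed
  have xeM: "x ^ e * y \<in> ?M" if "y \<in> ?M" for e y
    by (induction e) (auto simp: that mult.assoc xM)
  have RM: "r \<in> ?M" if "r \<in> R" for r
  proof -
    have "x ^ 0 \<in> {x ^ e | e. e < m}" using m by fastforce
    then show ?thesis using rspan_term[OF that, of "x ^ 0" "{x ^ e | e. e < m}"] by simp
  qed
  show "is_subring ?M"
    unfolding is_subring_def
  proof (intro conjI ballI)
    show "1 \<in> ?M" by (rule RM[OF subring_one[OF R]])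
    fix y z assume y: "y \<in> ?M" and z: "z \<in> ?M"
    show "y - z \<in> ?M" by (rule rspan_diff[OF R y z])
    show "y * z \<in> ?M"
      by (rule rspan_mult_closed[OF z _ R]) (use xeM[OF y] in \<open>auto simp: mult.commute\<close>)
  qed
  show "insert x R \<subseteq> ?M" using RM xM[OF RM[OF subring_one[OF R]]] by auto
qed

lemma rspan_trans:
  assumes "S \<subseteq> rspan R B" "is_subring R"
  shows "rspan S C \<subseteq> rspan R {b * c | b c. b \<in> B \<and> c \<in> C}"
proof (rule rspan_subset)
  let ?B = "{b * c | b c. b \<in> B \<and> c \<in> C}"
  fix r c assume r: "r \<in> S" and c: "c \<in> C"
  have "c * r \<in> rspan R ?B"
  proof (rule rspan_mult_closed[OF _ _ assms(2)])
    show "r \<in> rspan R B" using r assms(1) by blast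
    fix b assume "b \<in> B"
    then have "b * c \<in> ?B" using c by blast
    then have "b * c \<in> rspan R ?B" by (rule rspan_base[OF assms(2)])
    then show "c * b \<in> rspan R ?B" by (simp add: mult.commute)
  qed
  then show "r * c \<in> rspan R ?B" by (simp add: mult.commute)
qed

text \<open>\<open>esn_tail n k j\<close> is the \<open>j\<close>-th elementary symmetric polynomial in
  \<open>-x\<^bsub>k+1\<^esub>, \<dots>, -x\<^sub>n\<close>, written as a polynomial in the \<open>esn n\<close> and \<open>x\<^sub>1, \<dots>, x\<^sub>k\<close>.\<close>

fun esn_tail :: "nat \<Rightarrow> nat \<Rightarrow> nat \<Rightarrow> gxy" where
  "esn_tail n 0 j = esn n j"
| "esn_tail n (Suc k) j = (\<Sum>i\<le>j. esn_tail n k i * xv (Suc k) ^ (j - i))"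

text \<open>Multiplication by the geometric series in x_{k+1} cancels the factor 1 - x_{k+1}
  t.\<close>

lemma esn_tail_fps:
  assumes "k \<le> n"
  shows "Abs_fps (esn_tail n k) = (\<Prod>i=Suc k..n. 1 + fps_const (- xv i) * fps_X)"
  using assms
proof (induction k)
  case 0
  have "esn_tail n 0 = esn n" by (simp add: fun_eq_iff)
  then show ?case using esn_fps[of n] by simp
next
  case (Suc k)
  let ?x = "xv (Suc k)" and ?P = "\<lambda>k. \<Prod>i=Suc k..n. 1 + fps_const (- xv i) * fps_X"
  have geo: "(1 + fps_const (- ?x) * fps_X) * Abs_fps (\<lambda>j. ?x ^ j) = 1"
  proof (rule fps_ext)
    fix j
    let ?G = "Abs_fps (\<lambda>j. ?x ^ j)"
    have "(1 + fps_const (- ?x) * fps_X) * ?G = ?G + fps_X * (fps_const (- ?x) * ?G)"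
      by (simp add: algebra_simps)
    then have "fps_nth ((1 + fps_const (- ?x) * fps_X) * ?G) j
        = fps_nth ?G j + (if j = 0 then 0 else - ?x * fps_nth ?G (j - 1))"
      by (simp only: fps_add_nth fps_X_mult_nth fps_mult_left_const_nth)
    then show "fps_nth ((1 + fps_const (- ?x) * fps_X) * ?G) j = fps_nth 1 j"
      by (cases j) simp_all
  qed
  have "Abs_fps (esn_tail n (Suc k)) = Abs_fps (esn_tail n k) * Abs_fps (\<lambda>j. ?x ^ j)"
    by (rule fps_ext) (simp add: fps_mult_nth atLeast0AtMost)
  also have "Abs_fps (esn_tail n k) = (1 + fps_const (- ?x) * fps_X) * ?P (Suc k)"
    using Suc.IH Suc.prems by (simp add: prod.atLeast_Suc_atMost[of "Suc k"])
  also have "\<dots> * Abs_fps (\<lambda>j. ?x ^ j) = ?P (Suc k) * ((1 + fps_const (- ?x) * fps_X) * Abs_fps (\<lambda>j. ?x ^ j))"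
    by (simp only: mult_ac)
  finally show ?case unfolding geo by simp
qed

lemma esn_tail_0: "esn_tail n k 0 = 1"
  by (induction k) (simp_all add: esn_0)

lemma esn_tail_eq_0: "k \<le> n \<Longrightarrow> n - k < j \<Longrightarrow> esn_tail n k j = 0"
  using fps_linear_prod_nth_0[of "{Suc k..n}" j "\<lambda>i. - xv i"] esn_tail_fps[of k n]
  by (metis card_atLeastAtMost diff_Suc_Suc fps_nth_Abs_fps finite_atLeastAtMost)

definition stair_mono :: "nat \<Rightarrow> nat \<Rightarrow> gxy set" where
  "stair_mono n k = {\<Prod>i=1..k. xv i ^ \<alpha> i | \<alpha>. \<forall>i\<in>{1..k}. \<alpha> i \<le> n - i}"

lemma esn_tail_in: "esn_tail n k j \<in> ring_gen (sym_gen n \<union> xv ` {1..k})"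
proof (induction k arbitrary: j)
  case 0
  have "esn n j \<in> sym_gen n" unfolding sym_gen_def by (auto intro: ring_gen.gen)
  then show ?case by (auto intro: ring_gen.gen)
next
  case (Suc k)
  have "esn_tail n k i \<in> ring_gen (sym_gen n \<union> xv ` {1..Suc k})" for i
    by (rule subsetD[OF ring_gen_mono Suc.IH]) auto
  moreover have "xv (Suc k) \<in> ring_gen (sym_gen n \<union> xv ` {1..Suc k})"
    by (rule ring_gen.gen) auto
  ultimately show ?case by (simp only: esn_tail.simps) (intro ring_gen_intros)
qed

lemma stair_span:
  "k \<le> n \<Longrightarrow> ring_gen (sym_gen n \<union> xv ` {1..k}) \<subseteq> rspan (sym_gen n) (stair_mono n k)"
proof (induction k)
  case 0
  have "1 \<in> stair_mono n 0" by (auto simp: stair_mono_def)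
  then have "sym_gen n \<subseteq> rspan (sym_gen n) (stair_mono n 0)"
    using rspan_term[of _ "sym_gen n" 1 "stair_mono n 0"] by auto
  moreover have "ring_gen (sym_gen n) \<subseteq> sym_gen n"
    by (rule ring_gen_subset[OF is_subring_sym_gen]) simp
  ultimately show ?case by auto
next
  case (Suc k)
  let ?R = "ring_gen (sym_gen n \<union> xv ` {1..k})" and ?x = "xv (Suc k)" and ?m = "n - k"
  have m: "?m \<ge> 1" using Suc.prems by simp
  \<comment> \<open>Only n - k - 1 variables remain, so nothing has degree n - k; this is a monic
    equation for x_{k+1} over the earlier variables.\<close>
  have "0 = esn_tail n (Suc k) ?m" using esn_tail_eq_0[of "Suc k" n ?m] Suc.prems by simp
  also have "\<dots> = ?x ^ ?m + (\<Sum>i=1..?m. esn_tail n k i * ?x ^ (?m - i))"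
    by (simp add: atLeast0AtMost[symmetric] sum.atLeast_Suc_atMost esn_tail_0)
  finally have "?x ^ ?m = - (\<Sum>i=1..?m. esn_tail n k i * ?x ^ (?m - i))"
    by (simp add: eq_neg_iff_add_eq_0)
  also have "\<dots> = (\<Sum>i=1..?m. (- esn_tail n k i) * ?x ^ (?m - i))"
    by (simp add: sum_negf)
  also have "\<dots> \<in> rspan ?R {?x ^ e | e. e < ?m}"
  proof (intro rspan_sum rspan_term)
    fix i assume "i \<in> {1..?m}"
    then show "?x ^ (?m - i) \<in> {?x ^ e | e. e < ?m}" using m by auto
    show "- esn_tail n k i \<in> ?R" by (intro ring_gen_intros esn_tail_in)
  qed
  finally have "ring_gen (insert ?x ?R) \<subseteq> rspan ?R {?x ^ e | e. e < ?m}"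
    by (intro monic_extension_span is_subring_ring_gen m)
  also have "\<dots> \<subseteq> rspan (sym_gen n) {b * c | b c. b \<in> stair_mono n k \<and> c \<in> {?x ^ e | e. e < ?m}}"
    by (rule rspan_trans[OF Suc.IH is_subring_sym_gen]) (use Suc.prems in simp)
  also have "\<dots> \<subseteq> rspan (sym_gen n) (stair_mono n (Suc k))"
  proof (rule rspan_mono[OF order_refl], clarify)
    fix b c e assume b: "b \<in> stair_mono n k" and e: "e < ?m"
    obtain \<alpha> where \<alpha>: "b = (\<Prod>i=1..k. xv i ^ \<alpha> i)" "\<forall>i\<in>{1..k}. \<alpha> i \<le> n - i"
      using b by (auto simp: stair_mono_def)
    let ?\<beta> = "\<alpha>(Suc k := e)"
    have "(\<Prod>i=1..k. xv i ^ ?\<beta> i) = b" unfolding \<alpha> by (intro prod.cong) auto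
    then have "b * ?x ^ e = (\<Prod>i=1..Suc k. xv i ^ ?\<beta> i)" by simp
    moreover have "\<forall>i\<in>{1..Suc k}. ?\<beta> i \<le> n - i" using \<alpha> e by (auto simp: le_Suc_eq)
    ultimately show "b * ?x ^ e \<in> stair_mono n (Suc k)" unfolding stair_mono_def by blast
  qed
  finally have "ring_gen (insert ?x ?R) \<subseteq> rspan (sym_gen n) (stair_mono n (Suc k))" .
  moreover have "ring_gen (sym_gen n \<union> xv ` {1..Suc k}) \<subseteq> ring_gen (insert ?x ?R)"
  proof (rule ring_gen_mono)
    have "sym_gen n \<union> xv ` {1..k} \<subseteq> ?R" by (rule subsetI) (rule ring_gen.gen)
    then show "sym_gen n \<union> xv ` {1..Suc k} \<subseteq> insert ?x ?R" by (auto simp: atLeastAtMostSuc_conv)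
  qed
  ultimately show ?case by blast
qed

lemma GX_stair_span: "GX n \<subseteq> rspan (sym_gen n) (stair_mono n n)"
proof -
  have "GX n \<subseteq> ring_gen (sym_gen n \<union> xv ` {1..n})"
    unfolding GX_eq by (rule ring_gen_mono) (auto simp: sym_gen_def intro: ring_gen.gen)
  then show ?thesis using stair_span[of n n] by auto
qed

text \<open>The degree is tracked as well, so that one operator per pair in \<open>A_pairs n\<close>
  leaves only integers.\<close>

definition stair_part :: "nat \<Rightarrow> nat \<Rightarrow> gxy set" where
  "stair_part n d = rspan (range of_int) {\<Prod>i=1..n. xv i ^ \<alpha> i | \<alpha>. (\<forall>i\<in>{1..n}. \<alpha> i \<le> n - i) \<and> (\<Sum>i=1..n. \<alpha> i) \<le> d}"

lemma is_subring_range_of_int: "is_subring (range of_int)"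
  unfolding is_subring_def
  by (auto simp: of_int_diff[symmetric] of_int_mult[symmetric] simp del: of_int_diff of_int_mult)
     (metis of_int_1 rangeI)

lemma ddx_power: "i \<ge> 1 \<Longrightarrow> ddx i (xv i ^ r) = (\<Sum>j<r. xv i ^ j * xv (Suc i) ^ (r - Suc j))"
  by (rule ddx_unique)
     (simp add: ddenom_def s_act_hom s_act_simps power_diff_sumr2 mult.commute)

lemma ddx_power_Suc: "i \<ge> 1 \<Longrightarrow> ddx i (xv (Suc i) ^ r) = - (\<Sum>j<r. xv i ^ j * xv (Suc i) ^ (r - Suc j))"
proof -
  assume i: "i \<ge> 1"
  have s: "s_act i (xv i ^ r) = xv (Suc i) ^ r" using i by (simp add: s_act_hom s_act_simps)
  have "ddenom i * ddx i (xv (Suc i) ^ r) = - (ddenom i * ddx i (xv i ^ r))"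
    unfolding ddx_eq s[symmetric] s_act_s_act by simp
  also have "\<dots> = ddenom i * - ddx i (xv i ^ r)" by simp
  finally have "ddx i (xv (Suc i) ^ r) = - ddx i (xv i ^ r)" by (rule nzd_cancel[OF nzd_ddenom])
  then show ?thesis using ddx_power[OF i] by simp
qed

text \<open>Split off the symmetric factor (x_i x_{i+1})^q, q the smaller exponent. The divided
  difference of the remaining pure power lowers the degree by one, and the new exponents stay below
  the larger of the two old ones.\<close>

lemma ddx_stair_part:
  assumes i: "i \<in> {1..<n}" and f: "f \<in> stair_part n (Suc d)"
  shows "ddx i f \<in> stair_part n d"
  using f unfolding stair_part_def
proof (induction rule: rspan.induct)
  case zero then show ?case by (simp add: ddx_zero rspan.zero)
next
  case (step f k m)
  let ?B = "{\<Prod>i=1..n. xv i ^ \<alpha> i | \<alpha>. (\<forall>i\<in>{1..n}. \<alpha> i \<le> n - i) \<and> (\<Sum>i=1..n. \<alpha> i) \<le> d}"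
  obtain \<alpha> where \<alpha>: "m = (\<Prod>i=1..n. xv i ^ \<alpha> i)" "\<forall>i\<in>{1..n}. \<alpha> i \<le> n - i" "(\<Sum>i=1..n. \<alpha> i) \<le> Suc d"
    using step by blast
  let ?R = "{1..n} - {i, Suc i}"
  let ?C = "\<Prod>j\<in>?R. xv j ^ \<alpha> j" and ?x = "xv i" and ?y = "xv (Suc i)"
  have dec: "{1..n} = insert i (insert (Suc i) ?R)" using i by auto
  have split: "(\<Prod>j=1..n. g j) = g i * (g (Suc i) * (\<Prod>j\<in>?R. g j))" for g :: "nat \<Rightarrow> gxy"
    by (subst dec) simp
  have ssplit: "(\<Sum>j=1..n. g j) = g i + (g (Suc i) + (\<Sum>j\<in>?R. g j))" for g :: "nat \<Rightarrow> nat"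
    by (subst dec) simp
  have C: "s_act i ?C = ?C" by (rule s_act_prod_xv) (use i in auto)
  have tm: "?C * (?x ^ p * ?y ^ q) \<in> rspan (range of_int) ?B"
    if "p \<le> n - Suc i" "q \<le> n - Suc i" "Suc (p + q) \<le> \<alpha> i + \<alpha> (Suc i)" for p q
  proof -
    let ?\<beta> = "\<alpha>(i := p, Suc i := q)"
    have "(\<Prod>j\<in>?R. xv j ^ ?\<beta> j) = ?C" by (intro prod.cong) auto
    then have "(\<Prod>j=1..n. xv j ^ ?\<beta> j) = ?C * (?x ^ p * ?y ^ q)"
      unfolding split by (simp add: mult_ac)
    moreover have "\<forall>j\<in>{1..n}. ?\<beta> j \<le> n - j" using \<alpha>(2) that by auto
    moreover have "(\<Sum>j\<in>?R. ?\<beta> j) = (\<Sum>j\<in>?R. \<alpha> j)" by (intro sum.cong) auto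
    then have "(\<Sum>j=1..n. ?\<beta> j) \<le> d" using \<alpha>(3) that(3) unfolding ssplit by simp
    ultimately have "?C * (?x ^ p * ?y ^ q) \<in> ?B" by (intro CollectI exI[of _ ?\<beta>]) auto
    then show ?thesis by (rule rspan_base[OF is_subring_range_of_int])
  qed
  have shift: "c * (x * y) ^ q * (\<Sum>j<r. x ^ j * y ^ (r - Suc j)) = (\<Sum>j<r. c * (x ^ (q + j) * y ^ (q + (r - Suc j))))"
    for c x y :: gxy and q r
    unfolding sum_distrib_left by (intro sum.cong refl) (simp only: power_add power_mult_distrib mult_ac)
  have bound: "\<alpha> i \<le> n - i" "\<alpha> (Suc i) \<le> n - Suc i" using \<alpha>(2) i by auto
  have pow: "ddx i (?C * (?x ^ \<alpha> i * ?y ^ \<alpha> (Suc i))) \<in> rspan (range of_int) ?B"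
  proof (cases "\<alpha> (Suc i) \<le> \<alpha> i")
    case True
    define q r where "q = \<alpha> (Suc i)" and "r = \<alpha> i - \<alpha> (Suc i)"
    have e: "\<alpha> i = q + r" using True by (simp add: q_def r_def)
    have "s_act i (?C * (?x * ?y) ^ q) = ?C * (?x * ?y) ^ q"
      using i by (simp add: s_act_hom C s_act_simps mult.commute)
    then have "ddx i (?C * (?x * ?y) ^ q * ?x ^ r) = ?C * (?x * ?y) ^ q * (\<Sum>j<r. ?x ^ j * ?y ^ (r - Suc j))"
      using i by (simp add: ddx_scale ddx_power)
    moreover have "?C * (?x ^ \<alpha> i * ?y ^ \<alpha> (Suc i)) = ?C * (?x * ?y) ^ q * ?x ^ r"
      unfolding e q_def[symmetric] by (simp add: power_add power_mult_distrib mult_ac)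
    ultimately have "ddx i (?C * (?x ^ \<alpha> i * ?y ^ \<alpha> (Suc i))) = (\<Sum>j<r. ?C * (?x ^ (q + j) * ?y ^ (q + (r - Suc j))))"
      by (simp only: shift)
    also have "\<dots> \<in> rspan (range of_int) ?B"
      by (intro rspan_sum tm) (use bound e q_def in auto)
    finally show ?thesis .
  next
    case False
    define q r where "q = \<alpha> i" and "r = \<alpha> (Suc i) - \<alpha> i"
    have e: "\<alpha> (Suc i) = q + r" using False by (simp add: q_def r_def)
    have "s_act i (?C * (?x * ?y) ^ q) = ?C * (?x * ?y) ^ q"
      using i by (simp add: s_act_hom C s_act_simps mult.commute)
    then have "ddx i (?C * (?x * ?y) ^ q * ?y ^ r) = ?C * (?x * ?y) ^ q * - (\<Sum>j<r. ?x ^ j * ?y ^ (r - Suc j))"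
      using i by (simp add: ddx_scale ddx_power_Suc)
    moreover have "?C * (?x ^ \<alpha> i * ?y ^ \<alpha> (Suc i)) = ?C * (?x * ?y) ^ q * ?y ^ r"
      unfolding e q_def[symmetric] by (simp add: power_add power_mult_distrib mult_ac)
    ultimately have "ddx i (?C * (?x ^ \<alpha> i * ?y ^ \<alpha> (Suc i))) = 0 - (\<Sum>j<r. ?C * (?x ^ (q + j) * ?y ^ (q + (r - Suc j))))"
      by (simp only: shift mult_minus_right diff_0)
    also have "\<dots> \<in> rspan (range of_int) ?B"
      by (intro rspan_diff[OF is_subring_range_of_int rspan.zero] rspan_sum tm) (use bound e q_def in auto)
    finally show ?thesis .
  qed
  have "m = ?C * (?x ^ \<alpha> i * ?y ^ \<alpha> (Suc i))" unfolding \<alpha>(1) split by (simp add: mult_ac)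
  moreover obtain z where "k = of_int z" using step by blast
  then have "ddx i (k * m) = k * ddx i m" by (intro ddx_scale) (simp add: s_act_hom)
  ultimately show ?case
    unfolding ddx_add using step pow by (auto intro!: rspan_add rspan_scale[OF is_subring_range_of_int])
qed

lemma foldr_ddx_stair:
  assumes "m \<in> stair_mono n n"
  shows "foldr ddx (w0_word n) m \<in> range of_int"
proof -
  let ?N = "card (A_pairs n)"
  obtain \<alpha> where \<alpha>: "m = (\<Prod>i=1..n. xv i ^ \<alpha> i)" "\<forall>i\<in>{1..n}. \<alpha> i \<le> n - i"
    using assms by (auto simp: stair_mono_def)
  have "(\<Sum>i=1..n. \<alpha> i) \<le> ?N" unfolding card_A_pairs using \<alpha>(2) by (intro sum_mono) auto
  then have "m \<in> stair_part n ?N"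
    unfolding stair_part_def using \<alpha>
    by (intro rspan_base[OF is_subring_range_of_int] CollectI exI[of _ \<alpha>]) auto
  moreover have "foldr ddx as f \<in> stair_part n d"
    if "set as \<subseteq> {1..<n}" "f \<in> stair_part n (d + length as)" for as f d
    using that
  proof (induction as arbitrary: d)
    case (Cons i as)
    have "foldr ddx as f \<in> stair_part n (Suc d)" by (rule Cons.IH) (use Cons.prems in auto)
    then show ?case using ddx_stair_part[of i n] Cons.prems by auto
  qed simp
  ultimately have "foldr ddx (w0_word n) m \<in> stair_part n 0"
    using set_w0_word length_w0_word by (metis add_0)
  also have "stair_part n 0 \<subseteq> range of_int"
    unfolding stair_part_def
  proof (rule rspan_subset_ring[OF is_subring_range_of_int order_refl], rule subsetI)
    fix x assume "x \<in> {\<Prod>i=1..n. xv i ^ \<alpha> i | \<alpha>. (\<forall>i\<in>{1..n}. \<alpha> i \<le> n - i) \<and> (\<Sum>i=1..n. \<alpha> i) \<le> 0}"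
    then obtain \<alpha> where "x = (\<Prod>i=1..n. xv i ^ \<alpha> i)" "(\<Sum>i=1..n. \<alpha> i) = 0" by auto
    then have "x = of_int 1" by (auto intro!: prod.neutral)
    then show "x \<in> range of_int" by blast
  qed
  finally show ?thesis .
qed

text \<open>For symmetric \<open>f\<close> the operator \<open>\<partial>\<^bsub>w\<^sub>0\<^esub>\<close> maps \<open>f x\<^sup>\<delta>\<close> to \<open>f\<close>; expanding \<open>f x\<^sup>\<delta>\<close> in the
  staircase monomials shows that \<open>f\<close> is a polynomial in the elementary symmetric ones.\<close>

lemma GX_sym_eq: "GX_sym n = sym_gen n"
proof
  show "sym_gen n \<subseteq> GX_sym n" by (rule sym_gen_subset)
  show "GX_sym n \<subseteq> sym_gen n"
  proof
    interpret A: nil_coxeter A_gen "{1..<n}" "{w. w permutes {1..n}}" A_length ddx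
      by (rule nil_coxeter_A)
    fix f assume f: "f \<in> GX_sym n"
    have inv: "ddx i a = 0" if "a \<in> GX_sym n" "i \<in> {1..<n}" for a i
      using that unfolding GX_sym_eq_Inv by blast
    have "f * x_delta n \<in> rspan (sym_gen n) (stair_mono n n)"
      using GX_stair_span[of n] subring_mult[OF is_subring_GX, of f n] f x_delta_GX by (auto simp: GX_sym_def)
    moreover have "foldr ddx (w0_word n) h \<in> sym_gen n" if "h \<in> rspan (sym_gen n) (stair_mono n n)" for h
      using that
    proof induction
      case zero
      then show ?case using A.foldr_D_zero[OF set_w0_word] subring_zero[OF is_subring_sym_gen] by simp
    next
      case (step h a m)
      have "foldr ddx (w0_word n) (a * m) = a * foldr ddx (w0_word n) m"
        by (rule A.foldr_D_scale[OF set_w0_word]) (use inv sym_gen_subset step in blast)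
      moreover have "foldr ddx (w0_word n) m \<in> sym_gen n"
        using foldr_ddx_stair[OF step(3)] subring_of_int[OF is_subring_sym_gen] by auto
      ultimately show ?case
        using step subring_add[OF is_subring_sym_gen] subring_mult[OF is_subring_sym_gen]
        by (simp add: A.foldr_D_add[OF set_w0_word])
    qed
    ultimately have "foldr ddx (w0_word n) (f * x_delta n) \<in> sym_gen n" by blast
    moreover have "foldr ddx (w0_word n) (f * x_delta n) = f"
      using A.foldr_D_scale[OF set_w0_word inv[OF f]] by (simp add: foldr_ddx_x_delta)
    ultimately show "f \<in> sym_gen n" by simp
  qed
qed

section \<open>Straightening products\<close>

text \<open>The sum s decides first: its values lie between s^3 and s^3 + s^2, which is less than (s
  + 1)^3. For equal sums, more spread-out indices have the smaller measure. The truncated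
  subtraction is exact by \<open>sum_mset_square_le\<close>.\<close>

definition str_measure :: "nat multiset \<Rightarrow> nat" where
  "str_measure M = sum_mset M ^ 3 + sum_mset M ^ 2 - (\<Sum>p\<in>#M. p ^ 2)"

lemma sum_mset_square_le: "(\<Sum>p\<in>#M. p ^ 2) \<le> sum_mset M ^ 2" for M :: "nat multiset"
proof (induction M)
  case (add x M)
  have "x ^ 2 + sum_mset M ^ 2 \<le> (x + sum_mset M) ^ 2" by (simp add: power2_sum)
  then show ?case using add by simp
qed simp

lemma str_measure_less_sum:
  assumes "sum_mset M < sum_mset N"
  shows "str_measure M < str_measure N"
proof -
  define s t where "s = sum_mset M" and "t = sum_mset N"
  have "str_measure M \<le> s ^ 3 + s ^ 2" by (simp add: str_measure_def s_def)
  also have "\<dots> < (Suc s) ^ 3" by (simp add: power3_eq_cube power2_eq_square algebra_simps)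
  also have "\<dots> \<le> t ^ 3" using assms by (intro power_mono) (auto simp: s_def t_def)
  also have "\<dots> \<le> str_measure N"
    using sum_mset_square_le[of N] by (simp add: str_measure_def t_def)
  finally show ?thesis .
qed

lemma str_measure_less_square:
  assumes "sum_mset M = sum_mset N" "(\<Sum>p\<in>#N. p ^ 2) < (\<Sum>p\<in>#M. p ^ 2)"
  shows "str_measure M < str_measure N"
  using assms sum_mset_square_le[of M] by (simp add: str_measure_def)

lemma str_measure_remove_zero: "str_measure (filter_mset (\<lambda>p. p \<noteq> 0) M) = str_measure M"
proof -
  have "sum_mset (filter_mset (\<lambda>p. p \<noteq> 0) M) = sum_mset M" by (induction M) auto
  moreover have "(\<Sum>p\<in>#filter_mset (\<lambda>p. p \<noteq> 0) M. p ^ 2) = (\<Sum>p\<in>#M. p ^ 2)" by (induction M) auto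
  ultimately show ?thesis by (simp add: str_measure_def)
qed

text \<open>Solving the relation \<open>Grel a p \<in> R\<close> for \<open>(a p)\<^sup>2\<close> either lowers the total index or keeps it and
  raises the sum of the squares of the indices.\<close>

lemma straighten:
  fixes a :: "nat \<Rightarrow> 'a::comm_ring_1"
  assumes R: "is_subring R" and a0: "a 0 = 1" and rel: "\<And>p. p \<ge> 1 \<Longrightarrow> Grel a p \<in> R"
  shows "(\<Prod>p\<in>#M. a p) \<in> rspan R {prod a S | S. finite S \<and> 0 \<notin> S \<and> str_measure (mset_set S) \<le> str_measure M}"
proof (induction "str_measure M" arbitrary: M rule: less_induct)
  case less
  let ?B = "\<lambda>M. {prod a S | S. finite S \<and> 0 \<notin> S \<and> str_measure (mset_set S) \<le> str_measure M}"
  have sub: "(\<Prod>p\<in>#N. a p) \<in> rspan R (?B M)" if "str_measure N < str_measure M" for N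
  proof -
    have "rspan R (?B N) \<subseteq> rspan R (?B M)" using that by (intro rspan_mono) auto
    then show ?thesis using less.hyps[OF that] by blast
  qed
  let ?N = "filter_mset (\<lambda>p. p \<noteq> 0) M"
  have prodN: "(\<Prod>p\<in>#?N. a p) = (\<Prod>p\<in>#M. a p)" by (induction M) (auto simp: a0)
  note mN = str_measure_remove_zero[of M]
  show ?case
  \<comment> \<open>If the nonzero indices are distinct, the product is already squarefree.\<close>
  proof (cases "\<forall>p. count ?N p \<le> 1")
    case True
    have N: "mset_set (set_mset ?N) = ?N"
    proof (rule multiset_eqI)
      fix x
      show "count (mset_set (set_mset ?N)) x = count ?N x"
      proof (cases "x \<in># ?N")
        case x: True
        then have "count ?N x \<ge> 1" by (simp only: count_greater_eq_one_iff)
        then have "count ?N x = 1" using True by (intro le_antisym) blast+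
        then show ?thesis using x by (simp only: count_mset_set(1)[OF finite_set_mset])
      next
        case x: False
        then show ?thesis by (simp only: count_mset_set(3) not_in_iff)
      qed
    qed
    have "prod a (set_mset ?N) = (\<Prod>p\<in>#?N. a p)" unfolding prod_unfold_prod_mset N ..
    moreover have m: "str_measure (mset_set (set_mset ?N)) \<le> str_measure M"
      by (simp only: N mN order_refl)
    have "prod a (set_mset ?N) \<in> ?B M"
      by (intro CollectI exI[of _ "set_mset ?N"] conjI refl m) simp_all
    then have "prod a (set_mset ?N) \<in> rspan R (?B M)" by (rule rspan_base[OF R])
    ultimately show ?thesis using prodN by (simp only:)
  next
    case False
    then obtain p where "count ?N p > 1" by (auto simp: not_le)
    then have p: "p \<ge> 1" and pc: "count ?N p \<ge> 2" by (auto split: if_splits)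
    then have "p \<in># ?N" by (metis count_greater_zero_iff less_le_trans zero_less_numeral)
    then obtain N1 where N1: "?N = add_mset p N1" by (metis mset_add)
    then have "p \<in># N1" using pc by (metis One_nat_def Suc_1 Suc_le_mono count_add_mset count_greater_eq_one_iff)
    then obtain K where "N1 = add_mset p K" by (metis mset_add)
    then have K: "?N = add_mset p (add_mset p K)" using N1 by simp
    let ?P = "\<Prod>q\<in>#K. a q"
    have "(\<Prod>q\<in>#?N. a q) = a p ^ 2 * ?P"
      unfolding K by (simp add: power2_eq_square mult.assoc)
    also have "a p ^ 2 = Grel a p - 2 * (\<Sum>i=1..p. (-1) ^ i * a (p + i) * a (p - i))" by (simp add: Grel_def)
    also have "(Grel a p - 2 * (\<Sum>i=1..p. (-1) ^ i * a (p + i) * a (p - i))) * ?P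
        = Grel a p * ?P - (\<Sum>i=1..p. (2 * (-1) ^ i) * (\<Prod>q\<in>#add_mset (p + i) (add_mset (p - i) K). a q))"
      unfolding left_diff_distrib sum_distrib_left sum_distrib_right
      by (intro arg_cong2[where f = minus] refl sum.cong) (simp add: mult_ac)
    also have "\<dots> \<in> rspan R (?B M)"
    proof (rule rspan_diff[OF R])
      \<comment> \<open>Here a scalar from R replaces the two equal factors, and the index sum drops
        by 2p.\<close>
      have "str_measure K < str_measure ?N" by (rule str_measure_less_sum) (use K p in simp)
      then have "?P \<in> rspan R (?B M)" using mN by (intro sub) simp
      then show "Grel a p * ?P \<in> rspan R (?B M)" by (rule rspan_scale[OF R rel[OF p]])
      show "(\<Sum>i=1..p. (2 * (-1) ^ i) * (\<Prod>q\<in>#add_mset (p + i) (add_mset (p - i) K). a q)) \<in> rspan R (?B M)"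
      proof (intro rspan_sum rspan_scale[OF R] sub)
        show "2 * (-1) ^ i \<in> R" for i by (intro subring_intros[OF R])
        fix i assume i: "i \<in> {1..p}"
        have "str_measure (add_mset (p + i) (add_mset (p - i) K)) < str_measure ?N"
        proof (rule str_measure_less_square)
          show "sum_mset (add_mset (p + i) (add_mset (p - i) K)) = sum_mset ?N" using K i by simp
          obtain j where j: "p = i + j" using i by (metis atLeastAtMost_iff le_Suc_ex)
          have "p ^ 2 + p ^ 2 < (p + i) ^ 2 + (p - i) ^ 2"
            using i unfolding j by (simp add: power2_eq_square algebra_simps)
          then show "(\<Sum>p\<in>#?N. p ^ 2) < (\<Sum>p\<in>#add_mset (p + i) (add_mset (p - i) K). p ^ 2)"
            using K by simp
        qed
        then show "str_measure (add_mset (p + i) (add_mset (p - i) K)) < str_measure M" using mN by simp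
      qed
    qed
    finally show ?thesis using prodN by simp
  qed
qed

text \<open>A product of two members is a product over a multiset with possible repetitions, which
  the hypothesis returns to the span.\<close>

lemma rspan_products_subring:
  assumes R: "is_subring R" and B: "\<And>b. b \<in> B \<Longrightarrow> \<exists>S. b = prod a S"
    and mset: "\<And>M. (\<Prod>p\<in>#M. a p) \<in> rspan R B"
  shows "is_subring (rspan R B)"
proof -
  have "x * y \<in> rspan R B" if x: "x \<in> rspan R B" and y: "y \<in> rspan R B" for x y
  proof (rule rspan_mult_closed[OF y _ R])
    fix b assume "b \<in> B"
    then obtain S where S: "b = prod a S" using B by blast
    have "b * x \<in> rspan R B"
    proof (rule rspan_mult_closed[OF x _ R])
      fix c assume "c \<in> B"
      then obtain T where T: "c = prod a T" using B by blast
      have "b * c = (\<Prod>p\<in>#mset_set S + mset_set T. a p)" by (simp add: S T prod_unfold_prod_mset)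
      then show "b * c \<in> rspan R B" by (simp only: mset)
    qed
    then show "x * b \<in> rspan R B" by (simp add: mult.commute)
  qed
  then show ?thesis
    unfolding is_subring_def using mset[of "{#}"] rspan_diff[OF R] by auto
qed

section \<open>The ring \<open>\<Gamma>\<^bsup>(n)\<^esup>\<close>\<close>

definition esp :: "nat \<Rightarrow> nat \<Rightarrow> gxy" where
  "esp n p = elem_sym n xv (int p)"

lemma esn_esp: "esn n p = (-1) ^ p * esp n p"
  unfolding esn_def esp_def elem_sym_def sum_distrib_left
  by (intro sum.cong) (auto simp: prod_uminus)

lemma esp_esn: "esp n p = (-1) ^ p * esn n p"
  unfolding esn_esp by (simp only: left_minus_one_mult_self)

lemma esp_0: "esp n 0 = 1"
  by (simp add: esp_def elem_sym_0)

lemma nc_esp: "nc n p = (\<Sum>j=0..p. esp n j * cc (p - j))"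
  by (simp add: nc_def esp_def mult.commute)

lemma nc_fps: "Abs_fps (nc n) = Abs_fps (esp n) * Abs_fps cc"
  by (rule fps_ext) (simp add: fps_mult_nth nc_esp)

lemma nc_0: "nc n 0 = 1"
  by (simp add: nc_esp esp_0 cc_0)

section \<open>Generating functions under the substitution of -t for t\<close>

definition alt_fps :: "'a::comm_ring_1 fps \<Rightarrow> 'a fps" where
  "alt_fps f = Abs_fps (\<lambda>p. (-1) ^ p * fps_nth f p)"

lemma alt_fps_mult: "alt_fps (f * g) = alt_fps f * alt_fps g"
proof (rule fps_ext)
  fix k
  have "(-1) ^ k * (fps_nth f i * fps_nth g (k - i)) = ((-1) ^ i * fps_nth f i) * ((-1) ^ (k - i) * fps_nth g (k - i))"
    if "i \<le> k" for i
  proof -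
    have "(-1 :: 'a) ^ k = (-1) ^ i * (-1) ^ (k - i)" using that by (simp add: power_add[symmetric])
    then show ?thesis by (simp only: mult_ac)
  qed
  then show "fps_nth (alt_fps (f * g)) k = fps_nth (alt_fps f * alt_fps g) k"
    by (simp add: alt_fps_def fps_mult_nth sum_distrib_left)
qed

lemma Grel_fps: "Grel a p = (-1) ^ p * fps_nth (alt_fps (Abs_fps a) * Abs_fps a) (2 * p)"
  for a :: "nat \<Rightarrow> 'a::comm_ring_1"
proof -
  have "fps_nth (alt_fps (Abs_fps a) * Abs_fps a) (2 * p) = (-1) ^ p * Grel a p"
    unfolding Grel_even[symmetric] by (simp add: alt_fps_def fps_mult_nth atLeast0AtMost)
  then show ?thesis by (simp only: left_minus_one_mult_self)
qed

lemma Grel_esn: "Grel (esn n) p = Grel (nc n) p"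
proof -
  have "alt_fps (Abs_fps cc) * Abs_fps cc = 1"
    using Grel_iff_fps[of cc] cc_0 Grel_cc by (simp add: alt_fps_def)
  \<comment> \<open>The series of \<open>esn n\<close> is that of \<open>esp n\<close> at -t, so the
    substitution exchanges them.\<close>
  moreover have "alt_fps (Abs_fps (esp n)) = Abs_fps (esn n)" "alt_fps (Abs_fps (esn n)) = Abs_fps (esp n)"
    by (simp_all add: alt_fps_def esn_esp[symmetric] esp_esn[symmetric])
  ultimately have "alt_fps (Abs_fps (nc n)) * Abs_fps (nc n) = alt_fps (Abs_fps (esn n)) * Abs_fps (esn n)"
    by (simp add: nc_fps alt_fps_mult mult.left_commute mult.assoc)
  then show ?thesis by (simp add: Grel_fps)
qed

lemma Gamma_n_eq: "Gamma_n n = ring_gen (range (\<lambda>k. nc n (Suc k)))"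
  unfolding Gamma_n_def by (rule range_peval)

lemma is_subring_Gamma_n: "is_subring (Gamma_n n)"
  unfolding Gamma_n_eq by (rule is_subring_ring_gen)

lemma nc_Gamma_n: "nc n p \<in> Gamma_n n"
  by (cases p) (auto simp: Gamma_n_eq nc_0 intro: ring_gen.intros)

lemma Grel_esn_Gamma_n: "Grel (esn n) p \<in> Gamma_n n"
  unfolding Grel_esn unfolding Grel_def
  by (intro subring_intros[OF is_subring_Gamma_n] nc_Gamma_n)

definition esn_prod :: "nat \<Rightarrow> nat set \<Rightarrow> gxy" where
  "esn_prod n S = (\<Prod>p\<in>S. esn n p)"

text \<open>The bound on the measure is kept for the triangularity of the Q-tilde polynomials. Sets
  with an index above n give the product 0.\<close>

lemma esn_prod_mset:
  "(\<Prod>p\<in>#M. esn n p) \<in> rspan (Gamma_n n) (esn_prod n ` {S \<in> Pow {1..n}. str_measure (mset_set S) \<le> str_measure M})"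
proof -
  let ?B = "{prod (esn n) S | S. finite S \<and> 0 \<notin> S \<and> str_measure (mset_set S) \<le> str_measure M}"
  have "(\<Prod>p\<in>#M. esn n p) \<in> rspan (Gamma_n n) ?B"
    by (rule straighten[OF is_subring_Gamma_n esn_0 Grel_esn_Gamma_n])
  also have "rspan (Gamma_n n) ?B \<subseteq> rspan (Gamma_n n) (esn_prod n ` {S \<in> Pow {1..n}. str_measure (mset_set S) \<le> str_measure M})"
  proof (rule rspan_subset)
    fix r b assume r: "r \<in> Gamma_n n" and "b \<in> ?B"
    then obtain S where S: "b = prod (esn n) S" "finite S" "0 \<notin> S" "str_measure (mset_set S) \<le> str_measure M" by blast
    show "r * b \<in> rspan (Gamma_n n) (esn_prod n ` {S \<in> Pow {1..n}. str_measure (mset_set S) \<le> str_measure M})"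
    proof (cases "S \<subseteq> {1..n}")
      case True
      then show ?thesis using S by (intro rspan_term[OF r]) (auto simp: esn_prod_def)
    next
      case False
      then obtain p where p: "p \<in> S" "p \<notin> {1..n}" by blast
      then have "p > n" using S(3) by (cases "p = 0") auto
      then have "b = 0" using S p esn_eq_0[of n p] by (auto intro: prod_zero)
      then show ?thesis by (simp add: rspan.zero)
    qed
  qed
  finally show ?thesis .
qed

lemma GX_sym_span: "GX_sym n \<subseteq> rspan (Gamma_n n) (esn_prod n ` Pow {1..n})"
proof -
  let ?N = "rspan (Gamma_n n) (esn_prod n ` Pow {1..n})"
  have mset: "(\<Prod>p\<in>#M. esn n p) \<in> ?N" for M
    using esn_prod_mset[of n M] rspan_mono[of "Gamma_n n" "Gamma_n n" "esn_prod n ` {S \<in> Pow {1..n}. str_measure (mset_set S) \<le> str_measure M}" "esn_prod n ` Pow {1..n}"]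
    by auto
  have one: "1 \<in> ?N" using mset[of "{#}"] by simp
  have sub: "is_subring ?N"
    by (rule rspan_products_subring[OF is_subring_Gamma_n _ mset]) (auto simp: esn_prod_def)
  have G: "g \<in> ?N" if "g \<in> Gamma_n n" for g
    using rspan_scale[OF is_subring_Gamma_n that one] by simp
  have e: "esn n p \<in> ?N" for p using mset[of "{#p#}"] by simp
  \<comment> \<open>Since \<open>esp n 0\<close> is 1, c_p is \<open>nc n p\<close> minus terms in c
    of smaller index.\<close>
  have c: "cc p \<in> ?N" for p
  proof (induction p rule: less_induct)
    case (less p)
    have "nc n p = cc p + (\<Sum>j=1..p. esp n j * cc (p - j))"
      unfolding nc_esp by (simp add: sum.atLeast_Suc_atMost esp_0)
    then have "cc p = nc n p - (\<Sum>j=1..p. esp n j * cc (p - j))" by simp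
    also have "\<dots> \<in> ?N"
      using less e G[OF nc_Gamma_n] unfolding esp_esn
      by (intro subring_intros[OF sub]) auto
    finally show ?case .
  qed
  show ?thesis
    unfolding GX_sym_eq sym_gen_def by (rule ring_gen_subset[OF sub]) (use e c in auto)
qed

section \<open>Independence over the invariants of \<open>W\<^sub>n\<close>\<close>

definition W_inv :: "nat \<Rightarrow> gxy set" where
  "W_inv n = {f \<in> GX n. \<forall>i<n. ddx i f = 0}"

text \<open>The sign change of x_{k+1}, as the conjugate of s_0 by s_1, ..., s_k. It also moves the
  c_p.\<close>

fun sign_act :: "nat \<Rightarrow> gxy \<Rightarrow> gxy" where
  "sign_act 0 f = s_act 0 f"
| "sign_act (Suc k) f = s_act (Suc k) (sign_act k (s_act (Suc k) f))"

lemma is_ring_hom_sign_act: "is_ring_hom (sign_act k)"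
proof (induction k)
  case 0
  show ?case using is_ring_hom_s_act[of 0] by (simp add: is_ring_hom_def)
next
  case (Suc k)
  then show ?case using is_ring_hom_s_act[of "Suc k"] by (simp add: is_ring_hom_def)
qed

lemma sign_act_xv: "i \<ge> 1 \<Longrightarrow> sign_act k (xv i) = (if i = Suc k then - xv i else xv i)"
proof (induction k arbitrary: i)
  case (Suc k)
  then show ?case by (auto simp: s_act_simps s_act_hom)
qed (auto simp: s_act_simps)

lemma sign_act_W_inv: "f \<in> W_inv n \<Longrightarrow> k < n \<Longrightarrow> sign_act k f = f"
proof (induction k)
  case (Suc k)
  then show ?case by (simp add: W_inv_def ddx_eq_0)
qed (auto simp: W_inv_def ddx_eq_0)

text \<open>The sign change of x_{k+1} with Gamma fixed. It agrees with \<open>sign_act k\<close> on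
  integer polynomials in the x and, unlike it, is diagonal on monomials over Gamma.\<close>

definition flip :: "nat \<Rightarrow> gxy \<Rightarrow> gxy" where
  "flip k = peval mconst (\<lambda>v. if v = XV k then - mvar v else mvar v)"

lemma is_ring_hom_flip: "is_ring_hom (flip k)"
  unfolding flip_def by (rule peval_ring_hom[OF is_ring_hom_mconst])

lemma flip_xv: "i \<ge> 1 \<Longrightarrow> flip k (xv i) = (if i = Suc k then - xv i else xv i)"
  by (auto simp: flip_def xv_def peval_mvar[OF is_ring_hom_mconst])

lemma lookup_flip: "Poly_Mapping.lookup (flip k f) m = (-1) ^ Poly_Mapping.lookup m (XV k) * Poly_Mapping.lookup f m"
proof -
  let ?\<sigma> = "\<lambda>v. if v = XV k then - mvar v else mvar v :: gxy"
  have mono: "mono_eval ?\<sigma> m = (-1) ^ Poly_Mapping.lookup m (XV k) * mono_eval mvar m" for m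
  proof -
    have "mono_eval ?\<sigma> m = (\<Prod>v\<in>Poly_Mapping.keys m. (if v = XV k then (-1) ^ Poly_Mapping.lookup m v else 1) * mvar v ^ Poly_Mapping.lookup m v)"
      unfolding mono_eval_def by (intro prod.cong refl) (auto simp: power_minus[of "mvar _"])
    also have "\<dots> = (\<Prod>v\<in>Poly_Mapping.keys m. if v = XV k then (-1) ^ Poly_Mapping.lookup m v else 1) * mono_eval mvar m"
      by (simp add: prod.distrib mono_eval_def)
    also have "(\<Prod>v\<in>Poly_Mapping.keys m. if v = XV k then (-1) ^ Poly_Mapping.lookup m v else 1 :: gxy) = (-1) ^ Poly_Mapping.lookup m (XV k)"
      by (auto simp: prod.delta in_keys_iff)
    finally show ?thesis .
  qed
  have "flip k f = (\<Sum>m\<in>Poly_Mapping.keys f. Poly_Mapping.single m ((-1) ^ Poly_Mapping.lookup m (XV k) * Poly_Mapping.lookup f m))"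
    unfolding flip_def peval_def mono mono_eval_mvar
  proof (intro sum.cong refl)
    fix m :: "xyvar \<Rightarrow>\<^sub>0 nat"
    have "mconst a * ((-1) ^ j * Poly_Mapping.single m 1) = Poly_Mapping.single m ((-1) ^ j * a)" for a :: gamma and j :: nat
    proof (cases "even j")
      case True then show ?thesis by (simp add: mconst_def mult_single)
    next
      case False then show ?thesis by (simp add: mconst_def mult_single single_uminus)
    qed
    then show "mconst (Poly_Mapping.lookup f m) * ((-1) ^ Poly_Mapping.lookup m (XV k) * Poly_Mapping.single m 1) =
       Poly_Mapping.single m ((-1) ^ Poly_Mapping.lookup m (XV k) * Poly_Mapping.lookup f m)" .
  qed
  then have "Poly_Mapping.lookup (flip k f) m
      = (\<Sum>m'\<in>Poly_Mapping.keys f. if m' = m then (-1) ^ Poly_Mapping.lookup m' (XV k) * Poly_Mapping.lookup f m' else 0)"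
    by (simp add: lookup_sum lookup_single when_def)
  also have "\<dots> = (-1) ^ Poly_Mapping.lookup m (XV k) * Poly_Mapping.lookup f m"
    by (auto simp: in_keys_iff)
  finally show ?thesis .
qed

lemma sign_act_eq_flip:
  assumes "f \<in> ring_gen (xv ` {1..n})"
  shows "sign_act k f = flip k f"
  by (rule hom_eq_on_ring_gen[OF is_ring_hom_sign_act is_ring_hom_flip _ assms])
     (auto simp: sign_act_xv flip_xv)

lemma flip_ring_gen: "f \<in> ring_gen (xv ` {1..n}) \<Longrightarrow> flip k f \<in> ring_gen (xv ` {1..n})"
proof (rule hom_ring_gen[OF is_ring_hom_flip is_subring_ring_gen])
  have x: "xv i \<in> ring_gen (xv ` {1..n})" if "i \<in> {1..n}" for i
    by (rule ring_gen.gen) (use that in auto)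
  fix g assume "g \<in> xv ` {1..n}"
  then obtain i where i: "g = xv i" "i \<in> {1..n}" by blast
  then have "flip k g = xv i \<or> flip k g = - xv i" by (auto simp: flip_xv)
  then show "flip k g \<in> ring_gen (xv ` {1..n})" using x[OF i(2)] ring_gen_intros(5)[OF x[OF i(2)]] by auto
qed

text \<open>Up to a power of 2, the operators \<open>f \<mapsto> f \<plusminus> \<sigma>\<^sub>k f\<close> for the sign changes \<open>\<sigma>\<^sub>k\<close> project to
  the monomials whose exponents have prescribed parities.\<close>

lemma parity_part:
  assumes a: "\<And>i. i \<in> I \<Longrightarrow> a i \<in> W_inv n" and f: "\<And>i. i \<in> I \<Longrightarrow> f i \<in> ring_gen (xv ` {1..n})"
    and z: "(\<Sum>i\<in>I. a i * f i) = 0" and k: "k \<le> n"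
  shows "\<exists>h. (\<forall>i\<in>I. h i \<in> ring_gen (xv ` {1..n})
      \<and> (\<forall>m. Poly_Mapping.lookup (h i) m = (\<Prod>j<k. 1 + (-1) ^ (\<epsilon> j + Poly_Mapping.lookup m (XV j))) * Poly_Mapping.lookup (f i) m))
      \<and> (\<Sum>i\<in>I. a i * h i) = 0"
  using k
proof (induction k)
  case 0
  show ?case using f z by (intro exI[of _ f]) auto
next
  case (Suc k)
  then obtain h where h: "\<And>i. i \<in> I \<Longrightarrow> h i \<in> ring_gen (xv ` {1..n})"
    "\<And>i m. i \<in> I \<Longrightarrow> Poly_Mapping.lookup (h i) m = (\<Prod>j<k. 1 + (-1) ^ (\<epsilon> j + Poly_Mapping.lookup m (XV j))) * Poly_Mapping.lookup (f i) m"
    "(\<Sum>i\<in>I. a i * h i) = 0" by auto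
  let ?h = "\<lambda>i. h i + (-1) ^ \<epsilon> k * flip k (h i)"
  \<comment> \<open>The coefficients \<open>a i\<close> are invariant, so a sign change of the
    relation affects only the \<open>h i\<close>.\<close>
  have "sign_act k (\<Sum>i\<in>I. a i * h i) = (\<Sum>i\<in>I. a i * flip k (h i))"
    unfolding hom_simps[OF is_ring_hom_sign_act]
    by (intro sum.cong refl) (use Suc.prems sign_act_W_inv[OF a] sign_act_eq_flip[OF h(1)] in auto)
  then have z: "(\<Sum>i\<in>I. a i * flip k (h i)) = 0"
    by (simp add: h(3) hom_simps[OF is_ring_hom_sign_act])
  have "(\<Sum>i\<in>I. a i * ?h i) = (\<Sum>i\<in>I. a i * h i) + (-1) ^ \<epsilon> k * (\<Sum>i\<in>I. a i * flip k (h i))"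
    by (simp add: distrib_left sum.distrib sum_distrib_left mult.left_commute)
  then have "(\<Sum>i\<in>I. a i * ?h i) = 0" by (simp add: z h(3))
  moreover have "?h i \<in> ring_gen (xv ` {1..n})" if "i \<in> I" for i
    by (intro ring_gen_intros flip_ring_gen h(1) that)
  moreover have "Poly_Mapping.lookup (?h i) m = (\<Prod>j<Suc k. 1 + (-1) ^ (\<epsilon> j + Poly_Mapping.lookup m (XV j))) * Poly_Mapping.lookup (f i) m"
    if i: "i \<in> I" for i m
  proof -
    have sgn: "Poly_Mapping.lookup ((-1) ^ e * q) m = (-1) ^ e * Poly_Mapping.lookup q m" for e and q :: gxy
      by (cases "even e") auto
    show ?thesis
      unfolding lookup_add sgn lookup_flip h(2)[OF i]
      by (simp add: power_add algebra_simps)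
  qed
  ultimately show ?case by (intro exI[of _ ?h]) auto
qed

section \<open>Leading monomials of the elementary symmetric polynomials\<close>

definition top_mono :: "(('v \<Rightarrow>\<^sub>0 nat) \<Rightarrow> nat) \<Rightarrow> ('v, 'a::comm_ring_1) mpol \<Rightarrow> ('v \<Rightarrow>\<^sub>0 nat) \<Rightarrow> bool" where
  "top_mono wt f b \<longleftrightarrow> (\<forall>m\<in>Poly_Mapping.keys f. m \<noteq> b \<longrightarrow> wt m < wt b) \<and> (Poly_Mapping.lookup f b = 1 \<or> Poly_Mapping.lookup f b = -1)"

lemma top_mono_one: "top_mono wt 1 0"
  by (auto simp: top_mono_def)

lemma top_mono_mult:
  fixes f g :: "('v, 'a::comm_ring_1) mpol"
  assumes add: "\<And>m m'. wt (m + m') = wt m + wt m'" and f: "top_mono wt f b" and g: "top_mono wt g c"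
  shows "top_mono wt (f * g) (b + c)"
proof -
  have fb: "m \<noteq> b \<Longrightarrow> wt m < wt b" if "m \<in> Poly_Mapping.keys f" for m using f that by (auto simp: top_mono_def)
  have gc: "m \<noteq> c \<Longrightarrow> wt m < wt c" if "m \<in> Poly_Mapping.keys g" for m using g that by (auto simp: top_mono_def)
  have "Poly_Mapping.lookup (f * g) (b + c) = Poly_Mapping.lookup f b * Poly_Mapping.lookup g c"
    by (rule lookup_mult_top[where wt=wt, OF add]) (use fb gc in \<open>auto simp: le_less\<close>)
  moreover have "wt m < wt (b + c)" if m: "m \<in> Poly_Mapping.keys (f * g)" "m \<noteq> b + c" for m
  proof -
    obtain p q where pq: "m = p + q" "p \<in> Poly_Mapping.keys f" "q \<in> Poly_Mapping.keys g"
      using keys_mult[of f g] m(1) by auto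
    then have "p \<noteq> b \<or> q \<noteq> c" using m(2) by auto
    then show ?thesis using fb[OF pq(2)] gc[OF pq(3)] unfolding pq(1) add
      by (cases "p = b"; cases "q = c") auto
  qed
  ultimately show ?thesis using f g by (auto simp: top_mono_def)
qed

lemma top_mono_add:
  assumes "top_mono wt f b" "\<And>m. m \<in> Poly_Mapping.keys g \<Longrightarrow> wt m < wt b"
  shows "top_mono wt (f + g) b"
proof -
  have "b \<notin> Poly_Mapping.keys g" using assms(2) by blast
  then have "Poly_Mapping.lookup (f + g) b = Poly_Mapping.lookup f b" by (simp add: lookup_add in_keys_iff)
  then show ?thesis using assms Poly_Mapping.keys_add[of f g] by (fastforce simp: top_mono_def)
qed

text \<open>The weights n, ..., 1 on x_1, ..., x_n make x_1 ... x_p the unique heaviest monomial of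
  the p-th elementary symmetric polynomial.\<close>

definition x_weight :: "nat \<Rightarrow> (xyvar \<Rightarrow>\<^sub>0 nat) \<Rightarrow> nat" where
  "x_weight n m = (\<Sum>k<n. (n - k) * Poly_Mapping.lookup m (XV k))"

lemma x_weight_add: "x_weight n (m + m') = x_weight n m + x_weight n m'"
  unfolding x_weight_def lookup_add distrib_left sum.distrib ..

definition e_top :: "nat \<Rightarrow> (xyvar \<Rightarrow>\<^sub>0 nat)" where
  "e_top p = (\<Sum>k<p. Poly_Mapping.single (XV k) 1)"

lemma lookup_e_top: "Poly_Mapping.lookup (e_top p) (XV k) = (if k < p then 1 else 0)"
  by (simp add: e_top_def lookup_sum lookup_single when_def)

lemma x_weight_single: "k < n \<Longrightarrow> x_weight n (Poly_Mapping.single (XV k) 1) = n - k"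
  by (simp add: x_weight_def lookup_single when_def if_distrib cong: if_cong)

lemma top_mono_esn:
  assumes "m \<le> n" "p \<le> m"
  shows "top_mono (x_weight n) (esn m p) (e_top p)"
  using assms
proof (induction m arbitrary: p)
  case 0
  then show ?case by (simp add: esn_0 e_top_def top_mono_one)
next
  case (Suc m)
  let ?xm = "mvar (XV m) :: gxy" and ?s = "Poly_Mapping.single (XV m) (1::nat)"
  show ?case
  proof (cases p)
    case 0
    then show ?thesis by (simp add: esn_0 e_top_def top_mono_one)
  next
    case (Suc q)
    have rec: "esn (Suc m) (Suc q) = esn m (Suc q) + (- ?xm) * esn m q"
      using elem_sym_Suc[of m "\<lambda>i. - xv i" q] by (simp add: esn_def xv_def)
    have x: "top_mono (x_weight n) (- ?xm) ?s"
      by (auto simp: top_mono_def mvar_def)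
    have xe: "top_mono (x_weight n) (- ?xm * esn m q) (?s + e_top q)"
      using Suc.prems \<open>p = Suc q\<close> by (intro top_mono_mult x_weight_add x Suc.IH) auto
    show ?thesis
    proof (cases "Suc q \<le> m")
      case True
      have "top_mono (x_weight n) (esn m (Suc q)) (e_top (Suc q))" using True Suc.prems by (intro Suc.IH) auto
      \<comment> \<open>Exchanging x_{m+1} for the heavier x_{q+1}, q < m, bounds the terms that
        contain x_{m+1}.\<close>
      moreover have "x_weight n k < x_weight n (e_top (Suc q))" if "k \<in> Poly_Mapping.keys (- ?xm * esn m q)" for k
      proof -
        have "x_weight n k \<le> x_weight n (?s + e_top q)" using xe that by (auto simp: top_mono_def le_less)
        also have "\<dots> < x_weight n (Poly_Mapping.single (XV q) 1) + x_weight n (e_top q)"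
          using True Suc.prems by (simp del: One_nat_def add: x_weight_add x_weight_single)
        also have "\<dots> = x_weight n (e_top (Suc q))"
          by (simp add: e_top_def x_weight_add)
        finally show ?thesis .
      qed
      ultimately show ?thesis unfolding \<open>p = Suc q\<close> rec by (rule top_mono_add)
    next
      case False
      then have "q = m" using Suc.prems \<open>p = Suc q\<close> by simp
      then have "esn (Suc m) p = - ?xm * esn m q" "e_top p = ?s + e_top q"
        using rec esn_eq_0[of m "Suc q"] by (auto simp: e_top_def \<open>p = Suc q\<close> add.commute)
      then show ?thesis using xe by simp
    qed
  qed
qed

definition e_top_set :: "nat set \<Rightarrow> (xyvar \<Rightarrow>\<^sub>0 nat)" where
  "e_top_set S = (\<Sum>p\<in>S. e_top p)"

lemma top_mono_esn_prod:
  assumes "S \<subseteq> {1..n}"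
  shows "top_mono (x_weight n) (esn_prod n S) (e_top_set S)"
proof -
  have "finite S" using assms by (rule finite_subset) simp
  then show ?thesis
    using assms unfolding esn_prod_def e_top_set_def
    by induction (auto intro!: top_mono_mult x_weight_add top_mono_esn top_mono_one)
qed

lemma lookup_e_top_set: "finite S \<Longrightarrow> Poly_Mapping.lookup (e_top_set S) (XV k) = card {p \<in> S. k < p}"
  by (simp add: e_top_set_def lookup_sum lookup_e_top sum.If_cases Int_def)

text \<open>The exponent of x_p in the leading monomial counts the members from p on. At the largest
  p where S and T differ, the two exponents differ by one.\<close>

lemma e_top_set_parity:
  fixes S T :: "nat set"
  assumes S: "S \<subseteq> {1..n}" "T \<subseteq> {1..n}" and eq: "\<And>k. k < n \<Longrightarrow> even (card {p \<in> S. k < p} + card {p \<in> T. k < p})"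
  shows "S = T"
proof (rule ccontr)
  assume "S \<noteq> T"
  have fin: "finite S" "finite T" by (rule finite_subset[OF S(1) finite_atLeastAtMost], rule finite_subset[OF S(2) finite_atLeastAtMost])
  let ?D = "(S - T) \<union> (T - S)"
  have D: "finite ?D" "?D \<noteq> {}" using fin \<open>S \<noteq> T\<close> by auto
  define p where "p = Max ?D"
  have p: "p \<in> ?D" "\<And>q. q \<in> ?D \<Longrightarrow> q \<le> p" using D by (auto simp: p_def simp del: Un_iff)
  then have p1: "p \<in> {1..n}" using S by auto
  have up: "q \<in> S \<longleftrightarrow> q \<in> T" if "q > p" for q using p(2)[of q] that by auto
  have c: "card {q \<in> A. p - 1 < q} = (if p \<in> A then 1 else 0) + card {q \<in> A. p < q}" if "finite A" for A
  proof -
    have "p - 1 < q \<longleftrightarrow> q = p \<or> p < q" for q using p1 by auto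
    then have "{q \<in> A. p - 1 < q} = {q \<in> A. q = p \<or> p < q}" by (simp only:)
    also have "\<dots> = (if p \<in> A then {p} else {}) \<union> {q \<in> A. p < q}" by auto
    also have "card \<dots> = (if p \<in> A then 1 else 0) + card {q \<in> A. p < q}"
      using that by (subst card_Un_disjoint) auto
    finally show ?thesis .
  qed
  have "{q \<in> S. p < q} = {q \<in> T. p < q}" using up by auto
  then have "odd (card {q \<in> S. p - 1 < q} + card {q \<in> T. p - 1 < q})"
    unfolding c[OF fin(1)] c[OF fin(2)] using p(1) by auto
  moreover have "p - 1 < n" using p1 unfolding atLeastAtMost_iff by linarith
  ultimately show False using eq by blast
qed

lemma esn_ring_gen: "esn n p \<in> ring_gen (xv ` {1..n})"
  unfolding esn_def elem_sym_def by (intro ring_gen_intros ring_gen.gen) auto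

lemma two_power_torsion_free: "2 ^ k * a = 0 \<Longrightarrow> a = 0" for a :: gamma
  by (induction k) (auto simp: mult.assoc dest: gamma_two_torsion_free)

theorem esn_prod_independent: "independent_over (W_inv n) (Pow {1..n}) (esn_prod n)"
  unfolding independent_over_def
proof (intro allI impI, rule ccontr)
  fix a :: "nat set \<Rightarrow> gxy"
  assume a: "\<forall>S\<in>Pow {1..n}. a S \<in> W_inv n" and z: "(\<Sum>S\<in>Pow {1..n}. a S * esn_prod n S) = 0"
    and ne: "\<not> (\<forall>S\<in>Pow {1..n}. a S = 0)"
  let ?wt = "x_weight n"
  define K where "K = Sigma (Pow {1..n}) (\<lambda>S. Poly_Mapping.keys (a S))"
  obtain S where "S \<in> Pow {1..n}" "a S \<noteq> 0" using ne by blast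
  then have K: "finite K" "K \<noteq> {}" by (auto simp: K_def Sigma_empty_iff)
  \<comment> \<open>The weight is maximised over the terms of all coefficients together, since the
    coefficients contain x-variables themselves.\<close>
  obtain S0 m0 where S0: "(S0, m0) \<in> K"
    and max: "\<And>S m. (S, m) \<in> K \<Longrightarrow> ?wt m + ?wt (e_top_set S) \<le> ?wt m0 + ?wt (e_top_set S0)"
    using finite_max_element[OF K, of "\<lambda>(S, m). ?wt m + ?wt (e_top_set S)"] by fastforce
  let ?b = "e_top_set S0"
  let ?\<epsilon> = "\<lambda>k. Poly_Mapping.lookup ?b (XV k)"
  have sub: "S0 \<subseteq> {1..n}" using S0 by (auto simp: K_def)
  have fin: "finite S" if "S \<subseteq> {1..n}" for S :: "nat set" using that finite_subset by auto
  \<comment> \<open>Project onto the parities of the leading exponents of \<open>S0\<close>: a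
    monomial of this class is multiplied by 2^n, any other by 0.\<close>
  obtain h where h: "\<And>S m. S \<in> Pow {1..n} \<Longrightarrow> Poly_Mapping.lookup (h S) m
      = (\<Prod>j<n. 1 + (-1) ^ (?\<epsilon> j + Poly_Mapping.lookup m (XV j))) * Poly_Mapping.lookup (esn_prod n S) m"
    and hz: "(\<Sum>S\<in>Pow {1..n}. a S * h S) = 0"
  proof -
    have "esn_prod n S \<in> ring_gen (xv ` {1..n})" for S
      unfolding esn_prod_def by (intro ring_gen_intros esn_ring_gen)
    then show ?thesis
      using parity_part[of "Pow {1..n}" a n "esn_prod n" n ?\<epsilon>, OF _ _ z order_refl] a that by blast
  qed
  \<comment> \<open>The leading monomial of another S has different parities and is gone from
    \<open>h S\<close>; what remains is too light to reach \<open>m0 + ?b\<close>.\<close>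
  have other: "Poly_Mapping.lookup (a S * h S) (m0 + ?b) = 0" if S: "S \<in> Pow {1..n}" "S \<noteq> S0" for S
  proof -
    have "a' + b' \<noteq> m0 + ?b" if ab: "a' \<in> Poly_Mapping.keys (a S)" "b' \<in> Poly_Mapping.keys (h S)" for a' b'
    proof
      assume e: "a' + b' = m0 + ?b"
      have b': "b' \<in> Poly_Mapping.keys (esn_prod n S)" using ab(2) h[OF S(1), of b'] by (auto simp: in_keys_iff)
      have "b' \<noteq> e_top_set S"
      proof
        assume b: "b' = e_top_set S"
        obtain k where k: "k < n" "odd (card {p \<in> S0. k < p} + card {p \<in> S. k < p})"
          using e_top_set_parity[OF sub, of S] S by blast
        have "1 + (-1) ^ (?\<epsilon> k + Poly_Mapping.lookup b' (XV k)) = (0 :: gamma)"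
          using k(2) S sub fin by (simp add: b lookup_e_top_set)
        then have "(\<Prod>j<n. 1 + (-1) ^ (?\<epsilon> j + Poly_Mapping.lookup b' (XV j))) = (0 :: gamma)"
          using k(1) by (intro prod_zero) auto
        then show False using ab(2) h[OF S(1), of b'] by (simp add: in_keys_iff)
      qed
      then have "?wt b' < ?wt (e_top_set S)"
        using top_mono_esn_prod[of S n] S b' by (auto simp: top_mono_def)
      moreover have "?wt a' + ?wt (e_top_set S) \<le> ?wt m0 + ?wt ?b"
        using max[of S a'] ab S by (auto simp: K_def)
      moreover have "?wt a' + ?wt b' = ?wt m0 + ?wt ?b" using e by (metis x_weight_add)
      ultimately show False by linarith
    qed
    then show ?thesis unfolding lookup_mult_keys by (intro sum.neutral ballI) auto
  qed
  have S0': "S0 \<in> Pow {1..n}" using sub by simp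
  have top: "Poly_Mapping.lookup (a S0 * h S0) (m0 + ?b) = Poly_Mapping.lookup (a S0) m0 * Poly_Mapping.lookup (h S0) ?b"
  proof (rule lookup_mult_top[where wt="?wt", OF x_weight_add])
    show "?wt m \<le> ?wt m0" if "m \<in> Poly_Mapping.keys (a S0)" for m
      using max[of S0 m] that S0' by (auto simp: K_def)
    show "?wt m < ?wt ?b" if "m \<in> Poly_Mapping.keys (h S0)" "m \<noteq> ?b" for m
    proof -
      have "m \<in> Poly_Mapping.keys (esn_prod n S0)" using that(1) h[OF S0', of m] by (auto simp: in_keys_iff)
      then show ?thesis using top_mono_esn_prod[OF sub] that(2) by (auto simp: top_mono_def)
    qed
  qed
  \<comment> \<open>Every factor is 1 + 1 on the leading monomial of \<open>S0\<close>; the power of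
    2 is cancelled in Gamma.\<close>
  have "(\<Prod>j<n. 1 + (-1) ^ (?\<epsilon> j + ?\<epsilon> j)) = (2 ^ n :: gamma)" by simp
  then have hb: "Poly_Mapping.lookup (h S0) ?b = 2 ^ n * Poly_Mapping.lookup (esn_prod n S0) ?b"
    using h[OF S0', of ?b] by simp
  have "0 = Poly_Mapping.lookup (\<Sum>S\<in>Pow {1..n}. a S * h S) (m0 + ?b)" by (simp only: hz lookup_zero)
  also have "\<dots> = Poly_Mapping.lookup (a S0 * h S0) (m0 + ?b)"
    unfolding lookup_sum by (subst sum.remove[of _ S0]) (use other S0' in \<open>auto intro!: sum.neutral\<close>)
  finally have "2 ^ n * (Poly_Mapping.lookup (esn_prod n S0) ?b * Poly_Mapping.lookup (a S0) m0) = 0"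
    unfolding top hb by (simp add: mult_ac)
  then have "Poly_Mapping.lookup (esn_prod n S0) ?b * Poly_Mapping.lookup (a S0) m0 = 0"
    by (rule two_power_torsion_free)
  then have "Poly_Mapping.lookup (a S0) m0 = 0"
    using top_mono_esn_prod[OF sub] by (auto simp: top_mono_def)
  then show False using S0 by (auto simp: K_def in_keys_iff)
qed

text \<open>s_0 turns the factor 1 + x_1 t of e(t) into 1 - x_1 t and multiplies c(t) by (1 + x_1 t)
  / (1 - x_1 t), so e(t) c(t) does not change.\<close>

lemma s_act_0_nc:
  assumes "n \<ge> 1"
  shows "s_act 0 (nc n p) = nc n p"
proof -
  let ?x = "xv 1"
  let ?t = "fps_const ?x * fps_X"
  have nth: "fps_nth (A * (1 + fps_const c * fps_X)) k = fps_nth A k + (if k = 0 then 0 else c * fps_nth A (k - 1))" for A :: "gxy fps" and c k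
  proof -
    have "A * (1 + fps_const c * fps_X) = A + fps_X * (fps_const c * A)" by (simp add: algebra_simps)
    then show ?thesis by (simp only: fps_add_nth fps_X_mult_nth fps_mult_left_const_nth)
  qed
  have s0c: "Abs_fps s0c * (1 + fps_const (- ?x) * fps_X) = Abs_fps cc * (1 + fps_const ?x * fps_X)"
  proof (rule fps_ext)
    fix k
    show "fps_nth (Abs_fps s0c * (1 + fps_const (- ?x) * fps_X)) k = fps_nth (Abs_fps cc * (1 + fps_const ?x * fps_X)) k"
      unfolding nth using s0c_Suc[of "k - 1"] by (cases k) (simp_all add: s0c_0 cc_0)
  qed
  let ?P = "\<Prod>i=2..n. 1 + fps_const (xv i) * fps_X"
  have e: "Abs_fps (esp n) = (1 + fps_const ?x * fps_X) * ?P"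
    using elem_sym_fps[of n xv] assms by (simp add: esp_def[abs_def] prod.atLeast_Suc_atMost numeral_2_eq_2)
  have se: "Abs_fps (\<lambda>p. s_act 0 (esp n p)) = (1 + fps_const (- ?x) * fps_X) * ?P"
  proof -
    have "s_act 0 (esp n p) = elem_sym n (\<lambda>i. s_act 0 (xv i)) (int p)" for p
      by (simp add: esp_def elem_sym_def s_act_hom)
    then have "Abs_fps (\<lambda>p. s_act 0 (esp n p)) = (\<Prod>i=1..n. 1 + fps_const (s_act 0 (xv i)) * fps_X)"
      using elem_sym_fps[of n "\<lambda>i. s_act 0 (xv i)"] by simp
    also have "\<dots> = (1 + fps_const (s_act 0 ?x) * fps_X) * (\<Prod>i=2..n. 1 + fps_const (s_act 0 (xv i)) * fps_X)"
      using assms by (simp add: prod.atLeast_Suc_atMost numeral_2_eq_2)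
    also have "(\<Prod>i=2..n. 1 + fps_const (s_act 0 (xv i)) * fps_X) = ?P"
      by (intro prod.cong) (auto simp: s_act_simps)
    finally show ?thesis by (simp add: s_act_simps)
  qed
  have "Abs_fps (\<lambda>p. s_act 0 (nc n p)) = Abs_fps (\<lambda>p. s_act 0 (esp n p)) * Abs_fps s0c"
    by (rule fps_ext) (simp add: fps_mult_nth nc_esp s_act_hom s_act_simps)
  also have "\<dots> = (Abs_fps s0c * (1 + fps_const (- ?x) * fps_X)) * ?P" unfolding se by (simp only: mult_ac)
  also have "\<dots> = Abs_fps (nc n)" unfolding s0c nc_fps e by (simp only: mult_ac)
  finally show ?thesis by (simp add: fps_eq_iff)
qed

lemma is_subring_W_inv: "is_subring (W_inv n)"
  unfolding is_subring_def W_inv_def ddx_eq_0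
  using subring_intros(1,3,4)[OF is_subring_GX] by (auto simp: s_act_hom)

lemma Gamma_n_W_inv: "Gamma_n n \<subseteq> W_inv n"
  unfolding Gamma_n_eq
proof (rule ring_gen_subset[OF is_subring_W_inv])
  have "s_act i (nc n p) = nc n p" if "i < n" for i p
  proof (cases "i = 0")
    case True then show ?thesis using s_act_0_nc[of n p] that by simp
  next
    case False
    then show ?thesis
      using that by (simp add: nc_esp esp_esn s_act_hom s_act_simps s_act_esn)
  qed
  moreover have "nc n p \<in> GX n" for p
    unfolding nc_esp esp_esn by (intro subring_intros[OF is_subring_GX] GX_cc esn_GX)
  ultimately show "range (\<lambda>k. nc n (Suc k)) \<subseteq> W_inv n"
    by (auto simp: W_inv_def ddx_eq_0)
qed

theorem esn_prod_basis: "free_with_basis (Gamma_n n) (GX_sym n) (Pow {1..n}) (esn_prod n)"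
  unfolding free_with_basis_iff
proof (intro conjI)
  have e: "esn n p \<in> GX_sym n" for p
    unfolding GX_sym_eq sym_gen_def by (auto intro: ring_gen.gen)
  show "Gamma_n n \<subseteq> GX_sym n"
    using Gamma_n_W_inv[of n] by (auto simp: W_inv_def GX_sym_eq_Inv)
  show "esn_prod n ` Pow {1..n} \<subseteq> GX_sym n"
    unfolding esn_prod_def by (auto intro!: subring_prod[OF is_subring_GX_sym] e)
  show "independent_over (Gamma_n n) (Pow {1..n}) (esn_prod n)"
    using esn_prod_independent[of n] Gamma_n_W_inv[of n] unfolding independent_over_def by blast
qed (use is_subring_Gamma_n is_subring_GX_sym GX_sym_span in auto)

theorem W_inv_eq: "W_inv n = Gamma_n n"
proof
  show "Gamma_n n \<subseteq> W_inv n" by (rule Gamma_n_W_inv)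
  show "W_inv n \<subseteq> Gamma_n n"
  proof
    fix f assume f: "f \<in> W_inv n"
    then have "f \<in> GX_sym n" by (auto simp: W_inv_def GX_sym_eq_Inv)
    then obtain a where a: "a \<in> Pow {1..n} \<rightarrow> Gamma_n n" "f = (\<Sum>S\<in>Pow {1..n}. a S * esn_prod n S)"
      using GX_sym_span[of n] rspan_family[OF _ is_subring_Gamma_n, of f n "esn_prod n" "Pow {1..n}"] by auto
    \<comment> \<open>f is also f times the empty product. Independence over the invariants, where f
      itself is a scalar, compares this with the expansion over Gamma^(n).\<close>
    let ?a = "\<lambda>S. a S - (if S = {} then f else 0)"
    have "(\<Sum>S\<in>Pow {1..n}. ?a S * esn_prod n S) = f - (\<Sum>S\<in>Pow {1..n}. if S = {} then f * esn_prod n S else 0)"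
      unfolding a(2) sum_subtractf[symmetric] by (intro sum.cong) (auto simp: left_diff_distrib)
    also have "\<dots> = 0" by (simp add: esn_prod_def)
    finally have "?a {} = 0"
      by (intro independent_overD[OF esn_prod_independent, of n ?a])
         (use a Gamma_n_W_inv[of n] f in \<open>auto intro!: subring_diff[OF is_subring_W_inv] subring_zero[OF is_subring_W_inv]\<close>)
    then show "f \<in> Gamma_n n" using a(1) by auto
  qed
qed

section \<open>The polynomials \<open>Q\<close>-tilde\<close>

lemma elem_sym_neg: "q < 0 \<Longrightarrow> elem_sym n z q = 0"
proof -
  assume "q < 0"
  then have "{S. S \<subseteq> {1..n} \<and> int (card S) = q} = {}" by auto
  then show ?thesis unfolding elem_sym_def by (simp only: sum.empty)
qed

lemma elem_sym_esn: "q \<ge> 0 \<Longrightarrow> elem_sym n (\<lambda>i. - xv i) q = esn n (nat q)"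
  by (simp add: esn_def)

text \<open>Each R_ij moves a unit from position j to position i and contributes c_i - c_j. Constant
  weights give the sum of the entries, weights 2 \<mu>_i the sum of squares, and decreasing weights
  the finiteness of the expansion.\<close>

lemma raised_weighted_sum:
  fixes c :: "nat \<Rightarrow> int"
  shows "(\<Sum>i<length \<mu>. c i * raised k \<mu> i) = (\<Sum>i<length \<mu>. c i * int (\<mu> ! i))
    + (\<Sum>i<length \<mu>. \<Sum>j\<in>{i<..<length \<mu>}. (c i - c j) * int (Poly_Mapping.lookup k (i, j)))"
proof -
  let ?l = "length \<mu>" and ?k = "\<lambda>i j. int (Poly_Mapping.lookup k (i, j))"
  have swap: "(\<Sum>i<?l. \<Sum>j<i. c i * ?k j i) = (\<Sum>i<?l. \<Sum>j\<in>{i<..<?l}. c j * ?k i j)"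
  proof -
    have "(\<Sum>i<?l. \<Sum>j<i. c i * ?k j i) = (\<Sum>(i, j)\<in>Sigma {..<?l} (\<lambda>i. {..<i}). c i * ?k j i)"
      by (rule sum.Sigma) auto
    also have "\<dots> = (\<Sum>(i, j)\<in>Sigma {..<?l} (\<lambda>i. {i<..<?l}). c j * ?k i j)"
      by (rule sum.reindex_bij_witness[of _ "\<lambda>(i, j). (j, i)" "\<lambda>(i, j). (j, i)"]) auto
    also have "\<dots> = (\<Sum>i<?l. \<Sum>j\<in>{i<..<?l}. c j * ?k i j)"
      by (rule sum.Sigma[symmetric]) auto
    finally show ?thesis .
  qed
  have "(\<Sum>i<?l. c i * raised k \<mu> i) = (\<Sum>i<?l. c i * int (\<mu> ! i)) + (\<Sum>i<?l. \<Sum>j\<in>{i<..<?l}. c i * ?k i j)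
      - (\<Sum>i<?l. \<Sum>j<i. c i * ?k j i)"
    unfolding raised_def by (simp add: algebra_simps sum.distrib sum_subtractf sum_distrib_left)
  also have "\<dots> = (\<Sum>i<?l. c i * int (\<mu> ! i)) + (\<Sum>i<?l. \<Sum>j\<in>{i<..<?l}. (c i - c j) * ?k i j)"
    unfolding swap by (simp add: left_diff_distrib sum_subtractf)
  finally show ?thesis .
qed

definition upper_pairs :: "nat \<Rightarrow> (nat \<times> nat) set" where
  "upper_pairs l = {(i, j). i < j \<and> j < l}"

lemma finite_upper_pairs: "finite (upper_pairs l)"
  by (rule finite_subset[of _ "{..<l} \<times> {..<l}"]) (auto simp: upper_pairs_def)

lemma finite_bounded_poly_mapping:
  assumes "finite P"
  shows "finite {k :: 'b \<Rightarrow>\<^sub>0 nat. Poly_Mapping.keys k \<subseteq> P \<and> (\<forall>r\<in>P. Poly_Mapping.lookup k r \<le> B)}" (is "finite ?F")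
proof (rule finite_imageD)
  let ?f = "\<lambda>k :: 'b \<Rightarrow>\<^sub>0 nat. restrict (Poly_Mapping.lookup k) P"
  have "?f ` ?F \<subseteq> P \<rightarrow>\<^sub>E {..B}" by auto
  then show "finite (?f ` ?F)" by (rule finite_subset) (auto intro: finite_PiE assms)
  show "inj_on ?f ?F"
  proof (rule inj_onI)
    fix k l assume k: "k \<in> ?F" and l: "l \<in> ?F" and e: "?f k = ?f l"
    show "k = l"
    proof (rule poly_mapping_eqI)
      fix r
      show "Poly_Mapping.lookup k r = Poly_Mapping.lookup l r"
      proof (cases "r \<in> P")
        case True then show ?thesis using fun_cong[OF e, of r] by simp
      next
        case False
        then have "r \<notin> Poly_Mapping.keys k" "r \<notin> Poly_Mapping.keys l" using k l by auto
        then show ?thesis by (simp add: in_keys_iff)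
      qed
    qed
  qed
qed

definition Q_term :: "nat \<Rightarrow> nat list \<Rightarrow> (nat \<times> nat \<Rightarrow>\<^sub>0 nat) \<Rightarrow> gxy" where
  "Q_term n \<mu> k = (if Poly_Mapping.keys k \<subseteq> upper_pairs (length \<mu>)
     then (\<Prod>r\<in>Poly_Mapping.keys k. 2 * (-1) ^ Poly_Mapping.lookup k r)
          * (\<Prod>i<length \<mu>. elem_sym n (\<lambda>i. - xv i) (raised k \<mu> i))
     else 0)"

lemma Q_term_nonzero:
  assumes "Q_term n \<mu> k \<noteq> 0" "i < length \<mu>"
  shows "0 \<le> raised k \<mu> i" "raised k \<mu> i \<le> int n"
proof -
  have ne: "elem_sym n (\<lambda>i. - xv i) (raised k \<mu> i) \<noteq> 0"
  proof
    assume "elem_sym n (\<lambda>i. - xv i) (raised k \<mu> i) = 0"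
    then have "(\<Prod>i<length \<mu>. elem_sym n (\<lambda>i. - xv i) (raised k \<mu> i)) = 0"
      using assms(2) by (intro prod_zero) auto
    then have "Q_term n \<mu> k = 0" unfolding Q_term_def by (simp only: mult_zero_right if_cancel)
    then show False using assms(1) by blast
  qed
  then show "0 \<le> raised k \<mu> i" using elem_sym_neg[of "raised k \<mu> i" n] by force
  then show "raised k \<mu> i \<le> int n"
    using ne elem_sym_esn[of "raised k \<mu> i" n] esn_eq_0[of n "nat (raised k \<mu> i)"] by force
qed

text \<open>A \<open>Sum_any\<close> of infinite support is 0, so finiteness gives
  \<open>Qtilde\<close> its meaning. With the strictly decreasing weights l - i each exponent is
  bounded by the weighted sum of the raised entries, which lie in 0..n.\<close>

lemma finite_Q_term: "finite {k. Q_term n \<mu> k \<noteq> 0}"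
proof -
  let ?l = "length \<mu>" and ?B = "length \<mu> * (length \<mu> * n)"
  have "{k. Q_term n \<mu> k \<noteq> 0} \<subseteq> {k. Poly_Mapping.keys k \<subseteq> upper_pairs ?l \<and> (\<forall>r\<in>upper_pairs ?l. Poly_Mapping.lookup k r \<le> ?B)}"
  proof clarify
    fix k assume k: "Q_term n \<mu> k \<noteq> 0"
    show "Poly_Mapping.keys k \<subseteq> upper_pairs ?l \<and> (\<forall>r\<in>upper_pairs ?l. Poly_Mapping.lookup k r \<le> ?B)"
    proof (intro conjI ballI)
      show "Poly_Mapping.keys k \<subseteq> upper_pairs ?l" using k by (auto simp: Q_term_def split: if_splits)
      fix r assume r: "r \<in> upper_pairs ?l"
      obtain a b where ab: "r = (a, b)" "a < b" "b < ?l" using r by (auto simp: upper_pairs_def)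
      let ?c = "\<lambda>i. int (?l - i)"
      let ?k = "\<lambda>i j. (?c i - ?c j) * int (Poly_Mapping.lookup k (i, j))"
      have nn: "0 \<le> ?k i j" if "i < ?l" "j \<in> {i<..<?l}" for i j using that by (intro mult_nonneg_nonneg) auto
      have "int (Poly_Mapping.lookup k r) \<le> ?k a b"
      proof -
        have "1 * int (Poly_Mapping.lookup k (a, b)) \<le> ?k a b"
          using ab by (intro mult_right_mono) auto
        then show ?thesis using ab by simp
      qed
      also have "\<dots> \<le> (\<Sum>j\<in>{a<..<?l}. ?k a j)"
        using ab nn[of a] by (intro member_le_sum) auto
      also have "\<dots> \<le> (\<Sum>i<?l. \<Sum>j\<in>{i<..<?l}. ?k i j)"
        using ab by (intro member_le_sum[of a]) (auto intro!: sum_nonneg nn)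
      also have "\<dots> \<le> (\<Sum>i<?l. ?c i * raised k \<mu> i)"
        unfolding raised_weighted_sum[where c="?c"] by (auto intro!: sum_nonneg)
      also have "\<dots> \<le> (\<Sum>i<?l. int ?l * int n)"
        using Q_term_nonzero[OF k] by (intro sum_mono mult_mono) auto
      also have "\<dots> = int ?B" by simp
      finally show "Poly_Mapping.lookup k r \<le> ?B" by linarith
    qed
  qed
  then show ?thesis by (rule finite_subset) (intro finite_bounded_poly_mapping finite_upper_pairs)
qed

lemma Qtilde_sum: "Qtilde n (\<lambda>i. - xv i) \<mu> - Q_term n \<mu> 0 = (\<Sum>k\<in>{k. Q_term n \<mu> k \<noteq> 0} - {0}. Q_term n \<mu> k)"
proof -
  have "Qtilde n (\<lambda>i. - xv i) \<mu> = Sum_any (Q_term n \<mu>)"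
    by (simp add: Qtilde_def Q_term_def[abs_def] upper_pairs_def)
  also have "\<dots> = (\<Sum>k\<in>{k. Q_term n \<mu> k \<noteq> 0}. Q_term n \<mu> k)" by (rule Sum_any.expand_set)
  also have "\<dots> = Q_term n \<mu> 0 + (\<Sum>k\<in>{k. Q_term n \<mu> k \<noteq> 0} - {0}. Q_term n \<mu> k)"
  proof (cases "Q_term n \<mu> 0 = 0")
    case False
    then show ?thesis using finite_Q_term[of n \<mu>] by (intro sum.remove) auto
  qed simp
  finally show ?thesis by simp
qed

context
  fixes n :: nat and \<mu> :: "nat list"
  assumes \<mu>: "\<mu> \<in> strict_parts n"
begin

lemma strict_decreasing: "i < j \<Longrightarrow> j < length \<mu> \<Longrightarrow> \<mu> ! j < \<mu> ! i"
  using \<mu> by (auto simp: strict_parts_def sorted_wrt_iff_nth_less)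

lemma strict_distinct: "distinct \<mu>"
  unfolding distinct_conv_nth using strict_decreasing by (metis less_irrefl linorder_neqE_nat)

lemma Q_term_zero: "Q_term n \<mu> 0 = esn_prod n (set \<mu>)"
proof -
  have "Q_term n \<mu> 0 = (\<Prod>i<length \<mu>. esn n (\<mu> ! i))"
    by (simp add: Q_term_def raised_def elem_sym_esn)
  also have "\<dots> = esn_prod n (set \<mu>)"
    unfolding esn_prod_def by (rule prod.reindex_bij_betw[OF bij_betw_nth[OF strict_distinct]]) auto
  finally show ?thesis .
qed

text \<open>Let \<alpha> be the raised vector. Then |\<alpha>|^2 = |\<mu>|^2 + |\<alpha> - \<mu>|^2
  + 2 <\<mu>, \<alpha> - \<mu>>, where the inner product is the sum of the (\<mu>_i - \<mu>_j) k_ij,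
  positive because \<mu> decreases strictly. At fixed sum the squares grow, so the measure drops,
  and straightening only lowers it further or keeps it.\<close>

lemma Q_term_lower:
  assumes k: "Q_term n \<mu> k \<noteq> 0" "k \<noteq> 0"
  shows "Q_term n \<mu> k \<in> rspan (Gamma_n n)
    (esn_prod n ` {S \<in> Pow {1..n}. str_measure (mset_set S) < str_measure (mset_set (set \<mu>))})"
proof -
  let ?l = "length \<mu>" and ?\<alpha> = "raised k \<mu>"
  let ?d = "\<lambda>i j. int (Poly_Mapping.lookup k (i, j))"
  note nn = Q_term_nonzero(1)[OF k(1)]
  define M where "M = image_mset (\<lambda>i. nat (?\<alpha> i)) (mset_set {..<?l})"
  have keys: "Poly_Mapping.keys k \<subseteq> upper_pairs ?l" using k(1) by (auto simp: Q_term_def split: if_splits)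
  have "Poly_Mapping.keys k \<noteq> {}" using k(2) by simp
  then obtain a b where ab: "(a, b) \<in> Poly_Mapping.keys k" by fast
  have "(a, b) \<in> upper_pairs ?l" using ab keys by blast
  then have ab': "a < b" "b < ?l" "Poly_Mapping.lookup k (a, b) > 0" using ab by (auto simp: upper_pairs_def in_keys_iff)
  have sum\<mu>: "sum_mset (mset_set (set \<mu>)) = (\<Sum>i<?l. \<mu> ! i)"
    "(\<Sum>p\<in>#mset_set (set \<mu>). p ^ 2) = (\<Sum>i<?l. (\<mu> ! i) ^ 2)"
  proof -
    have m: "mset_set (set \<mu>) = image_mset ((!) \<mu>) (mset_set {..<?l})"
      using image_mset_mset_set[OF bij_betw_imp_inj_on[OF bij_betw_nth[OF strict_distinct refl refl]]]
        bij_betw_imp_surj_on[OF bij_betw_nth[OF strict_distinct refl refl]] by simp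
    show "sum_mset (mset_set (set \<mu>)) = (\<Sum>i<?l. \<mu> ! i)" "(\<Sum>p\<in>#mset_set (set \<mu>). p ^ 2) = (\<Sum>i<?l. (\<mu> ! i) ^ 2)"
      unfolding m by (simp_all add: sum_unfold_sum_mset image_mset.compositionality comp_def)
  qed
  have "str_measure M < str_measure (mset_set (set \<mu>))"
  proof (rule str_measure_less_square)
    have "sum_mset M = (\<Sum>i<?l. nat (?\<alpha> i))" unfolding M_def sum_unfold_sum_mset ..
    then have "int (sum_mset M) = (\<Sum>i<?l. 1 * ?\<alpha> i)" by (simp add: nn)
    also have "\<dots> = (\<Sum>i<?l. 1 * int (\<mu> ! i))" unfolding raised_weighted_sum by simp
    also have "\<dots> = int (\<Sum>i<?l. \<mu> ! i)" by simp
    finally show "sum_mset M = sum_mset (mset_set (set \<mu>))" unfolding sum\<mu> by (simp only: of_nat_eq_iff)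
    have "(\<Sum>i<?l. (?\<alpha> i)\<^sup>2) = (\<Sum>i<?l. 2 * int (\<mu> ! i) * ?\<alpha> i) - (\<Sum>i<?l. (int (\<mu> ! i))\<^sup>2) + (\<Sum>i<?l. (?\<alpha> i - int (\<mu> ! i))\<^sup>2)"
      unfolding sum.distrib[symmetric] sum_subtractf[symmetric]
      by (intro sum.cong) (simp_all add: power2_eq_square algebra_simps)
    also have "(\<Sum>i<?l. 2 * int (\<mu> ! i) * ?\<alpha> i) = (\<Sum>i<?l. 2 * int (\<mu> ! i) * int (\<mu> ! i))
        + (\<Sum>i<?l. \<Sum>j\<in>{i<..<?l}. (2 * int (\<mu> ! i) - 2 * int (\<mu> ! j)) * ?d i j)"
      by (rule raised_weighted_sum)
    also have "(\<Sum>i<?l. 2 * int (\<mu> ! i) * int (\<mu> ! i)) = 2 * (\<Sum>i<?l. (int (\<mu> ! i))\<^sup>2)"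
      by (simp add: sum_distrib_left power2_eq_square mult.assoc)
    finally have "(\<Sum>i<?l. (?\<alpha> i)\<^sup>2) = (\<Sum>i<?l. (int (\<mu> ! i))\<^sup>2) + (\<Sum>i<?l. (?\<alpha> i - int (\<mu> ! i))\<^sup>2)
        + (\<Sum>i<?l. \<Sum>j\<in>{i<..<?l}. (2 * int (\<mu> ! i) - 2 * int (\<mu> ! j)) * ?d i j)" by simp
    moreover have "0 \<le> (\<Sum>i<?l. (?\<alpha> i - int (\<mu> ! i))\<^sup>2)" by (intro sum_nonneg) simp
    moreover have "0 < (\<Sum>i<?l. \<Sum>j\<in>{i<..<?l}. (2 * int (\<mu> ! i) - 2 * int (\<mu> ! j)) * ?d i j)"
    proof -
      let ?t = "\<lambda>i j. (2 * int (\<mu> ! i) - 2 * int (\<mu> ! j)) * ?d i j"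
      have t: "0 \<le> ?t i j" if "i < ?l" "j \<in> {i<..<?l}" for i j
        using strict_decreasing[of i j] that by (intro mult_nonneg_nonneg) auto
      have "0 < ?t a b" using strict_decreasing[OF ab'(1,2)] ab'(3) by (intro mult_pos_pos) auto
      also have "\<dots> \<le> (\<Sum>j\<in>{a<..<?l}. ?t a j)" using ab' t[of a] by (intro member_le_sum) auto
      also have "\<dots> \<le> (\<Sum>i<?l. \<Sum>j\<in>{i<..<?l}. ?t i j)"
        using ab' by (intro member_le_sum[of a]) (auto intro!: sum_nonneg t)
      finally show ?thesis .
    qed
    ultimately have "(\<Sum>i<?l. (int (\<mu> ! i))\<^sup>2) < (\<Sum>i<?l. (?\<alpha> i)\<^sup>2)" by linarith
    moreover have "(\<Sum>p\<in>#M. p ^ 2) = (\<Sum>i<?l. (nat (?\<alpha> i)) ^ 2)"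
      unfolding M_def sum_unfold_sum_mset image_mset.compositionality comp_def ..
    then have "int (\<Sum>p\<in>#M. p ^ 2) = (\<Sum>i<?l. (?\<alpha> i)\<^sup>2)" by (simp add: nn)
    ultimately have "int (\<Sum>i<?l. (\<mu> ! i)\<^sup>2) < int (\<Sum>p\<in>#M. p ^ 2)" by simp
    then show "(\<Sum>p\<in>#mset_set (set \<mu>). p ^ 2) < (\<Sum>p\<in>#M. p ^ 2)" unfolding sum\<mu> by linarith
  qed
  then have "rspan (Gamma_n n) (esn_prod n ` {S \<in> Pow {1..n}. str_measure (mset_set S) \<le> str_measure M})
     \<subseteq> rspan (Gamma_n n) (esn_prod n ` {S \<in> Pow {1..n}. str_measure (mset_set S) < str_measure (mset_set (set \<mu>))})"
    by (intro rspan_mono) auto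
  then have M: "(\<Prod>p\<in>#M. esn n p) \<in> rspan (Gamma_n n) (esn_prod n ` {S \<in> Pow {1..n}. str_measure (mset_set S) < str_measure (mset_set (set \<mu>))})"
    using esn_prod_mset[of n M] by blast
  have "(\<Prod>i<?l. elem_sym n (\<lambda>i. - xv i) (?\<alpha> i)) = (\<Prod>p\<in>#M. esn n p)"
    unfolding M_def by (simp add: image_mset.compositionality comp_def prod_unfold_prod_mset[symmetric] elem_sym_esn nn)
  then have "Q_term n \<mu> k = (\<Prod>r\<in>Poly_Mapping.keys k. 2 * (-1) ^ Poly_Mapping.lookup k r) * (\<Prod>p\<in>#M. esn n p)"
    using keys by (simp add: Q_term_def)
  then show ?thesis
    using M by (auto intro!: rspan_scale[OF is_subring_Gamma_n] subring_intros[OF is_subring_Gamma_n])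
qed

lemma Qtilde_lower: "Qtilde n (\<lambda>i. - xv i) \<mu> - esn_prod n (set \<mu>) \<in> rspan (Gamma_n n)
    (esn_prod n ` {S \<in> Pow {1..n}. str_measure (mset_set S) < str_measure (mset_set (set \<mu>))})"
  unfolding Q_term_zero[symmetric] Qtilde_sum by (intro rspan_sum Q_term_lower) auto

end

lemma bij_betw_strict_parts: "bij_betw set (strict_parts n) (Pow {1..n})"
proof (rule bij_betwI')
  fix \<mu> \<nu> assume "\<mu> \<in> strict_parts n" "\<nu> \<in> strict_parts n"
  then have "sorted_wrt (<) (rev \<mu>)" "sorted_wrt (<) (rev \<nu>)" by (auto simp: strict_parts_def sorted_wrt_rev)
  then show "set \<mu> = set \<nu> \<longleftrightarrow> \<mu> = \<nu>"
    using strict_sorted_equal[of "rev \<mu>" "rev \<nu>"] by auto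
next
  fix \<mu> assume "\<mu> \<in> strict_parts n"
  then show "set \<mu> \<in> Pow {1..n}" by (simp add: strict_parts_def)
next
  fix S :: "nat set" assume S: "S \<in> Pow {1..n}"
  then have "finite S" using finite_subset by auto
  then have "rev (sorted_list_of_set S) \<in> strict_parts n" "set (rev (sorted_list_of_set S)) = S"
    using S by (auto simp: strict_parts_def sorted_wrt_rev)
  then show "\<exists>\<mu>\<in>strict_parts n. S = set \<mu>" by blast
qed

theorem Qtilde_basis: "free_with_basis (Gamma_n n) (GX_sym n) (strict_parts n) (Qtilde n (\<lambda>i. - xv i))"
  by (rule free_with_basis_unitriangular[OF esn_prod_basis bij_betw_strict_parts, where \<mu>="\<lambda>S. str_measure (mset_set S)"])
     (rule Qtilde_lower)

section \<open>Elements of \<open>\<Gamma>\<close> invariant under \<open>s\<^sub>0\<close>\<close>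

definition squarefree_sum :: "nat set set \<Rightarrow> (nat set \<Rightarrow> int) \<Rightarrow> gamma" where
  "squarefree_sum F c = (\<Sum>S\<in>F. of_int (c S) * prod gc S)"

definition index_family :: "nat set set \<Rightarrow> bool" where
  "index_family F \<longleftrightarrow> finite F \<and> (\<forall>S\<in>F. finite S \<and> 0 \<notin> S)"

text \<open>\<open>straighten\<close> over the integers: in Gamma the relations have the value 0,
  which is an integer.\<close>

lemma gamma_squarefree: "\<exists>F c. index_family F \<and> g = squarefree_sum F c"
proof -
  let ?R = "range of_int :: gamma set" and ?B = "{prod gc S | S. finite S \<and> 0 \<notin> S}"
  have R: "is_subring ?R"
    by (rule is_subring_range_of_int)
  have mset: "(\<Prod>p\<in>#M. gc p) \<in> rspan ?R ?B" for M
  proof -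
    have "(\<Prod>p\<in>#M. gc p) \<in> rspan ?R {prod gc S | S. finite S \<and> 0 \<notin> S \<and> str_measure (mset_set S) \<le> str_measure M}"
      by (rule straighten[where a = gc, OF R gc_0]) (simp add: Grel_gc subring_zero[OF R])
    also have "\<dots> \<subseteq> rspan ?R ?B" by (rule rspan_mono) auto
    finally show ?thesis .
  qed
  have "is_subring (rspan ?R ?B)"
    by (rule rspan_products_subring[OF R _ mset]) auto
  then have "ring_gen (range gc) \<subseteq> rspan ?R ?B"
  proof (rule ring_gen_subset)
    have "gc p \<in> rspan ?R ?B" for p using mset[of "{#p#}"] by simp
    then show "range gc \<subseteq> rspan ?R ?B" by blast
  qed
  then have "g \<in> rspan ?R ?B" using gamma_ring_gen by blast
  then show ?thesis
  proof induction
    case zero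
    show ?case by (intro exI[of _ "{}"]) (simp add: squarefree_sum_def index_family_def)
  next
    case (step x r b)
    then obtain F c S z where F: "index_family F" "x = squarefree_sum F c"
      and S: "b = prod gc S" "finite S" "0 \<notin> S" and z: "r = of_int z" by blast
    let ?c = "\<lambda>T. (if T \<in> F then c T else 0) + (if T = S then z else 0)"
    have fin: "finite F" using F by (simp add: index_family_def)
    have "squarefree_sum (insert S F) ?c = (\<Sum>T\<in>insert S F. (if T \<in> F then of_int (c T) * prod gc T else 0))
        + (\<Sum>T\<in>insert S F. (if T = S then of_int z * prod gc T else 0))"
      unfolding squarefree_sum_def sum.distrib[symmetric]
      by (intro sum.cong refl) (auto simp: distrib_right)
    also have "(\<Sum>T\<in>insert S F. (if T \<in> F then of_int (c T) * prod gc T else 0)) = x"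
      unfolding F(2) squarefree_sum_def using fin by (intro sum.mono_neutral_cong_right) auto
    also have "(\<Sum>T\<in>insert S F. (if T = S then of_int z * prod gc T else 0)) = r * b"
      using fin by (simp add: z S(1))
    finally have "x + r * b = squarefree_sum (insert S F) ?c" ..
    moreover have "index_family (insert S F)" using F S by (auto simp: index_family_def)
    ultimately show ?case by blast
  qed
qed

definition index_mono :: "nat set \<Rightarrow> (nat \<Rightarrow>\<^sub>0 nat)" where
  "index_mono S = (\<Sum>p\<in>S. Poly_Mapping.single (p - 1) 1)"

lemma lookup_index_mono:
  assumes "finite S" "0 \<notin> S"
  shows "Poly_Mapping.lookup (index_mono S) k = (if Suc k \<in> S then 1 else 0)"
proof -
  have "Poly_Mapping.lookup (index_mono S) k = (\<Sum>p\<in>S. if p = Suc k then 1 else 0)"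
    unfolding index_mono_def lookup_sum
  proof (intro sum.cong refl)
    fix p assume "p \<in> S"
    then have "p \<noteq> 0" using assms(2) by metis
    then show "Poly_Mapping.lookup (Poly_Mapping.single (p - 1) 1) k = (if p = Suc k then 1 else 0)"
      by (cases p) (auto simp: lookup_single when_def)
  qed
  then show ?thesis using assms(1) by simp
qed

lemma index_mono_inj:
  assumes "finite S" "0 \<notin> S" "finite T" "0 \<notin> T" "index_mono S = index_mono T"
  shows "S = T"
proof (rule set_eqI)
  fix p
  show "p \<in> S \<longleftrightarrow> p \<in> T"
  proof (cases p)
    case 0 then show ?thesis using assms(2,4) by simp
  next
    case (Suc q)
    have "(if Suc q \<in> S then 1 else 0 :: nat) = (if Suc q \<in> T then 1 else 0)"
      unfolding lookup_index_mono[OF assms(1,2), symmetric] lookup_index_mono[OF assms(3,4), symmetric] assms(5) ..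
    then show ?thesis unfolding Suc by (simp split: if_splits)
  qed
qed

lemma prod_cpol: "finite S \<Longrightarrow> 0 \<notin> S \<Longrightarrow> prod cpol S = Poly_Mapping.single (index_mono S) 1"
proof (induction S rule: finite_induct)
  case (insert p S)
  then obtain q where "p = Suc q" by (cases p) auto
  then show ?case using insert by (simp add: index_mono_def mvar_def mult_single)
qed (simp add: index_mono_def)

text \<open>Modulo 2 the ideal is generated by the squares c_p^2, so a squarefree monomial cannot
  occur with an odd coefficient.\<close>

lemma Gideal_even_squarefree:
  assumes "f \<in> Gideal" "finite S" "0 \<notin> S"
  shows "even (Poly_Mapping.lookup f (index_mono S))"
proof -
  obtain A g where A: "finite A" "A \<subseteq> {1..}" "f = (\<Sum>p\<in>A. g p * Grel cpol p)"
    using assms(1) Gideal_sum by blast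
  have "even (Poly_Mapping.lookup (g p * Grel cpol p) (index_mono S))" if p: "p \<in> A" for p
  proof -
    have p1: "p \<ge> 1" using p A by auto
    have no: "\<not> (\<exists>m'. index_mono S = m' + sq_mono p)"
    proof
      assume "\<exists>m'. index_mono S = m' + sq_mono p"
      then obtain m' where "index_mono S = m' + sq_mono p" by blast
      then have "Poly_Mapping.lookup (index_mono S) (p - 1) \<ge> 2"
        by (simp add: lookup_add sq_mono_def)
      then show False using lookup_index_mono[OF assms(2,3), of "p - 1"] by (auto split: if_splits)
    qed
    have "g p * Grel cpol p = g p * Poly_Mapping.single (sq_mono p) 1 + 2 * (g p * Grest p)"
      by (simp add: Grel_cpol cpol_square[OF p1] algebra_simps)
    then have "Poly_Mapping.lookup (g p * Grel cpol p) (index_mono S) = 2 * Poly_Mapping.lookup (g p * Grest p) (index_mono S)"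
      using no by (simp add: lookup_add lookup_mult_sq lookup_two_mult)
    then show ?thesis by simp
  qed
  then show ?thesis unfolding A(3) lookup_sum by (intro dvd_sum) auto
qed

text \<open>Lifted to polynomials, the sum differs from an even polynomial by an element of the
  ideal, whose squarefree coefficients are even.\<close>

lemma squarefree_sum_even:
  assumes F: "index_family F" and e: "squarefree_sum F c = 2 * h" and S: "S \<in> F"
  shows "even (c S)"
proof -
  obtain H where H: "h = abs_gamma H" using gamma_abs by blast
  let ?f = "\<Sum>T\<in>F. of_int (c T) * prod cpol T"
  have "abs_gamma ?f = squarefree_sum F c"
    by (simp add: squarefree_sum_def hom_simps[OF is_ring_hom_abs_gamma] abs_gamma_cpol)
  then have "abs_gamma (?f - 2 * H) = 0"
    using e by (simp add: hom_simps[OF is_ring_hom_abs_gamma] H)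
  then have I: "?f - 2 * H \<in> Gideal" by (simp add: abs_gamma_eq_0)
  have fS: "finite S" "0 \<notin> S" and fin: "finite F" using F S by (auto simp: index_family_def)
  have "Poly_Mapping.lookup ?f (index_mono S) = (\<Sum>T\<in>F. if T = S then c T else 0)"
    unfolding lookup_sum
  proof (intro sum.cong refl)
    fix T assume T: "T \<in> F"
    then have fT: "finite T" "0 \<notin> T" using F by (auto simp: index_family_def)
    have "of_int (c T) * prod cpol T = Poly_Mapping.single (index_mono T) (c T)"
      unfolding prod_cpol[OF fT] mconst_int[symmetric] mconst_def by (simp add: mult_single)
    then show "Poly_Mapping.lookup (of_int (c T) * prod cpol T) (index_mono S) = (if T = S then c T else 0)"
      using index_mono_inj[OF fT fS] by (auto simp: lookup_single when_def)
  qed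
  also have "\<dots> = c S" using fin S by simp
  finally have "Poly_Mapping.lookup (?f - 2 * H) (index_mono S) = c S - 2 * Poly_Mapping.lookup H (index_mono S)"
    by (simp add: lookup_minus lookup_two_mult)
  then show ?thesis using Gideal_even_squarefree[OF I fS] by simp
qed

text \<open>Half of s_0 c_p - c_p.\<close>

definition s0_diff :: "nat \<Rightarrow> gxy" where
  "s0_diff p = (\<Sum>j=1..p. xv 1 ^ j * cc (p - j))"

text \<open>The part linear in 2 is a derivation; terms with two or more factors
  \<open>s0_diff\<close> carry the factor 4.\<close>

lemma prod_s0c:
  assumes "finite S"
  shows "\<exists>E. prod s0c S = prod cc S + 2 * (\<Sum>q\<in>S. s0_diff q * prod cc (S - {q})) + 4 * E"
  using assms
proof (induction S rule: finite_induct)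
  case empty show ?case by (intro exI[of _ 0]) simp
next
  case (insert p S)
  let ?D = "\<lambda>S. \<Sum>q\<in>S. s0_diff q * prod cc (S - {q})"
  obtain E where E: "prod s0c S = prod cc S + 2 * ?D S + 4 * E" using insert by blast
  have "(\<Sum>q\<in>S. s0_diff q * prod cc (insert p S - {q})) = (\<Sum>q\<in>S. cc p * (s0_diff q * prod cc (S - {q})))"
  proof (intro sum.cong refl)
    fix q assume "q \<in> S"
    then have "insert p S - {q} = insert p (S - {q})" using insert.hyps by auto
    then show "s0_diff q * prod cc (insert p S - {q}) = cc p * (s0_diff q * prod cc (S - {q}))"
      using insert.hyps by (simp add: mult_ac)
  qed
  then have D: "?D (insert p S) = s0_diff p * prod cc S + cc p * ?D S"
    using insert.hyps by (simp add: sum_distrib_left)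
  have "s0c p = cc p + 2 * s0_diff p" by (simp add: s0c_def s0_diff_def)
  then have "prod s0c (insert p S) = (cc p + 2 * s0_diff p) * (prod cc S + 2 * ?D S + 4 * E)"
    using insert.hyps E by simp
  also have "\<dots> = prod cc (insert p S) + 2 * ?D (insert p S) + 4 * (cc p * E + s0_diff p * ?D S + 2 * (s0_diff p * E))"
    unfolding D using insert.hyps by (simp add: algebra_simps)
  finally show ?case by blast
qed

lemma lookup_x_power_mult: "Poly_Mapping.lookup (xv 1 ^ j * mconst a) (Poly_Mapping.single (XV 0) k) = (if j = k then a else 0)"
proof -
  have "xv 1 ^ j * mconst a = Poly_Mapping.single (Poly_Mapping.single (XV 0) j) a"
    by (simp add: xv_def mvar_power mconst_def mult_single)
  moreover have "Poly_Mapping.single (XV 0) j = Poly_Mapping.single (XV 0) k \<longleftrightarrow> j = k"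
    by (metis lookup_single_eq)
  ultimately show ?thesis by (simp add: lookup_single when_def)
qed

lemma lookup_s0_diff:
  assumes "k \<ge> 1"
  shows "Poly_Mapping.lookup (s0_diff q * mconst a) (Poly_Mapping.single (XV 0) k) = (if k \<le> q then gc (q - k) * a else 0)"
proof -
  have "s0_diff q * mconst a = (\<Sum>j=1..q. xv 1 ^ j * mconst (gc (q - j) * a))"
    by (simp add: s0_diff_def sum_distrib_right cc_def mconst_hom_simps mult.assoc)
  then have "Poly_Mapping.lookup (s0_diff q * mconst a) (Poly_Mapping.single (XV 0) k)
      = (\<Sum>j=1..q. if j = k then gc (q - j) * a else 0)"
    by (simp only: lookup_sum lookup_x_power_mult)
  then show ?thesis using assms by simp
qed

lemma s_act_mconst_cc: "s_act 0 (mconst (squarefree_sum F c)) = (\<Sum>S\<in>F. of_int (c S) * prod s0c S)"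
  "mconst (squarefree_sum F c) = (\<Sum>S\<in>F. of_int (c S) * prod cc S)"
proof -
  show 1: "mconst (squarefree_sum F c) = (\<Sum>S\<in>F. of_int (c S) * prod cc S)"
    by (simp add: squarefree_sum_def hom_simps[OF is_ring_hom_mconst] cc_def)
  show "s_act 0 (mconst (squarefree_sum F c)) = (\<Sum>S\<in>F. of_int (c S) * prod s0c S)"
    unfolding 1 by (simp add: s_act_hom s_act_simps)
qed

text \<open>Modulo 4, the difference \<open>s\<^sub>0 g - g\<close> is twice a derivative of \<open>g\<close>; its coefficient at
  \<open>x\<^sub>1\<^sup>p\<close>, for the largest index \<open>p\<close> carrying an odd coefficient, is a squarefree sum.\<close>

lemma s0_invariant_even:
  assumes F: "index_family F" "{} \<notin> F" and inv: "s_act 0 (mconst (squarefree_sum F c)) = mconst (squarefree_sum F c)"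
    and S: "S \<in> F"
  shows "even (c S)"
proof (rule ccontr)
  assume odd: "odd (c S)"
  have fS: "finite S" "0 \<notin> S" if "S \<in> F" for S using F that by (auto simp: index_family_def)
  have finF: "finite F" using F by (simp add: index_family_def)
  \<comment> \<open>All indices occurring with an odd coefficient; the largest of them will isolate
    a single summand.\<close>
  define U where "U = \<Union> {S \<in> F. odd (c S)}"
  have U: "finite U" "U \<noteq> {}" using finF fS odd S F(2) by (auto simp: U_def)
  define k where "k = Max U"
  have k: "k \<in> U" "\<And>p. p \<in> U \<Longrightarrow> p \<le> k" using U by (auto simp: k_def)
  have k1: "k \<ge> 1" using k(1) fS(2) by (cases k) (auto simp: U_def)
  define d where "d S = (\<Sum>q\<in>S. s0_diff q * prod cc (S - {q}))" for S
  have "\<forall>S. \<exists>E. S \<in> F \<longrightarrow> prod s0c S = prod cc S + 2 * d S + 4 * E"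
    unfolding d_def using prod_s0c[OF fS(1)] by blast
  from choice[OF this] obtain E
    where E: "\<And>S. S \<in> F \<Longrightarrow> prod s0c S = prod cc S + 2 * d S + 4 * E S"
    by blast
  have "(\<Sum>S\<in>F. of_int (c S) * prod s0c S) = (\<Sum>S\<in>F. of_int (c S) * prod cc S)
      + 2 * ((\<Sum>S\<in>F. of_int (c S) * d S) + 2 * (\<Sum>S\<in>F. of_int (c S) * E S))"
    unfolding sum_distrib_left sum.distrib[symmetric]
    by (intro sum.cong refl) (simp add: E algebra_simps)
  \<comment> \<open>Invariance makes the difference vanish; one factor 2 cancels and leaves a
    congruence modulo 2.\<close>
  then have "2 * ((\<Sum>S\<in>F. of_int (c S) * d S) + 2 * (\<Sum>S\<in>F. of_int (c S) * E S)) = 0"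
    using trans[OF s_act_mconst_cc(1)[symmetric] trans[OF inv s_act_mconst_cc(2)]] by simp
  then have z: "(\<Sum>S\<in>F. of_int (c S) * d S) + 2 * (\<Sum>S\<in>F. of_int (c S) * E S) = 0"
    using nzd_two by (simp add: nzd_def)
  let ?m = "Poly_Mapping.single (XV 0) k"
  define e where "e = Poly_Mapping.lookup (\<Sum>S\<in>F. of_int (c S) * E S) ?m"
  define t where "t S = (\<Sum>q\<in>S. if k \<le> q then gc (q - k) * prod gc (S - {q}) else 0)" for S
  have lt: "Poly_Mapping.lookup (of_int (c S) * d S) ?m = of_int (c S) * t S" for S
  proof -
    have "of_int (c S) * d S = (\<Sum>q\<in>S. s0_diff q * mconst (of_int (c S) * prod gc (S - {q})))"
      by (simp add: d_def sum_distrib_left hom_simps[OF is_ring_hom_mconst] cc_def mult_ac)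
    then have "Poly_Mapping.lookup (of_int (c S) * d S) ?m = (\<Sum>q\<in>S. if k \<le> q then gc (q - k) * (of_int (c S) * prod gc (S - {q})) else 0)"
      by (simp only: lookup_sum lookup_s0_diff[OF k1])
    then show ?thesis unfolding t_def sum_distrib_left by (simp add: mult_ac if_distrib cong: if_cong)
  qed
  have "0 = Poly_Mapping.lookup ((\<Sum>S\<in>F. of_int (c S) * d S) + 2 * (\<Sum>S\<in>F. of_int (c S) * E S)) ?m"
    unfolding z by simp
  also have "\<dots> = (\<Sum>S\<in>F. of_int (c S) * t S) + 2 * e"
    unfolding lookup_add lookup_two_mult e_def lookup_sum[of "\<lambda>S. of_int (c S) * d S"] lt ..
  finally have z2: "(\<Sum>S\<in>F. of_int (c S) * t S) = - 2 * e" by (simp add: eq_neg_iff_add_eq_0)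
  let ?O = "{S \<in> F. odd (c S)}" and ?K = "{S \<in> F. odd (c S) \<and> k \<in> S}"
  have "(\<Sum>S\<in>F. of_int (c S) * t S) = (\<Sum>S\<in>?O. of_int (c S) * t S) + (\<Sum>S\<in>F - ?O. of_int (c S) * t S)"
    using finF by (subst sum.subset_diff[of ?O]) (auto simp: add.commute)
  also have "(\<Sum>S\<in>F - ?O. of_int (c S) * t S) = 2 * (\<Sum>S\<in>F - ?O. of_int (c S div 2) * t S)"
    unfolding sum_distrib_left
  proof (intro sum.cong refl)
    fix S assume "S \<in> F - ?O"
    then obtain b where "c S = 2 * b" by auto
    then show "of_int (c S) * t S = 2 * (of_int (c S div 2) * t S)" by simp
  qed
  also have "(\<Sum>S\<in>?O. of_int (c S) * t S) = (\<Sum>S\<in>?K. of_int (c S) * prod gc (S - {k}))"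
  proof (rule sum.mono_neutral_cong_right)
    show "finite ?O" "?K \<subseteq> ?O" using finF by auto
    have tO: "t S = (if k \<in> S then prod gc (S - {k}) else 0)" if "S \<in> ?O" for S
    proof -
      \<comment> \<open>By maximality of k only q = k contributes to the coefficient, with the
        factor c_0 = 1.\<close>
      have "q \<le> k" if "q \<in> S" for q using k(2)[of q] that \<open>S \<in> ?O\<close> by (auto simp: U_def)
      then have "t S = (\<Sum>q\<in>S. if q = k then prod gc (S - {k}) else 0)"
        unfolding t_def by (intro sum.cong refl) (auto simp: gc_0 dest: le_antisym)
      then show ?thesis using fS(1)[of S] that by simp
    qed
    show "\<forall>S\<in>?O - ?K. of_int (c S) * t S = 0" using tO by auto
    show "of_int (c S) * t S = of_int (c S) * prod gc (S - {k})" if "S \<in> ?K" for S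
      using tO[of S] that by auto
  qed
  also have "\<dots> = squarefree_sum ((\<lambda>S. S - {k}) ` ?K) (\<lambda>T. c (insert k T))"
  proof -
    have "inj_on (\<lambda>S. S - {k}) ?K" by (rule inj_on_inverseI[of _ "insert k"]) auto
    then show ?thesis unfolding squarefree_sum_def
      by (subst sum.reindex) (auto intro!: sum.cong simp: insert_absorb)
  qed
  finally have e2: "squarefree_sum ((\<lambda>S. S - {k}) ` ?K) (\<lambda>T. c (insert k T)) = 2 * (- e - (\<Sum>S\<in>F - ?O. of_int (c S div 2) * t S))"
    unfolding z2 by (simp add: algebra_simps)
  have fam: "index_family ((\<lambda>S. S - {k}) ` ?K)" using finF fS by (auto simp: index_family_def)
  obtain T where T: "T \<in> ?K" using k(1) unfolding U_def by blast
  have "even (c (insert k (T - {k})))"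
    by (rule squarefree_sum_even[OF fam e2]) (use T in blast)
  then show False using T by (simp add: insert_absorb)
qed

text \<open>Infinite descent: all coefficients are even, and halving them keeps invariance because 2
  can be cancelled, while the sum of absolute values drops unless it is 0.\<close>

lemma s0_invariant_zero:
  assumes F: "index_family F" "{} \<notin> F" and inv: "s_act 0 (mconst (squarefree_sum F c)) = mconst (squarefree_sum F c)"
  shows "\<forall>S\<in>F. c S = 0"
  using inv
proof (induction "\<Sum>S\<in>F. nat \<bar>c S\<bar>" arbitrary: c rule: less_induct)
  case less
  have finF: "finite F" using F by (simp add: index_family_def)
  show ?case
  proof (rule ccontr)
    assume "\<not> (\<forall>S\<in>F. c S = 0)"
    then obtain T where T: "T \<in> F" "c T \<noteq> 0" by blast
    have ev: "even (c S)" if "S \<in> F" for S by (rule s0_invariant_even[OF F less.prems that])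
    let ?c = "\<lambda>S. c S div 2"
    have two: "squarefree_sum F c = 2 * squarefree_sum F ?c"
      unfolding squarefree_sum_def sum_distrib_left
    proof (intro sum.cong refl)
      fix S assume "S \<in> F"
      then obtain b where "c S = 2 * b" using ev by blast
      then show "of_int (c S) * prod gc S = 2 * (of_int (?c S) * prod gc S)" by simp
    qed
    have "2 * s_act 0 (mconst (squarefree_sum F ?c)) = 2 * mconst (squarefree_sum F ?c)"
      using less.prems unfolding two by (simp add: hom_simps[OF is_ring_hom_mconst] s_act_hom)
    then have inv': "s_act 0 (mconst (squarefree_sum F ?c)) = mconst (squarefree_sum F ?c)"
      by (rule nzd_cancel[OF nzd_two])
    have "(\<Sum>S\<in>F. nat \<bar>?c S\<bar>) < (\<Sum>S\<in>F. nat \<bar>c S\<bar>)"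
    proof (rule sum_strict_mono_ex1[OF finF])
      show "\<forall>S\<in>F. nat \<bar>?c S\<bar> \<le> nat \<bar>c S\<bar>" by auto
      show "\<exists>S\<in>F. nat \<bar>?c S\<bar> < nat \<bar>c S\<bar>" using T ev[OF T(1)] by (intro bexI[of _ T]) auto
    qed
    then have "?c T = 0" using less.hyps[OF _ inv'] T by blast
    then show False using T(2) ev[OF T(1)] by auto
  qed
qed

text \<open>The coefficient of the empty product is the integer sought; the rest remains invariant
  and is therefore 0.\<close>

lemma s0_invariant_int:
  assumes inv: "s_act 0 (mconst g) = mconst g"
  shows "\<exists>z. g = of_int z"
proof -
  obtain F c where F: "index_family F" "g = squarefree_sum F c" using gamma_squarefree by blast
  have finF: "finite F" using F by (simp add: index_family_def)
  let ?z = "if {} \<in> F then c {} else 0"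
  have g: "g = of_int ?z + squarefree_sum (F - {{}}) c"
    unfolding F(2) squarefree_sum_def using finF
    by (cases "{} \<in> F") (simp_all add: sum.remove[of F "{}"])
  have "s_act 0 (mconst (squarefree_sum (F - {{}}) c)) = mconst (squarefree_sum (F - {{}}) c)"
    using inv unfolding g by (simp add: hom_simps[OF is_ring_hom_mconst] s_act_hom)
  then have "\<forall>S\<in>F - {{}}. c S = 0"
    using F(1) by (intro s0_invariant_zero) (auto simp: index_family_def)
  then have "squarefree_sum (F - {{}}) c = 0" unfolding squarefree_sum_def by (intro sum.neutral) auto
  then have "g = of_int ?z" using g by (simp only: add_0_right)
  then show ?thesis by blast
qed

section \<open>Type C Schubert polynomials\<close>

definition kill_x :: "nat \<Rightarrow> gxy \<Rightarrow> gxy" where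
  "kill_x k = peval mconst (\<lambda>v. if v = XV k then 0 else mvar v)"

lemma is_ring_hom_kill_x: "is_ring_hom (kill_x k)"
  unfolding kill_x_def by (rule peval_ring_hom[OF is_ring_hom_mconst])

lemma kill_x_simps:
  "kill_x k (cc p) = cc p" "i \<ge> 1 \<Longrightarrow> kill_x k (xv i) = (if i = Suc k then 0 else xv i)" "kill_x k (yv i) = yv i"
  by (auto simp: kill_x_def cc_def xv_def yv_def peval_mconst[OF is_ring_hom_mconst] peval_mvar[OF is_ring_hom_mconst])

text \<open>A polynomial without \<open>x\<^bsub>D+1\<^esub>\<close> which is fixed by \<open>s\<^sub>D\<close> does not contain \<open>x\<^sub>D\<close> either: exchange
  the two variables and set \<open>x\<^bsub>D+1\<^esub> = 0\<close>.\<close>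

lemma symmetric_drop_x:
  assumes Y: "Y \<subseteq> range (\<lambda>k. yv (Suc k))" and f: "f \<in> ring_gen (range cc \<union> xv ` {1..D} \<union> Y)"
    and inv: "\<And>i. i > d \<Longrightarrow> s_act i f = f"
  shows "f \<in> ring_gen (range cc \<union> xv ` {1..d} \<union> Y)"
  using f
proof (induction D)
  case 0
  then show ?case by (rule subsetD[OF ring_gen_mono, rotated]) auto
next
  case (Suc D)
  show ?case
  proof (cases "Suc D \<le> d")
    case True
    then show ?thesis using Suc.prems by (intro subsetD[OF ring_gen_mono, rotated, OF Suc.prems]) auto
  next
    case False
    let ?i = "Suc D"
    have "f = kill_x ?i f"
      by (rule hom_eq_on_ring_gen[of id "kill_x ?i", unfolded id_apply, OF _ is_ring_hom_kill_x _ Suc.prems])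
         (use Y in \<open>auto simp: is_ring_hom_def kill_x_simps\<close>)
    also have "\<dots> = (kill_x ?i \<circ> s_act ?i) f" using inv[of ?i] False by simp
    also have "\<dots> \<in> ring_gen (range cc \<union> xv ` {1..D} \<union> Y)"
    proof (rule hom_ring_gen[OF is_ring_hom_comp[OF is_ring_hom_kill_x is_ring_hom_s_act] is_subring_ring_gen _ Suc.prems])
      fix g assume g: "g \<in> range cc \<union> xv ` {1..Suc D} \<union> Y"
      then consider p where "g = cc p" | i where "g = xv i" "i \<in> {1..D}" | "g = xv (Suc D)"
        | k where "g = yv (Suc k)" "g \<in> Y"
        using Y by (auto simp: atLeastAtMostSuc_conv)
      then show "(kill_x ?i \<circ> s_act ?i) g \<in> ring_gen (range cc \<union> xv ` {1..D} \<union> Y)"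
      proof cases
        case 1 then show ?thesis by (auto simp: s_act_simps kill_x_simps intro: ring_gen.gen)
      next
        case 2
        then have "(kill_x ?i \<circ> s_act ?i) g = g" by (auto simp: s_act_simps kill_x_simps)
        then show ?thesis using 2 by (auto intro!: ring_gen.gen)
      next
        case 3 then show ?thesis by (auto simp: s_act_simps kill_x_simps intro: ring_gen_intros)
      next
        case 4
        then have "(kill_x ?i \<circ> s_act ?i) g = g" by (simp add: s_act_simps kill_x_simps)
        then show ?thesis using 4 by (auto intro!: ring_gen.gen)
      qed
    qed
    finally show ?thesis by (rule Suc.IH)
  qed
qed

lemma xv_image: "(\<lambda>k. xv (Suc k)) ` {..<D} = xv ` {1..D}"
  by (simp add: image_image[symmetric, of xv Suc] image_Suc_lessThan)

text \<open>Any element involves finitely many x-variables, and \<open>symmetric_drop_x\<close>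
  removes them from the top down to d.\<close>

lemma symmetric_finitely_many_x:
  assumes Y: "Y \<subseteq> range (\<lambda>k. yv (Suc k))" and f: "f \<in> ring_gen (range cc \<union> range (\<lambda>k. xv (Suc k)) \<union> Y)"
    and inv: "\<And>i. i > d \<Longrightarrow> s_act i f = f"
  shows "f \<in> ring_gen (range cc \<union> xv ` {1..d} \<union> Y)"
proof -
  have "f \<in> ring_gen (range cc \<union> Y \<union> range (\<lambda>k. xv (Suc k)))"
    using f by (simp only: Un_ac)
  then obtain D where "f \<in> ring_gen (range cc \<union> Y \<union> xv ` {1..D})"
    using ring_gen_finite_range unfolding xv_image[symmetric] by blast
  then have "f \<in> ring_gen (range cc \<union> xv ` {1..D} \<union> Y)" by (simp only: Un_ac)
  then show ?thesis by (rule symmetric_drop_x[OF Y _ inv])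
qed

section \<open>Invariants of W_inf in Gamma[X, Y]\<close>

lemma is_ring_hom_omega: "is_ring_hom omega"
  unfolding omega_def by (rule peval_ring_hom[OF is_ring_hom_mconst])

lemma omega_simps: "omega (cc p) = cc p" "i \<ge> 1 \<Longrightarrow> omega (xv i) = - yv i" "i \<ge> 1 \<Longrightarrow> omega (yv i) = - xv i"
  by (simp_all add: omega_def cc_def xv_def yv_def peval_mconst[OF is_ring_hom_mconst] peval_mvar[OF is_ring_hom_mconst])

lemma omega_omega: "omega (omega f) = f"
  by (rule gxy_hom_eqI[of "\<lambda>f. omega (omega f)" id, unfolded id_apply])
     (use is_ring_hom_omega in \<open>auto simp: is_ring_hom_def omega_simps hom_uminus\<close>)

text \<open>Invariance in the x removes all x-variables; \<open>omega\<close> turns invariance in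
  the y into invariance in the x and so removes the y-variables too. What is left lies in Gamma and
  is fixed by s_0.\<close>

lemma W_inf_invariant_const:
  assumes x: "\<And>i. ddx i f = 0" and y: "\<And>i. ddy i f = 0"
  shows "\<exists>z. f = of_int z"
proof -
  have wf: "s_act i (omega f) = omega f" for i
  proof -
    have "omega (omega (ddx i (omega f))) = omega 0" using y[of i] by (simp add: ddy_def)
    then show ?thesis by (simp add: omega_omega is_ring_hom_zero[OF is_ring_hom_omega] ddx_eq_0)
  qed
  have "f \<in> ring_gen (range cc \<union> xv ` {1..0} \<union> range (\<lambda>k. yv (Suc k)))"
    by (rule symmetric_finitely_many_x[OF order_refl gxy_ring_gen]) (use x in \<open>simp add: ddx_eq_0\<close>)
  then have "omega f \<in> ring_gen (range cc \<union> range (\<lambda>k. xv (Suc k)))"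
  proof (rule hom_ring_gen[OF is_ring_hom_omega is_subring_ring_gen, rotated])
    fix g assume "g \<in> range cc \<union> xv ` {1..0} \<union> range (\<lambda>k. yv (Suc k))"
    then consider p where "g = cc p" | k where "g = yv (Suc k)" by auto
    then show "omega g \<in> ring_gen (range cc \<union> range (\<lambda>k. xv (Suc k)))"
    proof cases
      case 1 then show ?thesis by (auto simp: omega_simps intro: ring_gen.gen)
    next
      case (2 k)
      have "xv (Suc k) \<in> ring_gen (range cc \<union> range (\<lambda>k. xv (Suc k)))" by (rule ring_gen.gen) blast
      then show ?thesis using 2 by (simp add: omega_simps ring_gen_intros(5))
    qed
  qed
  then have "omega f \<in> ring_gen (range cc \<union> range (\<lambda>k. xv (Suc k)) \<union> {})" by simp
  then have "omega f \<in> ring_gen (range cc \<union> xv ` {1..0} \<union> {})"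
    by (rule symmetric_finitely_many_x[rotated]) (simp_all add: wf)
  then have wc: "omega f \<in> ring_gen (range cc)" by simp
  \<comment> \<open>\<open>omega\<close> fixes Gamma, so f itself lies there.\<close>
  have "omega (omega f) = omega f"
    by (rule hom_eq_on_ring_gen[of omega id, unfolded id_apply, OF is_ring_hom_omega _ _ wc])
       (auto simp: omega_simps is_ring_hom_def)
  then have "f \<in> ring_gen (range cc)" using wc by (simp add: omega_omega)
  also have "ring_gen (range cc) \<subseteq> range mconst"
  proof (rule ring_gen_subset)
    show "is_subring (range mconst :: gxy set)"
      unfolding is_subring_def
      by (auto simp: mconst_hom_simps[symmetric])
    show "range cc \<subseteq> range mconst" by (auto simp: cc_def)
  qed
  finally obtain g where g: "f = mconst g" by blast
  have "s_act 0 (mconst g) = mconst g" using x[of 0] by (simp add: g ddx_eq_0)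
  then obtain z where "g = of_int z" using s0_invariant_int by blast
  then show ?thesis using g by (auto simp: hom_of_int[OF is_ring_hom_mconst])
qed

lemma const_term_of_int: "const_term (of_int z) = z"
proof -
  let ?a = "\<lambda>p. if p = 0 then 1 else 0 :: int"
  have "Grel ?a p = 0" if "p \<ge> 1" for p
    using that by (auto simp: Grel_def intro!: sum.neutral)
  then have h: "is_ring_hom (gamma_eval ?a)" by (intro gamma_eval_ring_hom) auto
  have "(of_int z :: gxy) = mconst (of_int z)" by (simp add: hom_of_int[OF is_ring_hom_mconst])
  then have "Poly_Mapping.lookup (of_int z :: gxy) 0 = of_int z" by (simp only: mconst_def lookup_single_eq)
  then show ?thesis by (simp add: const_term_def hom_of_int[OF h])
qed

section \<open>Specialization of the y-variables to 0\<close>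

lemma is_ring_hom_Y_to_zero: "is_ring_hom Y_to_zero"
  unfolding Y_to_zero_def by (rule peval_ring_hom[OF is_ring_hom_mconst])

lemma Y_to_zero_simps: "Y_to_zero (cc p) = cc p" "i \<ge> 1 \<Longrightarrow> Y_to_zero (xv i) = xv i" "Y_to_zero (yv i) = 0"
  by (simp_all add: Y_to_zero_def cc_def xv_def yv_def peval_mconst[OF is_ring_hom_mconst] peval_mvar[OF is_ring_hom_mconst])

lemma Y_to_zero_s_act: "Y_to_zero (s_act i f) = s_act i (Y_to_zero f)"
proof (rule gxy_hom_eqI[of "\<lambda>f. Y_to_zero (s_act i f)" "\<lambda>f. s_act i (Y_to_zero f)"])
  note h = hom_simps[OF is_ring_hom_Y_to_zero]
  show "is_ring_hom (\<lambda>f. Y_to_zero (s_act i f))" "is_ring_hom (\<lambda>f. s_act i (Y_to_zero f))"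
    by (simp_all add: is_ring_hom_def h s_act_hom)
  show "Y_to_zero (s_act i (cc p)) = s_act i (Y_to_zero (cc p))" for p
    using Y_to_zero_simps(2)[of 1] by (simp add: Y_to_zero_simps s_act_simps s0c_def h)
  show "Y_to_zero (s_act i (xv j)) = s_act i (Y_to_zero (xv j))" if "j \<ge> 1" for j
    using that by (auto simp: Y_to_zero_simps s_act_simps h)
  show "Y_to_zero (s_act i (yv j)) = s_act i (Y_to_zero (yv j))" if "j \<ge> 1" for j
    using that by (simp add: Y_to_zero_simps s_act_simps s_act_hom)
qed

lemma Y_to_zero_ddx: "ddx i (Y_to_zero f) = Y_to_zero (ddx i f)"
proof (rule ddx_unique)
  note h = hom_simps[OF is_ring_hom_Y_to_zero]
  have "Y_to_zero (ddenom i) = ddenom i"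
    by (auto simp: ddenom_def h Y_to_zero_simps)
  then have "ddenom i * Y_to_zero (ddx i f) = Y_to_zero (ddenom i * ddx i f)" by (simp add: h)
  also have "\<dots> = Y_to_zero f - s_act i (Y_to_zero f)" by (simp add: ddx_eq h Y_to_zero_s_act)
  finally show "ddenom i * Y_to_zero (ddx i f) = Y_to_zero f - s_act i (Y_to_zero f)" .
qed

theorem schubertC_basis:
  assumes CC: "is_schubertC_family CC"
  shows "free_with_basis (Gamma_n n) (GX n) (W n) (\<lambda>w. Y_to_zero (CC w))"
proof -
  interpret C: nil_coxeter sgen "{..<n}" "W n" C_length ddx by (rule nil_coxeter_W)
  have x: "ddx i (CC w) = (if C_length (w \<circ> sgen i) < C_length w then CC (w \<circ> sgen i) else 0)" if "w \<in> Winf" for w i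
    using CC that Winf_comp_sgen[OF that] by (simp add: is_schubertC_family_def ell_eq)
  have id: "id \<in> Winf" using W_Winf[OF id_W] .
  \<comment> \<open>No generator lowers the identity, so every operator kills \<open>CC id\<close>,
    which is thus an integer; its constant term is 1.\<close>
  have "ell id = 0" using ell_eq[OF id] by (simp only: C_length_id)
  then have "ddx i (CC id) = 0" "ddy i (CC id) = 0" "const_term (CC id) = 1" for i
    using CC id unfolding is_schubertC_family_def by force+
  moreover from this obtain z where "CC id = of_int z" using W_inf_invariant_const by blast
  ultimately have one: "CC id = 1" by (simp add: const_term_of_int)
  \<comment> \<open>No generator beyond n is a descent of w, so \<open>CC w\<close> is free of the
    x-variables beyond x_n; its y-variables are set to 0.\<close>
  have GX: "Y_to_zero (CC w) \<in> GX n" if w: "w \<in> W n" for w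
  proof -
    have "s_act i (CC w) = CC w" if i: "i > n" for i
    proof -
      have p: "w permutes {- int n..int n}" using w by (simp add: W_def)
      have "w (int i) = int i" "w (int i + 1) = int i + 1" using permutes_not_in[OF p] i by auto
      then have "\<not> C_descent w i" using i by (simp add: C_descent_def)
      then show ?thesis using x[OF W_Winf[OF w], of i] C_length_less_iff[OF W_Winf[OF w]] by (simp add: ddx_eq_0)
    qed
    then have "CC w \<in> ring_gen (range cc \<union> xv ` {1..n} \<union> range (\<lambda>k. yv (Suc k)))"
      by (rule symmetric_finitely_many_x[OF order_refl gxy_ring_gen])
    then show ?thesis
      by (rule hom_ring_gen[OF is_ring_hom_Y_to_zero is_subring_GX, rotated])
         (auto simp: Y_to_zero_simps GX_cc subring_zero[OF is_subring_GX] intro!: GX_xv)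
  qed
  have "free_with_basis (C.Inv (GX n)) (GX n) (W n) (\<lambda>w. Y_to_zero (CC w))"
  proof (rule C.free_over_Inv[OF is_subring_GX finite_W _ GX])
    show "Y_to_zero (CC id) = 1" by (simp only: one is_ring_homD(1)[OF is_ring_hom_Y_to_zero])
    show "ddx i (Y_to_zero (CC w)) = (if C_length (w \<circ> sgen i) < C_length w then Y_to_zero (CC (w \<circ> sgen i)) else 0)"
      if "w \<in> W n" for w i
      unfolding Y_to_zero_ddx x[OF W_Winf[OF that]] by (simp add: is_ring_hom_zero[OF is_ring_hom_Y_to_zero])
  qed (auto intro: ddx_GX)
  \<comment> \<open>Only here do the invariants of W_n, over which the operators give freeness,
    become the concrete ring Gamma^(n).\<close>
  moreover have "C.Inv (GX n) = Gamma_n n"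
    unfolding W_inv_eq[symmetric] C.Inv_def W_inv_def by auto
  ultimately show ?thesis by simp
qed

theorem corollary4:
  fixes n :: nat
  assumes "n \<ge> 1"
  shows "free_with_basis (GX_sym n) (GX n) {\<pi>. \<pi> permutes {1..n}} (schubertA n)
    \<and> free_with_basis (Gamma_n n) (GX_sym n) (strict_parts n) (Qtilde n (\<lambda>i. - xv i))
    \<and> (\<forall>CC. is_schubertC_family CC \<longrightarrow>
           free_with_basis (Gamma_n n) (GX n) (W n) (\<lambda>w. Y_to_zero (CC w)))
    \<and> free_with_basis (Gamma_n n) (GX n) (strict_parts n \<times> {\<pi>. \<pi> permutes {1..n}})
           (\<lambda>(\<mu>, \<pi>). Qtilde n (\<lambda>i. - xv i) \<mu> * schubertA n \<pi>)"
  by (intro conjI allI impI schubertA_basis Qtilde_basis schubertC_basis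
      free_with_basis_tower[OF Qtilde_basis schubertA_basis])

end
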